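(* Suppose that either (1) $n\ge4$, $m\ge2$ and $\alpha\in\mathbb{N}$, or (2) $n\in\{2,3\}$, $m\ge2$ and $\alpha=1$. Then there exists $C>0$ independent of $k\in\mathbb{N}_0$ such that $$\|P_k(g)\|_{L^\infty(\Omega,d\Omega)}\le C(k+1)^{n+m-2}\|g\|_{L^1(\Omega,d\Omega)}$$ for every $g\in L^1(\Omega,d\Omega)$.
   Context: $\mathbb{N}=\{1,2,\dots\}$, $\mathbb{N}_0=\{0,1,2,\dots\}$. Points of $\mathbb{R}^{n+m}$ are $(x,y)$, $x\in\mathbb{R}^n$, $y\in\mathbb{R}^m$. Polar coordinates $(\rho,\phi,\omega_1,\omega_2)$: $\rho=\left(|x|^{2(\alpha+1)}+(\alpha+1)^2|y|^2\right)^{\frac{1}{2(\alpha+1)}}$, $\phi\in[0,\pi/2]$ with $|x|=\rho\sin^{\frac1{\alpha+1}}\phi$, $|y|=\frac{1}{\alpha+1}\rho^{\alpha+1}\cos\phi$, $\omega_1=x/|x|\in\mathbb{S}^{n-1}$, $\omega_2=y/|y|\in\mathbb{S}^{m-1}$. $\Omega=\{\rho=1\}$ is equipped with $d\Omega=\sin^{\frac{n-2}{\alpha+1}+1}\phi\,\cos^{m-1}\phi\,d\phi\,d\omega_1\,d\omega_2$ ($d\omega_1,d\omega_2$ surface measures on the spheres). Let $\{Y_{\ell,p}\}_{1\le p\le d_\ell(n)}$ be an orthonormal basis of the spherical harmonics of degree $\ell$ on $\mathbb{S}^{n-1}$ ($d_\ell(n)$ the dimension of that space), and similarly $\{Y_{j,q}\}_{1\le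 q\le d_j(m)}$ on $\mathbb{S}^{m-1}$. With $P_N^{(a,b)}$ the Jacobi polynomials, put $\widetilde{k}=\frac{k-\ell-j(\alpha+1)}{2(\alpha+1)}$, $\mu=\frac{n-2+2\ell}{2(\alpha+1)}$, $\gamma=j+\frac m2$, $h_{k,\ell,j}(\phi)=\cos^j\phi\,\sin^{\frac{\ell}{\alpha+1}}\phi\,P_{\widetilde k}^{(\mu,\gamma-1)}(\cos2\phi)$. $\mathcal{H}_k^\alpha$ (restricted to $\Omega$) is the span of $h_{k,\ell,j}(\phi)Y_{\ell,p}(\omega_1)Y_{j,q}(\omega_2)$ over all $0\le\ell,j\le k$ with $\widetilde k\in\mathbb{N}_0$ and all $p,q$; these functions are mutually orthogonal in $L^2(\Omega,d\Omega)$. $P_k:L^2(\Omega,d\Omega)\to\mathcal{H}_k^\alpha$ is the orthogonal projection, which is the integral operator $P_k(g)=\int_\Omega G_k(\cdot,\zeta)g(\zeta)\,d\Omega(\zeta)$ with $G_k(z,\zeta)=\sum_ie_i(z)\overline{e_i(\zeta)}$ for any orthonormal basis $\{e_i\}$ of $\mathcal{H}_k^\alpha$; this formula defines $P_k$ on $L^1(\Omega,d\Omega)$. *)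

theory Defs
  imports "HOL-Analysis.Analysis" "HOL-Probability.Essential_Supremum"
    "HOL-Library.Function_Algebras"
begin

section \<open>Complex-valued functions as a complex vector space\<close>

text \<open>Function spaces on a subset (a sphere, or \<open>\<Omega>\<close>) are represented by functions on the ambient
  type that vanish outside the subset, so that equality of functions is equality on the subset.\<close>

global_interpretation cfun: vector_space
  "\<lambda>(c::complex) (f :: 'a \<Rightarrow> complex). (\<lambda>x. c * f x)"
  defines cspan = cfun.span and cdim = cfun.dim
  by unfold_locales (auto simp: fun_eq_iff algebra_simps)

definition L2_inner :: "'a measure \<Rightarrow> ('a \<Rightarrow> complex) \<Rightarrow> ('a \<Rightarrow> complex) \<Rightarrow> complex" where
  "L2_inner M f g = (\<integral>x. f x * cnj (g x) \<partial>M)"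

definition orthonormal_basis ::
    "'a measure \<Rightarrow> 'i set \<Rightarrow> ('i \<Rightarrow> 'a \<Rightarrow> complex) \<Rightarrow> ('a \<Rightarrow> complex) set \<Rightarrow> bool" where
  "orthonormal_basis M I e V \<longleftrightarrow> finite I \<and>
     (\<forall>i\<in>I. \<forall>i'\<in>I. L2_inner M (e i) (e i') = (if i = i' then 1 else 0)) \<and>
     cspan (e ` I) = V"

section \<open>Spheres and spherical harmonics\<close>

text \<open>Surface measure on the unit sphere of a space of dimension \<open>n\<close>: a Borel set \<open>A\<close> has measure
  \<open>n\<close> times the volume of the cone \<open>{t a | 0 < t < 1, a \<in> A}\<close>. This is the measure \<open>d\<omega>\<close> for which
  Lebesgue measure is \<open>r^(n-1) dr d\<omega>\<close>.\<close>

definition sphere_measure :: "'a::euclidean_space measure" where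
  "sphere_measure = scale_measure (of_nat DIM('a))
     (distr (restrict_space lborel (ball 0 1 - {0})) (restrict_space borel (sphere 0 1))
        (\<lambda>x. x /\<^sub>R norm x))"

definition laplacian :: "('a::euclidean_space \<Rightarrow> complex) \<Rightarrow> 'a \<Rightarrow> complex" where
  "laplacian f x = (\<Sum>b\<in>Basis.
     vector_derivative (\<lambda>s. vector_derivative (\<lambda>t. f (x + t *\<^sub>R b)) (at s)) (at 0))"

text \<open>Restrictions to the unit sphere of the harmonic homogeneous polynomials of degree \<open>l\<close>.\<close>

definition spherical_harmonics :: "nat \<Rightarrow> ('a::euclidean_space \<Rightarrow> complex) set" where
  "spherical_harmonics l = {\<lambda>\<omega>. if \<omega> \<in> sphere 0 1 then p \<omega> else 0 | p.
     polynomial_function p \<and>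
     (\<forall>t x. p (t *\<^sub>R x) = of_real (t ^ l) * p x) \<and>
     (\<forall>x. laplacian p x = 0)}"

definition harmonics_dim :: "'a::euclidean_space itself \<Rightarrow> nat \<Rightarrow> nat" where
  "harmonics_dim _ l = cdim (spherical_harmonics l :: ('a \<Rightarrow> complex) set)"

section \<open>Jacobi polynomials\<close>

text \<open>The standard normalisation, \<open>jacobi_P N a b 1 = (N + a) gchoose N\<close>.\<close>

definition jacobi_P :: "nat \<Rightarrow> real \<Rightarrow> real \<Rightarrow> real \<Rightarrow> real" where
  "jacobi_P N a b x = (\<Sum>s\<le>N. ((real N + a) gchoose (N - s)) * ((real N + b) gchoose s) *
     ((x - 1) / 2) ^ s * ((x + 1) / 2) ^ (N - s))"

section \<open>Polar coordinates and the unit sphere \<open>\<Omega>\<close>\<close>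

definition rho :: "real \<Rightarrow> (real^'n) \<times> (real^'m) \<Rightarrow> real" where
  "rho \<alpha> z = (norm (fst z) powr (2 * (\<alpha> + 1)) + (\<alpha> + 1)\<^sup>2 * (norm (snd z))\<^sup>2)
     powr (1 / (2 * (\<alpha> + 1)))"

definition phi :: "real \<Rightarrow> (real^'n) \<times> (real^'m) \<Rightarrow> real" where
  "phi \<alpha> z = (THE \<phi>. \<phi> \<in> {0..pi/2} \<and>
     norm (fst z) = rho \<alpha> z * sin \<phi> powr (1 / (\<alpha> + 1)) \<and>
     norm (snd z) = 1 / (\<alpha> + 1) * rho \<alpha> z powr (\<alpha> + 1) * cos \<phi>)"

text \<open>The angular variables have the junk value \<open>0\<close> where \<open>x = 0\<close> resp. \<open>y = 0\<close>; these points form a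
  null set of \<open>\<Omega>\<close>.\<close>

definition omega1 :: "(real^'n) \<times> (real^'m) \<Rightarrow> real^'n" where
  "omega1 z = fst z /\<^sub>R norm (fst z)"

definition omega2 :: "(real^'n) \<times> (real^'m) \<Rightarrow> real^'m" where
  "omega2 z = snd z /\<^sub>R norm (snd z)"

definition Omega :: "real \<Rightarrow> ((real^'n) \<times> (real^'m)) set" where
  "Omega \<alpha> = {z. rho \<alpha> z = 1}"

text \<open>The point of \<open>\<Omega>\<close> with coordinates \<open>(\<phi>, \<omega>\<^sub>1, \<omega>\<^sub>2)\<close>.\<close>

definition Omega_param ::
    "real \<Rightarrow> real \<times> (real^'n) \<times> (real^'m) \<Rightarrow> (real^'n) \<times> (real^'m)" where
  "Omega_param \<alpha> = (\<lambda>(\<phi>, \<omega>1, \<omega>2).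
     ((sin \<phi> powr (1 / (\<alpha> + 1))) *\<^sub>R \<omega>1, (1 / (\<alpha> + 1) * cos \<phi>) *\<^sub>R \<omega>2))"

definition Omega_measure :: "real \<Rightarrow> ((real^'n) \<times> (real^'m)) measure" where
  "Omega_measure \<alpha> = distr
     (density (restrict_space lborel {0..pi/2})
        (\<lambda>\<phi>. ennreal (sin \<phi> powr ((real CARD('n) - 2) / (\<alpha> + 1) + 1) * cos \<phi> ^ (CARD('m) - 1)))
      \<Otimes>\<^sub>M ((sphere_measure :: (real^'n) measure) \<Otimes>\<^sub>M (sphere_measure :: (real^'m) measure)))
     (restrict_space borel (Omega \<alpha>)) (Omega_param \<alpha>)"

section \<open>The spaces \<open>H\<^sub>k\<close> and the projections \<open>P\<^sub>k\<close>\<close>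

definition ktilde :: "real \<Rightarrow> nat \<Rightarrow> nat \<Rightarrow> nat \<Rightarrow> real" where
  "ktilde \<alpha> k l j = (real k - real l - real j * (\<alpha> + 1)) / (2 * (\<alpha> + 1))"

definition mu :: "real \<Rightarrow> nat \<Rightarrow> nat \<Rightarrow> real" where
  "mu \<alpha> n l = (real n - 2 + 2 * real l) / (2 * (\<alpha> + 1))"

definition gam :: "nat \<Rightarrow> nat \<Rightarrow> real" where
  "gam m j = real j + real m / 2"

text \<open>Only used when \<open>ktilde \<alpha> k l j\<close> is a natural number. The power \<open>sin\<^bsup>l/(\<alpha>+1)\<^esup> \<phi>\<close> is written as a
  natural power of \<open>sin\<^bsup>1/(\<alpha>+1)\<^esup> \<phi>\<close>, so that it is \<open>1\<close> for \<open>l = 0\<close> also where \<open>sin \<phi> = 0\<close>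
  (whereas \<open>0 powr 0 = 0\<close>).\<close>

definition h_fun :: "real \<Rightarrow> nat \<Rightarrow> nat \<Rightarrow> nat \<Rightarrow> nat \<Rightarrow> nat \<Rightarrow> real \<Rightarrow> real" where
  "h_fun \<alpha> n m k l j \<phi> = cos \<phi> ^ j * (sin \<phi> powr (1 / (\<alpha> + 1))) ^ l *
     jacobi_P (nat \<lfloor>ktilde \<alpha> k l j\<rfloor>) (mu \<alpha> n l) (gam m j - 1) (cos (2 * \<phi>))"

definition H_space ::
    "real \<Rightarrow> (nat \<Rightarrow> nat \<Rightarrow> real^'n \<Rightarrow> complex) \<Rightarrow> (nat \<Rightarrow> nat \<Rightarrow> real^'m \<Rightarrow> complex) \<Rightarrow> nat \<Rightarrow>
     ((real^'n) \<times> (real^'m) \<Rightarrow> complex) set" where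
  "H_space \<alpha> Y Z k = cspan
     {\<lambda>z. if z \<in> Omega \<alpha>
          then of_real (h_fun \<alpha> CARD('n) CARD('m) k l j (phi \<alpha> z)) *
               Y l p (omega1 z) * Z j q (omega2 z)
          else 0 | l j p q.
      l \<le> k \<and> j \<le> k \<and> ktilde \<alpha> k l j \<in> \<nat> \<and>
      p \<in> {1..harmonics_dim TYPE(real^'n) l} \<and> q \<in> {1..harmonics_dim TYPE(real^'m) j}}"

text \<open>The reproducing kernel \<open>G\<^sub>k(z,\<zeta>) = \<Sum>\<^sub>i e\<^sub>i(z) cnj (e\<^sub>i(\<zeta>))\<close>. It does not depend on the orthonormal
  basis, so an arbitrary one is chosen.\<close>

definition G_kernel ::
    "real \<Rightarrow> (nat \<Rightarrow> nat \<Rightarrow> real^'n \<Rightarrow> complex) \<Rightarrow> (nat \<Rightarrow> nat \<Rightarrow> real^'m \<Rightarrow> complex) \<Rightarrow> nat \<Rightarrow>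
     (real^'n) \<times> (real^'m) \<Rightarrow> (real^'n) \<times> (real^'m) \<Rightarrow> complex" where
  "G_kernel \<alpha> Y Z k z \<zeta> =
     (let I = {..<cdim (H_space \<alpha> Y Z k)};
          e = (SOME e. orthonormal_basis (Omega_measure \<alpha>) I e (H_space \<alpha> Y Z k))
      in \<Sum>i\<in>I. e i z * cnj (e i \<zeta>))"

text \<open>On \<open>L\<^sup>2(\<Omega>)\<close> this is the orthogonal projection onto \<open>H_space \<alpha> Y Z k\<close>; the same formula defines it
  on \<open>L\<^sup>1(\<Omega>)\<close>.\<close>

definition P_proj ::
    "real \<Rightarrow> (nat \<Rightarrow> nat \<Rightarrow> real^'n \<Rightarrow> complex) \<Rightarrow> (nat \<Rightarrow> nat \<Rightarrow> real^'m \<Rightarrow> complex) \<Rightarrow> nat \<Rightarrow>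
     ((real^'n) \<times> (real^'m) \<Rightarrow> complex) \<Rightarrow> (real^'n) \<times> (real^'m) \<Rightarrow> complex" where
  "P_proj \<alpha> Y Z k g z = (\<integral>\<zeta>. G_kernel \<alpha> Y Z k z \<zeta> * g \<zeta> \<partial>Omega_measure \<alpha>)"

definition L1_norm :: "'a measure \<Rightarrow> ('a \<Rightarrow> complex) \<Rightarrow> real" where
  "L1_norm M g = (\<integral>x. cmod (g x) \<partial>M)"

definition Linf_norm :: "'a measure \<Rightarrow> ('a \<Rightarrow> complex) \<Rightarrow> ereal" where
  "Linf_norm M g = esssup M (\<lambda>x. ereal (cmod (g x)))"

end

theory Submission
  imports Defs "HOL-Computational_Algebra.Polynomial"
begin

text \<open>By Cauchy--Schwarz for the reproducing kernel it suffices to bound the kernel on the diagonal, i.e.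
  the sum of \<open>|e\<^sub>i(z)|\<^sup>2\<close> over the basis of products \<open>h\<^sub>k\<^sub>,\<^sub>l\<^sub>,\<^sub>j Y\<^sub>l\<^sub>,\<^sub>p Z\<^sub>j\<^sub>,\<^sub>q\<close>. The sum over \<open>p\<close> of \<open>|Y\<^sub>l\<^sub>,\<^sub>p|\<^sup>2\<close> is constant
  by rotation invariance, hence equal to the dimension of the spherical harmonics divided by the area
  of the sphere, and so at most a multiple of \<open>(l + 1)\<^bsup>n - 2\<^esup>\<close>.

  Writing \<open>k = r + (\<alpha> + 1) k'\<close> and \<open>l = r + (\<alpha> + 1) l'\<close> turns the condition on \<open>(l, j)\<close> into
  \<open>l' + j + 2 N = k'\<close>. This is the decomposition of ordinary spherical harmonics of degree \<open>k'\<close> with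
  respect to a product of two spaces, the first of which has the fractional dimension
  \<open>2 p + 2 = 2 + (n - 2 + 2 r) / (\<alpha> + 1)\<close>. The four contiguous relations of the Jacobi functions
  (the matrix entries of infinitesimal rotations) show that the sum of their squares, weighted by the
  dimensions of the fractional harmonics, has derivative zero; its value is found by integration.
  If \<open>2 p \<le> n - 2\<close>, this bounds the kernel. In the remaining case
  \<open>n \<in> {2, 3}\<close>, \<open>\<alpha> = r = 1\<close> the telescoping sum for the right weights has a boundary term, which is the
  derivative of another nonnegative bounded sum.\<close>

section \<open>Jacobi polynomials and contiguous relations\<close>


text \<open>With \<open>Em l = E (l - 1)\<close>, the condition on the weights in
  \<open>has_real_derivative_wsum\<close> is the recursion
  \<open>E l * (l + P - p) = E (l - 1) * (l + P + p)\<close>, where \<open>P\<close> is the Jacobi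
  parameter at \<open>l = 0\<close> and \<open>2 * p\<close> is the growth exponent of the solution.
  At \<open>l = 0\<close> the condition reads \<open>E 0 * P = E 0 * p\<close>, so a solution can
  start there only if \<open>P = p\<close>: the growth of the weights is tied to the fractional
  dimension. The harmonics in x grow only like \<open>(l + 1) ^ (n - 2)\<close>. For n \<ge> 4 the
  fractional growth \<open>2 * P = (n - 2 + 2 * r) / (\<alpha> + 1)\<close> never exceeds n - 2,
  because r \<le> \<alpha>. For n < 4 and \<alpha> = r = 1 it equals n/2 > n - 2, and weights of
  that size would lose a positive power of k. The smaller growth \<open>2 * p = 2 * P - 1\<close> is
  obtained by running the recursion with the Jacobi parameter \<open>P - 1 = p - 1/2\<close> from l
  = 1 on and then shifting l by one (\<open>wsum_shift\<close>). The missing start at l = 0 is the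
  origin of the boundary term.\<close>

definition jcoeff :: "nat \<Rightarrow> real \<Rightarrow> real \<Rightarrow> nat \<Rightarrow> real" where
  "jcoeff N a b s = ((real N + a) gchoose (N - s)) * ((real N + b) gchoose s)"

text \<open>The homogeneous form of the Jacobi polynomial in S = (1 - x)/2 and C = (1 + x)/2. With S
  and C independent, the identities below are comparisons of coefficients and hold without S + C =
  1.\<close>

definition jhom :: "nat \<Rightarrow> real \<Rightarrow> real \<Rightarrow> real \<Rightarrow> real \<Rightarrow> real" where
  "jhom N a b S C = (\<Sum>s\<le>N. jcoeff N a b s * (- S) ^ s * C ^ (N - s))"

text \<open>The directional derivative d/dS - d/dC of \<open>jhom\<close>: along \<phi> the pair
  (sin^2, cos^2) moves in the direction (1, -1) with speed 2 sin \<phi> cos \<phi>.\<close>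

definition jhom_diff :: "nat \<Rightarrow> real \<Rightarrow> real \<Rightarrow> real \<Rightarrow> real \<Rightarrow> real" where
  "jhom_diff N a b S C = (\<Sum>s\<le>N. jcoeff N a b s *
     (- (real s * (- S) ^ (s - 1) * C ^ (N - s)) - real (N - s) * (- S) ^ s * C ^ (N - s - 1)))"

lemma gbinomial_step: "real (Suc k) * (x gchoose Suc k) = (x - real k) * (x gchoose k)"
  using gbinomial_mult_1[of x k] by (simp add: algebra_simps)

lemma jcoeff_step_right:
  "real (Suc s) * jcoeff N a b (Suc s) = (real N + b - real s) * ((real N + a) gchoose (N - Suc s)) * ((real N + b) gchoose s)"
proof -
  have "real (Suc s) * jcoeff N a b (Suc s)
      = (real (Suc s) * ((real N + b) gchoose Suc s)) * ((real N + a) gchoose (N - Suc s))"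
    unfolding jcoeff_def by (simp add: mult_ac)
  then show ?thesis unfolding gbinomial_step by (simp add: mult_ac)
qed

lemma jcoeff_step_left:
  assumes "s < N"
  shows "real (N - s) * jcoeff N a b s = (a + real s + 1) * ((real N + a) gchoose (N - Suc s)) * ((real N + b) gchoose s)"
proof -
  have e: "N - s = Suc (N - Suc s)" using assms by simp
  have "real (Suc (N - Suc s)) * ((real N + a) gchoose Suc (N - Suc s))
      = (real N + a - real (N - Suc s)) * ((real N + a) gchoose (N - Suc s))"
    by (rule gbinomial_step)
  moreover have "real N + a - real (N - Suc s) = a + real s + 1" using assms by (simp add: of_nat_diff)
  ultimately have "real (N - s) * ((real N + a) gchoose (N - s)) = (a + real s + 1) * ((real N + a) gchoose (N - Suc s))"
    using e by simp
  then show ?thesis unfolding jcoeff_def by (simp add: mult.assoc[symmetric])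
qed

text \<open>This is the classical rule that the derivative of P_N^(a,b) is (N + a + b + 1)/2 times
  P_(N-1)^(a+1,b+1); d/dS - d/dC is -2 d/dx, which accounts for sign and factor. Each monomial
  receives one term from the power of S and one from the power of C, and
  \<open>jcoeff_step_right\<close> and \<open>jcoeff_step_left\<close> give them a common
  factor.\<close>

lemma jhom_diff_Suc:
  "jhom_diff (Suc M) a b S C = - (real (Suc M) + a + b + 1) * jhom M (a + 1) (b + 1) S C"
proof -
  let ?j = "jcoeff (Suc M) a b"
  have 1: "(\<Sum>s\<le>Suc M. ?j s * (real s * (- S) ^ (s - 1) * C ^ (Suc M - s)))
     = (\<Sum>s\<le>M. (real (Suc s) * ?j (Suc s)) * (- S) ^ s * C ^ (M - s))"
    by (subst sum.atMost_Suc_shift) (simp add: algebra_simps)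
  have 2: "(\<Sum>s\<le>Suc M. ?j s * (real (Suc M - s) * (- S) ^ s * C ^ (Suc M - s - 1)))
     = (\<Sum>s\<le>M. (real (Suc M - s) * ?j s) * (- S) ^ s * C ^ (M - s))"
    by (simp add: algebra_simps Suc_diff_le)
  have 3: "real (Suc s) * ?j (Suc s) + real (Suc M - s) * ?j s
        = (real (Suc M) + a + b + 1) * jcoeff M (a + 1) (b + 1) s" if "s \<le> M" for s
    using that by (subst jcoeff_step_right, subst jcoeff_step_left)
      (auto simp: jcoeff_def algebra_simps)
  have "jhom_diff (Suc M) a b S C = - (\<Sum>s\<le>M. (real (Suc s) * ?j (Suc s) + real (Suc M - s) * ?j s) * (- S) ^ s * C ^ (M - s))"
    unfolding jhom_diff_def right_diff_distrib sum_subtractf mult_minus_right sum_negf 1 2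
    by (simp only: distrib_right sum.distrib)
  also have "\<dots> = - (\<Sum>s\<le>M. (real (Suc M) + a + b + 1) * jcoeff M (a + 1) (b + 1) s * (- S) ^ s * C ^ (M - s))"
    using 3 by (intro arg_cong[of _ _ uminus] sum.cong) (auto simp only: atMost_iff)
  also have "\<dots> = - (real (Suc M) + a + b + 1) * jhom M (a + 1) (b + 1) S C"
    unfolding jhom_def by (simp only: mult.assoc sum_distrib_left[symmetric] mult_minus_left)
  finally show ?thesis .
qed

lemma jhom_diff_0: "jhom_diff 0 a b S C = 0"
  by (simp add: jhom_diff_def)

text \<open>The left side is the derivative of
  \<open>S powr (a + 1) * C powr (b + 1) * jhom M (a + 1) (b + 1) S C\<close>, divided by
  \<open>S powr a * C powr b\<close>: one step of Rodrigues' formula, the adjoint of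
  \<open>jhom_diff_Suc\<close>.\<close>

lemma jhom_Suc_diff:
  "(a + 1) * C * jhom M (a + 1) (b + 1) S C - (b + 1) * S * jhom M (a + 1) (b + 1) S C
     + S * C * jhom_diff M (a + 1) (b + 1) S C = real (Suc M) * jhom (Suc M) a b S C"
proof -
  let ?q = "jcoeff M (a + 1) (b + 1)" and ?m = "\<lambda>s. (- S) ^ s * C ^ (Suc M - s)"
  have p: "C * C ^ (M - s) = C ^ (Suc M - s)" if "s \<le> M" for s
    using that by (simp add: Suc_diff_le)
  have t1: "?q s * (S * C * (- (real s * (- S) ^ (s - 1) * C ^ (M - s)))) = real s * ?q s * ?m s" if "s \<le> M" for s
  proof (cases s)
    case (Suc i)
    then have "M - i = Suc (M - Suc i)" using that by simp
    then show ?thesis using Suc by (simp add: algebra_simps)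
  qed auto
  have t2: "?q s * (S * C * (- (real (M - s) * (- S) ^ s * C ^ (M - s - 1)))) = real (M - s) * ?q s * ?m (Suc s)" if "s \<le> M" for s
  proof (cases "s = M")
    case False
    then have "Suc M - Suc s = Suc (M - s - 1)" using that by simp
    then show ?thesis by (simp add: algebra_simps)
  qed auto
  have t3: "(a + 1) * C * (?q s * (- S) ^ s * C ^ (M - s)) = (a + 1) * ?q s * ?m s" if "s \<le> M" for s
    unfolding p[OF that, symmetric] by (simp add: mult_ac)
  have t4: "- (b + 1) * S * (?q s * (- S) ^ s * C ^ (M - s)) = (b + 1) * ?q s * ?m (Suc s)" for s
    by (simp add: algebra_simps)
  have L: "(a + 1) * C * jhom M (a + 1) (b + 1) S C - (b + 1) * S * jhom M (a + 1) (b + 1) S C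
     + S * C * jhom_diff M (a + 1) (b + 1) S C
    = (\<Sum>s\<le>M. (a + 1) * C * (?q s * (- S) ^ s * C ^ (M - s)) + (- (b + 1) * S * (?q s * (- S) ^ s * C ^ (M - s)))
        + (?q s * (S * C * (- (real s * (- S) ^ (s - 1) * C ^ (M - s))))
          + ?q s * (S * C * (- (real (M - s) * (- S) ^ s * C ^ (M - s - 1))))))"
    unfolding jhom_def jhom_diff_def sum_distrib_left
    by (simp add: sum.distrib[symmetric] sum_subtractf[symmetric]) (simp add: algebra_simps)
  also have "\<dots> = (\<Sum>s\<le>M. ((a + 1 + real s) * ?q s) * ?m s + ((b + 1 + real (M - s)) * ?q s) * ?m (Suc s))"
    by (intro sum.cong refl, subst t1, simp, subst t2, simp, subst t3, simp, subst t4) (simp add: algebra_simps)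
  also have "\<dots> = (\<Sum>s\<le>M. ((a + 1 + real s) * ?q s) * ?m s) + (\<Sum>s\<le>M. ((b + 1 + real (M - s)) * ?q s) * ?m (Suc s))"
    by (rule sum.distrib)
  also have "(\<Sum>s\<le>M. ((a + 1 + real s) * ?q s) * ?m s) = (\<Sum>s\<le>Suc M. (real (Suc M - s) * jcoeff (Suc M) a b s) * ?m s)"
  proof -
    have "(a + 1 + real s) * ?q s = real (Suc M - s) * jcoeff (Suc M) a b s" if "s \<le> M" for s
      using that by (subst jcoeff_step_left) (auto simp: jcoeff_def algebra_simps)
    then show ?thesis by simp
  qed
  also have "(\<Sum>s\<le>M. ((b + 1 + real (M - s)) * ?q s) * ?m (Suc s)) = (\<Sum>s\<le>Suc M. (real s * jcoeff (Suc M) a b s) * ?m s)"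
  proof -
    have "(b + 1 + real (M - s)) * ?q s = real (Suc s) * jcoeff (Suc M) a b (Suc s)" if "s \<le> M" for s
      using that by (subst jcoeff_step_right) (auto simp: jcoeff_def algebra_simps of_nat_diff)
    then show ?thesis by (subst sum.atMost_Suc_shift) simp
  qed
  also have "(\<Sum>s\<le>Suc M. (real (Suc M - s) * jcoeff (Suc M) a b s) * ?m s) + (\<Sum>s\<le>Suc M. (real s * jcoeff (Suc M) a b s) * ?m s)
     = (\<Sum>s\<le>Suc M. real (Suc M) * (jcoeff (Suc M) a b s * ?m s))"
    unfolding sum.distrib[symmetric] by (intro sum.cong refl) (auto simp: of_nat_diff algebra_simps)
  also have "\<dots> = real (Suc M) * jhom (Suc M) a b S C"
    unfolding jhom_def sum_distrib_left by (simp add: mult.assoc)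
  finally show ?thesis .
qed

text \<open>The left side is the derivative of \<open>C powr b * jhom N a b S C\<close>, divided by
  \<open>C powr (b - 1)\<close>. The degree stays and one unit passes from b to a.\<close>

lemma jhom_right_shift:
  "- b * jhom N a b S C + C * jhom_diff N a b S C = - (real N + b) * jhom N (a + 1) (b - 1) S C"
proof (cases N)
  case 0
  then show ?thesis by (simp add: jhom_def jhom_diff_def jcoeff_def)
next
  case (Suc M)
  let ?p = "jcoeff N a b" and ?m = "\<lambda>s. (- S) ^ s * C ^ (N - s)"
  have 1: "(\<Sum>s\<le>N. ?p s * (C * (real s * (- S) ^ (s - 1) * C ^ (N - s)))) = (\<Sum>s\<le>M. (real (Suc s) * ?p (Suc s)) * ?m s)"
  proof -
    show ?thesis unfolding Suc by (subst sum.atMost_Suc_shift) (auto intro!: sum.cong simp: algebra_simps Suc_diff_le)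
  qed
  have 2: "(\<Sum>s\<le>N. ?p s * (C * (real (N - s) * (- S) ^ s * C ^ (N - s - 1)))) = (\<Sum>s\<le>M. (real (N - s) * ?p s) * ?m s)"
  proof -
    show ?thesis unfolding Suc by (auto intro!: sum.cong simp: algebra_simps Suc_diff_le)
  qed
  have "- b * jhom N a b S C + C * jhom_diff N a b S C = - ((\<Sum>s\<le>N. b * ?p s * ?m s)
      + (\<Sum>s\<le>N. ?p s * (C * (real s * (- S) ^ (s - 1) * C ^ (N - s))))
      + (\<Sum>s\<le>N. ?p s * (C * (real (N - s) * (- S) ^ s * C ^ (N - s - 1)))))"
    unfolding jhom_def jhom_diff_def sum_distrib_left sum.distrib[symmetric] sum_negf[symmetric]
    by (intro sum.cong refl) (simp add: algebra_simps)
  also have "\<dots> = - ((\<Sum>s\<le>M. (b * ?p s + real (Suc s) * ?p (Suc s) + real (N - s) * ?p s) * ?m s) + b * ?p N * ?m N)"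
    unfolding 1 2 by (simp only: distrib_right sum.distrib) (simp add: Suc)
  also have "(\<Sum>s\<le>M. (b * ?p s + real (Suc s) * ?p (Suc s) + real (N - s) * ?p s) * ?m s)
     = (\<Sum>s\<le>M. ((real N + b) * jcoeff N (a + 1) (b - 1) s) * ?m s)"
  proof (intro sum.cong refl arg_cong2[of _ _ _ _ "(*)"])
    fix s assume "s \<in> {..M}"
    then have s: "s \<le> M" "s < N" using Suc by auto
    have P: "(real N + (a + 1)) gchoose (N - s) = ((real N + a) gchoose (N - Suc s)) + ((real N + a) gchoose (N - s))"
    proof -
      have "N - s = Suc (N - Suc s)" using s by simp
      then show ?thesis using gbinomial_Suc_Suc[of "real N + a" "N - Suc s"] by (simp add: add.assoc)
    qed
    have Q: "(real N + b) * ((real N + (b - 1)) gchoose s) = (real N + b - real s) * ((real N + b) gchoose s)"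
      using gbinomial_absorb_comp[of "real N + b" s] by (simp add: algebra_simps)
    have "b * ?p s + real (Suc s) * ?p (Suc s) + real (N - s) * ?p s
       = (real N + b - real s) * ((real N + b) gchoose s) * (((real N + a) gchoose (N - Suc s)) + ((real N + a) gchoose (N - s)))"
      by (subst jcoeff_step_right) (use s in \<open>simp add: jcoeff_def algebra_simps of_nat_diff\<close>)
    also have "\<dots> = (real N + b) * jcoeff N (a + 1) (b - 1) s"
      unfolding P[symmetric] Q[symmetric] jcoeff_def by (simp add: algebra_simps)
    finally show "b * ?p s + real (Suc s) * ?p (Suc s) + real (N - s) * ?p s = (real N + b) * jcoeff N (a + 1) (b - 1) s" .
  qed
  also have "b * ?p N = (real N + b) * jcoeff N (a + 1) (b - 1) N"
    using gbinomial_absorb_comp[of "real N + b" N] by (simp add: jcoeff_def algebra_simps)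
  also have "- ((\<Sum>s\<le>M. ((real N + b) * jcoeff N (a + 1) (b - 1) s) * ?m s) + (real N + b) * jcoeff N (a + 1) (b - 1) N * ?m N)
     = - (real N + b) * jhom N (a + 1) (b - 1) S C"
  proof -
    have e1: "jhom N (a + 1) (b - 1) S C = (\<Sum>s\<le>M. jcoeff N (a + 1) (b - 1) s * ?m s) + jcoeff N (a + 1) (b - 1) N * ?m N"
      unfolding jhom_def by (simp add: Suc mult.assoc)
    have e2: "(\<Sum>s\<le>M. ((real N + b) * jcoeff N (a + 1) (b - 1) s) * ?m s)
        = (real N + b) * (\<Sum>s\<le>M. jcoeff N (a + 1) (b - 1) s * ?m s)"
      by (simp only: mult.assoc sum_distrib_left)
    show ?thesis unfolding e1 e2 by (simp only: mult_minus_left distrib_left mult.assoc)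
  qed
  finally show ?thesis .
qed

text \<open>The inverse move to \<open>jhom_right_shift\<close>: here
  \<open>S powr (a + 1) * jhom N (a + 1) (b - 1) S C\<close> is differentiated and divided by
  \<open>S powr a\<close>.\<close>

lemma jhom_left_shift:
  "(a + 1) * jhom N (a + 1) (b - 1) S C + S * jhom_diff N (a + 1) (b - 1) S C = (real N + a + 1) * jhom N a b S C"
proof (cases N)
  case 0
  then show ?thesis by (simp add: jhom_def jhom_diff_def jcoeff_def)
next
  case (Suc M)
  let ?q = "jcoeff N (a + 1) (b - 1)" and ?m = "\<lambda>s. (- S) ^ s * C ^ (N - s)"
  have 1: "(\<Sum>s\<le>N. ?q s * (S * (real s * (- S) ^ (s - 1) * C ^ (N - s)))) = - (\<Sum>s\<le>N. (real s * ?q s) * ?m s)"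
    unfolding sum_negf[symmetric]
  proof (intro sum.cong refl)
    fix s show "?q s * (S * (real s * (- S) ^ (s - 1) * C ^ (N - s))) = - (real s * ?q s * ?m s)"
      by (cases s) (auto simp: algebra_simps)
  qed
  have 2: "(\<Sum>s\<le>N. ?q s * (S * (real (N - s) * (- S) ^ s * C ^ (N - s - 1)))) = - (\<Sum>s\<le>M. (real (N - s) * ?q s) * ?m (Suc s))"
    unfolding sum_negf[symmetric] Suc by (auto intro!: sum.cong simp: algebra_simps)
  have "(a + 1) * jhom N (a + 1) (b - 1) S C + S * jhom_diff N (a + 1) (b - 1) S C = (\<Sum>s\<le>N. (a + 1) * ?q s * ?m s)
      - (\<Sum>s\<le>N. ?q s * (S * (real s * (- S) ^ (s - 1) * C ^ (N - s))))
      - (\<Sum>s\<le>N. ?q s * (S * (real (N - s) * (- S) ^ s * C ^ (N - s - 1))))"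
    unfolding jhom_def jhom_diff_def sum_distrib_left sum.distrib[symmetric] sum_subtractf[symmetric]
    by (intro sum.cong refl) (simp add: algebra_simps)
  also have "\<dots> = (\<Sum>s\<le>N. ((a + 1 + real s) * ?q s) * ?m s) + (\<Sum>s\<le>M. (real (N - s) * ?q s) * ?m (Suc s))"
    unfolding 1 2 by (simp add: sum.distrib algebra_simps)
  also have "\<dots> = (a + 1) * ?q 0 * ?m 0 + (\<Sum>s\<le>M. ((a + 1 + real (Suc s)) * ?q (Suc s) + real (N - s) * ?q s) * ?m (Suc s))"
  proof -
    have D: "(\<Sum>s\<le>M. (A s + B s) * m s) = (\<Sum>s\<le>M. A s * m s) + (\<Sum>s\<le>M. B s * m s)" for A B m :: "nat \<Rightarrow> real"
      by (simp only: distrib_right sum.distrib)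
    show ?thesis unfolding D unfolding Suc by (subst sum.atMost_Suc_shift) simp
  qed
  also have "(\<Sum>s\<le>M. ((a + 1 + real (Suc s)) * ?q (Suc s) + real (N - s) * ?q s) * ?m (Suc s))
     = (\<Sum>s\<le>M. ((real N + a + 1) * jcoeff N a b (Suc s)) * ?m (Suc s))"
  proof (intro sum.cong refl arg_cong2[of _ _ _ _ "(*)"])
    fix s assume "s \<in> {..M}"
    then have s: "s \<le> M" "s < N" using Suc by auto
    have P: "(real N + b) gchoose Suc s = ((real N + (b - 1)) gchoose s) + ((real N + (b - 1)) gchoose Suc s)"
      using gbinomial_Suc_Suc[of "real N + (b - 1)" s] by simp
    have Q1: "(a + 1 + real (Suc s)) * ((real N + (a + 1)) gchoose (N - Suc s)) = (real N + a + 1) * ((real N + a) gchoose (N - Suc s))"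
      using gbinomial_absorb_comp[of "real N + (a + 1)" "N - Suc s"] s by (simp add: algebra_simps of_nat_diff)
    have "N - s = Suc (N - Suc s)" using s by simp
    then have Q2: "real (N - s) * ((real N + (a + 1)) gchoose (N - s)) = (real N + a + 1) * ((real N + a) gchoose (N - Suc s))"
      using gbinomial_absorption[of "N - Suc s" "real N + (a + 1)"] by (simp add: algebra_simps)
    have "(a + 1 + real (Suc s)) * ?q (Suc s) + real (N - s) * ?q s
      = ((a + 1 + real (Suc s)) * ((real N + (a + 1)) gchoose (N - Suc s))) * ((real N + (b - 1)) gchoose Suc s)
        + (real (N - s) * ((real N + (a + 1)) gchoose (N - s))) * ((real N + (b - 1)) gchoose s)"
      unfolding jcoeff_def by (simp add: algebra_simps)
    also have "\<dots> = (real N + a + 1) * jcoeff N a b (Suc s)"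
      unfolding Q1 Q2 jcoeff_def P by (simp add: algebra_simps)
    finally show "(a + 1 + real (Suc s)) * ?q (Suc s) + real (N - s) * ?q s = (real N + a + 1) * jcoeff N a b (Suc s)" .
  qed
  also have "(a + 1) * ?q 0 = (real N + a + 1) * jcoeff N a b 0"
    using gbinomial_absorb_comp[of "real N + (a + 1)" N] by (simp add: jcoeff_def algebra_simps)
  also have "(real N + a + 1) * jcoeff N a b 0 * ?m 0 + (\<Sum>s\<le>M. ((real N + a + 1) * jcoeff N a b (Suc s)) * ?m (Suc s))
     = (real N + a + 1) * jhom N a b S C"
    unfolding jhom_def sum_distrib_left unfolding Suc by (subst sum.atMost_Suc_shift) (simp add: algebra_simps)
  finally show ?thesis .
qed

lemma jacobi_P_cos_double: "jacobi_P N a b (cos (2 * \<phi>)) = jhom N a b ((sin \<phi>)\<^sup>2) ((cos \<phi>)\<^sup>2)"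
proof -
  have 1: "(cos (2 * \<phi>) - 1) / 2 = - (sin \<phi>)\<^sup>2" by (simp add: cos_double_sin)
  have 2: "(cos (2 * \<phi>) + 1) / 2 = (cos \<phi>)\<^sup>2" by (simp add: cos_double_cos)
  show ?thesis unfolding jacobi_P_def jhom_def jcoeff_def 1 2 ..
qed

lemma has_real_derivative_jhom:
  assumes "(f has_real_derivative d) (at x)" "(g has_real_derivative - d) (at x)"
  shows "((\<lambda>x. jhom N a b (f x) (g x)) has_real_derivative d * jhom_diff N a b (f x) (g x)) (at x)"
  unfolding jhom_def jhom_diff_def sum_distrib_left
  by (rule derivative_eq_intros assms refl | simp)+ (auto intro!: sum.cong simp: algebra_simps)

lemma has_real_derivative_jhom_trig:
  "((\<lambda>\<phi>. jhom N a b ((sin \<phi>)\<^sup>2) ((cos \<phi>)\<^sup>2)) has_real_derivative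
     2 * sin \<phi> * cos \<phi> * jhom_diff N a b ((sin \<phi>)\<^sup>2) ((cos \<phi>)\<^sup>2)) (at \<phi>)"
  by (rule has_real_derivative_jhom) (auto intro!: derivative_eq_intros)


section \<open>Jacobi functions in the angle: contiguous relations and ratios of norms\<close>

definition jacobi_fun :: "nat \<Rightarrow> real \<Rightarrow> real \<Rightarrow> real \<Rightarrow> real" where
  "jacobi_fun N a b \<phi> = sin \<phi> powr a * cos \<phi> powr b * jacobi_P N a b (cos (2 * \<phi>))"

text \<open>The logarithmic derivative of the prefactor is kept apart because the contiguous
  relations differ exactly in the signs with which its two terms are compensated.\<close>

definition jacobi_fun_deriv :: "nat \<Rightarrow> real \<Rightarrow> real \<Rightarrow> real \<Rightarrow> real" where
  "jacobi_fun_deriv N a b \<phi> = (a * (cos \<phi> / sin \<phi>) - b * (sin \<phi> / cos \<phi>)) * jacobi_fun N a b \<phi>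
     + 2 * sin \<phi> powr (a + 1) * cos \<phi> powr (b + 1) * jhom_diff N a b ((sin \<phi>)\<^sup>2) ((cos \<phi>)\<^sup>2)"

lemma sin_cos_gt_zero:
  assumes "\<phi> \<in> {0<..<pi/2}" shows "sin \<phi> > 0" "cos \<phi> > 0"
  using assms by (auto intro!: sin_gt_zero cos_gt_zero)

lemma sin_cos_ge_zero:
  assumes "\<phi> \<in> {0..pi/2}" shows "sin \<phi> \<ge> 0" "cos \<phi> \<ge> 0"
  using assms by (auto intro!: sin_ge_zero cos_ge_zero)

lemma jacobi_fun_alt:
  "jacobi_fun N a b \<phi> = sin \<phi> powr a * cos \<phi> powr b * jhom N a b ((sin \<phi>)\<^sup>2) ((cos \<phi>)\<^sup>2)"
  by (simp add: jacobi_fun_def jacobi_P_cos_double)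

lemma has_real_derivative_jacobi_fun:
  assumes "\<phi> \<in> {0<..<pi/2}"
  shows "(jacobi_fun N a b has_real_derivative jacobi_fun_deriv N a b \<phi>) (at \<phi>)"
proof -
  note sc = sin_cos_gt_zero[OF assms]
  have 1: "((\<lambda>\<phi>. sin \<phi> powr a) has_real_derivative a * (cos \<phi> / sin \<phi>) * sin \<phi> powr a) (at \<phi>)"
    using sc by (auto intro!: derivative_eq_intros simp: powr_diff)
  have 2: "((\<lambda>\<phi>. cos \<phi> powr b) has_real_derivative - b * (sin \<phi> / cos \<phi>) * cos \<phi> powr b) (at \<phi>)"
    using sc by (auto intro!: derivative_eq_intros simp: powr_diff)
  have *: "jacobi_fun N a b = (\<lambda>\<phi>. sin \<phi> powr a * cos \<phi> powr b * jhom N a b ((sin \<phi>)\<^sup>2) ((cos \<phi>)\<^sup>2))"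
    by (rule ext) (rule jacobi_fun_alt)
  show ?thesis
    unfolding * jacobi_fun_deriv_def
    by (rule DERIV_cong[OF DERIV_mult[OF DERIV_mult[OF 1 2] has_real_derivative_jhom_trig]])
       (use sc in \<open>simp add: jacobi_fun_alt powr_add algebra_simps\<close>)
qed

text \<open>For a function of degree N with its own parameters (\<mu>, \<nu>), the four relations
  add to the derivative the four sign combinations of \<mu> cot \<phi> and \<nu> tan \<phi>, and
  lead to the neighbours (N - 1, \<mu> + 1, \<nu> + 1), (N + 1, \<mu> - 1, \<nu> - 1), (N, \<mu> +
  1, \<nu> - 1) and (N, \<mu> - 1, \<nu> + 1). All four preserve \<mu> + \<nu> + 2 N.\<close>

lemma jacobi_fun_raise_raise:
  "jacobi_fun_deriv (Suc M) a b \<phi> + (b * (sin \<phi> / cos \<phi>) - a * (cos \<phi> / sin \<phi>)) * jacobi_fun (Suc M) a b \<phi>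
    = - 2 * (real (Suc M) + a + b + 1) * jacobi_fun M (a + 1) (b + 1) \<phi>"
proof -
  have "jacobi_fun_deriv (Suc M) a b \<phi> + (b * (sin \<phi> / cos \<phi>) - a * (cos \<phi> / sin \<phi>)) * jacobi_fun (Suc M) a b \<phi>
    = 2 * sin \<phi> powr (a + 1) * cos \<phi> powr (b + 1) * jhom_diff (Suc M) a b ((sin \<phi>)\<^sup>2) ((cos \<phi>)\<^sup>2)"
    unfolding jacobi_fun_deriv_def by algebra
  then show ?thesis unfolding jhom_diff_Suc jacobi_fun_alt by simp
qed

lemma jacobi_fun_raise_raise_0:
  "jacobi_fun_deriv 0 a b \<phi> + (b * (sin \<phi> / cos \<phi>) - a * (cos \<phi> / sin \<phi>)) * jacobi_fun 0 a b \<phi> = 0"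
  unfolding jacobi_fun_deriv_def jhom_diff_0 by (simp add: algebra_simps)

lemma jacobi_fun_lower_lower:
  assumes "\<phi> \<in> {0<..<pi/2}"
  shows "jacobi_fun_deriv M (a + 1) (b + 1) \<phi>
       + ((a + 1) * (cos \<phi> / sin \<phi>) - (b + 1) * (sin \<phi> / cos \<phi>)) * jacobi_fun M (a + 1) (b + 1) \<phi>
    = 2 * real (Suc M) * jacobi_fun (Suc M) a b \<phi>"
proof -
  note sc = sin_cos_gt_zero[OF assms]
  let ?S = "(sin \<phi>)\<^sup>2" and ?C = "(cos \<phi>)\<^sup>2"
  let ?Q = "jhom M (a + 1) (b + 1) ?S ?C" and ?D = "jhom_diff M (a + 1) (b + 1) ?S ?C"
  have s: "(cos \<phi> / sin \<phi>) * sin \<phi> powr (a + 1) * cos \<phi> powr (b + 1) = sin \<phi> powr a * cos \<phi> powr b * ?C"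
    "(sin \<phi> / cos \<phi>) * sin \<phi> powr (a + 1) * cos \<phi> powr (b + 1) = sin \<phi> powr a * cos \<phi> powr b * ?S"
    "sin \<phi> powr (a + 1 + 1) * cos \<phi> powr (b + 1 + 1) = sin \<phi> powr a * cos \<phi> powr b * (?S * ?C)"
    using sc by (simp_all add: powr_add power2_eq_square)
  have "jacobi_fun_deriv M (a + 1) (b + 1) \<phi>
       + ((a + 1) * (cos \<phi> / sin \<phi>) - (b + 1) * (sin \<phi> / cos \<phi>)) * jacobi_fun M (a + 1) (b + 1) \<phi>
    = 2 * (a + 1) * ((cos \<phi> / sin \<phi>) * sin \<phi> powr (a + 1) * cos \<phi> powr (b + 1)) * ?Q
      - 2 * (b + 1) * ((sin \<phi> / cos \<phi>) * sin \<phi> powr (a + 1) * cos \<phi> powr (b + 1)) * ?Q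
      + 2 * (sin \<phi> powr (a + 1 + 1) * cos \<phi> powr (b + 1 + 1)) * ?D"
    unfolding jacobi_fun_deriv_def jacobi_fun_alt by algebra
  also have "\<dots> = 2 * (sin \<phi> powr a * cos \<phi> powr b) * ((a + 1) * ?C * ?Q - (b + 1) * ?S * ?Q + ?S * ?C * ?D)"
    unfolding s by (simp add: algebra_simps)
  also have "\<dots> = 2 * real (Suc M) * jacobi_fun (Suc M) a b \<phi>"
    unfolding jhom_Suc_diff jacobi_fun_alt by simp
  finally show ?thesis .
qed

lemma jacobi_fun_raise_lower:
  assumes "\<phi> \<in> {0<..<pi/2}"
  shows "jacobi_fun_deriv N a b \<phi> - (b * (sin \<phi> / cos \<phi>) + a * (cos \<phi> / sin \<phi>)) * jacobi_fun N a b \<phi>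
    = - 2 * (real N + b) * jacobi_fun N (a + 1) (b - 1) \<phi>"
proof -
  note sc = sin_cos_gt_zero[OF assms]
  let ?S = "(sin \<phi>)\<^sup>2" and ?C = "(cos \<phi>)\<^sup>2"
  let ?Q = "jhom N a b ?S ?C" and ?D = "jhom_diff N a b ?S ?C"
  have s: "(sin \<phi> / cos \<phi>) * sin \<phi> powr a * cos \<phi> powr b = sin \<phi> powr (a + 1) * cos \<phi> powr (b - 1)"
    "sin \<phi> powr (a + 1) * cos \<phi> powr (b + 1) = sin \<phi> powr (a + 1) * cos \<phi> powr (b - 1) * ?C"
    using sc by (simp_all add: powr_add powr_diff power2_eq_square)
  have "jacobi_fun_deriv N a b \<phi> - (b * (sin \<phi> / cos \<phi>) + a * (cos \<phi> / sin \<phi>)) * jacobi_fun N a b \<phi>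
    = - 2 * b * ((sin \<phi> / cos \<phi>) * sin \<phi> powr a * cos \<phi> powr b) * ?Q
      + 2 * (sin \<phi> powr (a + 1) * cos \<phi> powr (b + 1)) * ?D"
    unfolding jacobi_fun_deriv_def jacobi_fun_alt by algebra
  also have "\<dots> = 2 * (sin \<phi> powr (a + 1) * cos \<phi> powr (b - 1)) * (- b * ?Q + ?C * ?D)"
    unfolding s by (simp add: algebra_simps)
  also have "\<dots> = - 2 * (real N + b) * jacobi_fun N (a + 1) (b - 1) \<phi>"
    unfolding jhom_right_shift jacobi_fun_alt by simp
  finally show ?thesis .
qed

lemma jacobi_fun_lower_raise:
  assumes "\<phi> \<in> {0<..<pi/2}"
  shows "jacobi_fun_deriv N (a + 1) (b - 1) \<phi>
      + ((b - 1) * (sin \<phi> / cos \<phi>) + (a + 1) * (cos \<phi> / sin \<phi>)) * jacobi_fun N (a + 1) (b - 1) \<phi>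
    = 2 * (real N + a + 1) * jacobi_fun N a b \<phi>"
proof -
  note sc = sin_cos_gt_zero[OF assms]
  let ?S = "(sin \<phi>)\<^sup>2" and ?C = "(cos \<phi>)\<^sup>2"
  let ?Q = "jhom N (a + 1) (b - 1) ?S ?C" and ?D = "jhom_diff N (a + 1) (b - 1) ?S ?C"
  have s: "(cos \<phi> / sin \<phi>) * sin \<phi> powr (a + 1) * cos \<phi> powr (b - 1) = sin \<phi> powr a * cos \<phi> powr b"
    "sin \<phi> powr (a + 1 + 1) * cos \<phi> powr (b - 1 + 1) = sin \<phi> powr a * cos \<phi> powr b * ?S"
    using sc by (simp_all add: powr_add powr_diff power2_eq_square)
  have "jacobi_fun_deriv N (a + 1) (b - 1) \<phi>
      + ((b - 1) * (sin \<phi> / cos \<phi>) + (a + 1) * (cos \<phi> / sin \<phi>)) * jacobi_fun N (a + 1) (b - 1) \<phi>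
    = 2 * (a + 1) * ((cos \<phi> / sin \<phi>) * sin \<phi> powr (a + 1) * cos \<phi> powr (b - 1)) * ?Q
      + 2 * (sin \<phi> powr (a + 1 + 1) * cos \<phi> powr (b - 1 + 1)) * ?D"
    unfolding jacobi_fun_deriv_def jacobi_fun_alt by algebra
  also have "\<dots> = 2 * (sin \<phi> powr a * cos \<phi> powr b) * ((a + 1) * ?Q + ?S * ?D)"
    unfolding s by (simp add: algebra_simps)
  also have "\<dots> = 2 * (real N + a + 1) * jacobi_fun N a b \<phi>"
    unfolding jhom_left_shift jacobi_fun_alt by simp
  finally show ?thesis .
qed

lemma continuous_on_jhom_trig: "continuous_on A (\<lambda>\<phi>. jhom N a b ((sin \<phi>)\<^sup>2) ((cos \<phi>)\<^sup>2))"
  unfolding jhom_def by (intro continuous_intros)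

lemma borel_measurable_jacobi_fun [measurable]: "jacobi_fun N a b \<in> borel_measurable borel"
proof -
  have [measurable]: "(\<lambda>\<phi>. jhom N a b ((sin \<phi>)\<^sup>2) ((cos \<phi>)\<^sup>2)) \<in> borel_measurable borel"
    by (intro borel_measurable_continuous_onI continuous_on_jhom_trig)
  have *: "jacobi_fun N a b = (\<lambda>\<phi>. sin \<phi> powr a * cos \<phi> powr b * jhom N a b ((sin \<phi>)\<^sup>2) ((cos \<phi>)\<^sup>2))"
    by (rule ext) (rule jacobi_fun_alt)
  show ?thesis unfolding * by measurable
qed

lemma jacobi_fun_mult_weight:
  assumes "\<phi> \<in> {0..pi/2}"
  shows "jacobi_fun N a b \<phi> * jacobi_fun M a' b' \<phi> * sin \<phi> * cos \<phi>
    = sin \<phi> powr (a + a' + 1) * cos \<phi> powr (b + b' + 1)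
      * (jhom N a b ((sin \<phi>)\<^sup>2) ((cos \<phi>)\<^sup>2) * jhom M a' b' ((sin \<phi>)\<^sup>2) ((cos \<phi>)\<^sup>2))"
proof -
  note sc = sin_cos_ge_zero[OF assms]
  have 1: "x powr c * x powr d * x = x powr (c + d + 1)" if "x \<ge> 0" for x c d :: real
    using that by (auto simp: powr_add powr_one)
  show ?thesis unfolding jacobi_fun_alt 1[OF sc(1), symmetric] 1[OF sc(2), symmetric] by (simp add: algebra_simps)
qed

lemma set_integrable_jacobi_fun_mult:
  assumes "a + a' + 1 \<ge> 0" "b + b' + 1 \<ge> 0"
  shows "set_integrable lborel {0..pi/2} (\<lambda>\<phi>. jacobi_fun N a b \<phi> * jacobi_fun M a' b' \<phi> * sin \<phi> * cos \<phi>)"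
proof -
  let ?g = "\<lambda>\<phi>. jhom N a b ((sin \<phi>)\<^sup>2) ((cos \<phi>)\<^sup>2) * jhom M a' b' ((sin \<phi>)\<^sup>2) ((cos \<phi>)\<^sup>2)"
  have "continuous_on {0..pi/2} ?g" by (intro continuous_intros continuous_on_jhom_trig)
  then have "bounded (?g ` {0..pi/2})"
    by (intro compact_imp_bounded compact_continuous_image) auto
  then obtain B where "\<forall>x \<in> ?g ` {0..pi/2}. norm x \<le> B" unfolding bounded_iff by blast
  then have B: "\<bar>?g \<phi>\<bar> \<le> B" if "\<phi> \<in> {0..pi/2}" for \<phi>
    using that by (simp only: ball_simps real_norm_def)
  have "\<bar>jacobi_fun N a b \<phi> * jacobi_fun M a' b' \<phi> * sin \<phi> * cos \<phi>\<bar> \<le> B" if "\<phi> \<in> {0..pi/2}" for \<phi>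
  proof -
    note sc = sin_cos_ge_zero[OF that]
    have p1: "x powr c \<le> 1" if "0 \<le> x" "x \<le> 1" "c \<ge> 0" for x c :: real
      using powr_mono2[of c x 1] that by simp
    have "\<bar>sin \<phi> powr (a + a' + 1) * cos \<phi> powr (b + b' + 1)\<bar> \<le> 1 * 1"
      unfolding abs_mult using p1[OF sc(1) _ assms(1)] p1[OF sc(2) _ assms(2)] by (intro mult_mono) auto
    then have "\<bar>sin \<phi> powr (a + a' + 1) * cos \<phi> powr (b + b' + 1)\<bar> * \<bar>?g \<phi>\<bar> \<le> 1 * B"
      using B[OF that] by (intro mult_mono) auto
    then show ?thesis unfolding jacobi_fun_mult_weight[OF that] abs_mult by simp
  qed
  then show ?thesis
    unfolding set_integrable_def
    by (intro integrableI_bounded_set_indicator[where B=B]) auto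
qed

definition jacobi_norm2 :: "nat \<Rightarrow> real \<Rightarrow> real \<Rightarrow> real" where
  "jacobi_norm2 N a b = (LINT \<phi>:{0..pi/2}|lborel. jacobi_fun N a b \<phi> * jacobi_fun N a b \<phi> * sin \<phi> * cos \<phi>)"

text \<open>Two opposite contiguous relations are adjoint for the weight sin \<phi> cos \<phi>. The
  product of both functions with this weight vanishes at the two ends, the positive exponents make
  it continuous there, and by \<open>D\<close> its derivative is c times the first square minus d
  times the second, each with the weight. This gives ratios of norms without evaluating any
  norm.\<close>

lemma integral_skew_zero:
  assumes ab: "a + a' + 1 > 0" "b + b' + 1 > 0"
    and D: "\<And>\<phi>. \<phi> \<in> {0<..<pi/2} \<Longrightarrow>
      jacobi_fun_deriv N a b \<phi> * jacobi_fun M a' b' \<phi> + jacobi_fun N a b \<phi> * jacobi_fun_deriv M a' b' \<phi>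
      + jacobi_fun N a b \<phi> * jacobi_fun M a' b' \<phi> * (cos \<phi> / sin \<phi> - sin \<phi> / cos \<phi>)
      = c * (jacobi_fun N a b \<phi>)\<^sup>2 - d * (jacobi_fun M a' b' \<phi>)\<^sup>2"
    and ge: "a \<ge> -1/2" "b \<ge> -1/2" "a' \<ge> -1/2" "b' \<ge> -1/2"
  shows "c * jacobi_norm2 N a b = d * jacobi_norm2 M a' b'"
proof -
  let ?F = "\<lambda>\<phi>. jacobi_fun N a b \<phi> * jacobi_fun M a' b' \<phi> * sin \<phi> * cos \<phi>"
  let ?A = "\<lambda>\<phi>. jacobi_fun N a b \<phi> * jacobi_fun N a b \<phi> * sin \<phi> * cos \<phi>"
  let ?B = "\<lambda>\<phi>. jacobi_fun M a' b' \<phi> * jacobi_fun M a' b' \<phi> * sin \<phi> * cos \<phi>"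
  have pi: "pi / 2 \<ge> 0" by simp
  have "continuous_on {0..pi/2} (\<lambda>\<phi>. sin \<phi> powr (a + a' + 1) * cos \<phi> powr (b + b' + 1)
      * (jhom N a b ((sin \<phi>)\<^sup>2) ((cos \<phi>)\<^sup>2) * jhom M a' b' ((sin \<phi>)\<^sup>2) ((cos \<phi>)\<^sup>2)))"
    using ab sin_cos_ge_zero by (intro continuous_intros continuous_on_jhom_trig continuous_on_powr') auto
  then have cont: "continuous_on {0..pi/2} ?F"
    by (rule continuous_on_cong[THEN iffD1, rotated -1]) (use jacobi_fun_mult_weight in auto)
  have der: "(?F has_vector_derivative (c * ?A \<phi> - d * ?B \<phi>)) (at \<phi>)" if "\<phi> \<in> {0<..<pi/2}" for \<phi>
  proof -
    note sc = sin_cos_gt_zero[OF that]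
    have E1: "(?F has_real_derivative ((jacobi_fun_deriv N a b \<phi> * jacobi_fun M a' b' \<phi> + jacobi_fun_deriv M a' b' \<phi> * jacobi_fun N a b \<phi>) * sin \<phi>
        + cos \<phi> * (jacobi_fun N a b \<phi> * jacobi_fun M a' b' \<phi>)) * cos \<phi> + - sin \<phi> * (jacobi_fun N a b \<phi> * jacobi_fun M a' b' \<phi> * sin \<phi>)) (at \<phi>)"
      by (intro DERIV_mult has_real_derivative_jacobi_fun that) (auto intro!: derivative_eq_intros)
    have E2: "((jacobi_fun_deriv N a b \<phi> * jacobi_fun M a' b' \<phi> + jacobi_fun_deriv M a' b' \<phi> * jacobi_fun N a b \<phi>) * sin \<phi>
        + cos \<phi> * (jacobi_fun N a b \<phi> * jacobi_fun M a' b' \<phi>)) * cos \<phi> + - sin \<phi> * (jacobi_fun N a b \<phi> * jacobi_fun M a' b' \<phi> * sin \<phi>)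
      = (jacobi_fun_deriv N a b \<phi> * jacobi_fun M a' b' \<phi> + jacobi_fun N a b \<phi> * jacobi_fun_deriv M a' b' \<phi>
      + jacobi_fun N a b \<phi> * jacobi_fun M a' b' \<phi> * (cos \<phi> / sin \<phi> - sin \<phi> / cos \<phi>)) * (sin \<phi> * cos \<phi>)"
      using sc by (simp add: field_simps)
    have E3: "(c * (jacobi_fun N a b \<phi>)\<^sup>2 - d * (jacobi_fun M a' b' \<phi>)\<^sup>2) * (sin \<phi> * cos \<phi>) = c * ?A \<phi> - d * ?B \<phi>"
      by (simp add: algebra_simps power2_eq_square)
    show ?thesis
      using E1 unfolding E2 D[OF that] E3 has_real_derivative_iff_has_vector_derivative .
  qed
  have "((\<lambda>\<phi>. c * ?A \<phi> - d * ?B \<phi>) has_integral (?F (pi/2) - ?F 0)) {0..pi/2}"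
    using fundamental_theorem_of_calculus_interior[OF pi cont der] by auto
  then have "integral {0..pi/2} (\<lambda>\<phi>. c * ?A \<phi> - d * ?B \<phi>) = 0" by (simp add: integral_unique)
  moreover have iA: "set_integrable lborel {0..pi/2} ?A" "set_integrable lborel {0..pi/2} ?B"
    using ge by (intro set_integrable_jacobi_fun_mult; simp)+
  then have "set_integrable lborel {0..pi/2} (\<lambda>\<phi>. c * ?A \<phi> - d * ?B \<phi>)"
    by (intro set_integral_diff set_integrable_mult_right)
  note set_borel_integral_eq_integral(2)[OF this]
  ultimately have "(LINT \<phi>:{0..pi/2}|lborel. c * ?A \<phi> - d * ?B \<phi>) = 0"
    by (simp only:)
  then show ?thesis
    unfolding jacobi_norm2_def using iA by (simp add: set_integral_diff set_integrable_mult_right)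
qed

lemma jacobi_norm2_raise_raise:
  assumes "a \<ge> -1/2" "b \<ge> -1/2"
  shows "real (Suc M) * jacobi_norm2 (Suc M) a b = (real (Suc M) + a + b + 1) * jacobi_norm2 M (a + 1) (b + 1)"
proof -
  have "(2 * real (Suc M)) * jacobi_norm2 (Suc M) a b = (2 * (real (Suc M) + a + b + 1)) * jacobi_norm2 M (a + 1) (b + 1)"
  proof (rule integral_skew_zero)
    fix \<phi> :: real assume \<phi>: "\<phi> \<in> {0<..<pi/2}"
    have 1: "jacobi_fun_deriv (Suc M) a b \<phi> = - 2 * (real (Suc M) + a + b + 1) * jacobi_fun M (a + 1) (b + 1) \<phi>
       - (b * (sin \<phi> / cos \<phi>) - a * (cos \<phi> / sin \<phi>)) * jacobi_fun (Suc M) a b \<phi>"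
      using jacobi_fun_raise_raise[of M a b \<phi>] by linarith
    have 2: "jacobi_fun_deriv M (a + 1) (b + 1) \<phi> = 2 * real (Suc M) * jacobi_fun (Suc M) a b \<phi>
       - ((a + 1) * (cos \<phi> / sin \<phi>) - (b + 1) * (sin \<phi> / cos \<phi>)) * jacobi_fun M (a + 1) (b + 1) \<phi>"
      using jacobi_fun_lower_lower[OF \<phi>, of M a b] by linarith
    show "jacobi_fun_deriv (Suc M) a b \<phi> * jacobi_fun M (a + 1) (b + 1) \<phi> + jacobi_fun (Suc M) a b \<phi> * jacobi_fun_deriv M (a + 1) (b + 1) \<phi>
      + jacobi_fun (Suc M) a b \<phi> * jacobi_fun M (a + 1) (b + 1) \<phi> * (cos \<phi> / sin \<phi> - sin \<phi> / cos \<phi>)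
      = 2 * real (Suc M) * (jacobi_fun (Suc M) a b \<phi>)\<^sup>2 - 2 * (real (Suc M) + a + b + 1) * (jacobi_fun M (a + 1) (b + 1) \<phi>)\<^sup>2"
      unfolding 1 2 by algebra
  qed (use assms in auto)
  then show ?thesis by (simp only: mult.assoc mult_cancel_left) simp
qed

lemma jacobi_norm2_raise_lower:
  assumes "a \<ge> -1/2" "b \<ge> 1/2"
  shows "(real N + b) * jacobi_norm2 N (a + 1) (b - 1) = (real N + a + 1) * jacobi_norm2 N a b"
proof -
  have "(2 * (real N + a + 1)) * jacobi_norm2 N a b = (2 * (real N + b)) * jacobi_norm2 N (a + 1) (b - 1)"
  proof (rule integral_skew_zero)
    fix \<phi> :: real assume \<phi>: "\<phi> \<in> {0<..<pi/2}"
    have 1: "jacobi_fun_deriv N a b \<phi> = - 2 * (real N + b) * jacobi_fun N (a + 1) (b - 1) \<phi>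
       + (b * (sin \<phi> / cos \<phi>) + a * (cos \<phi> / sin \<phi>)) * jacobi_fun N a b \<phi>"
      using jacobi_fun_raise_lower[OF \<phi>, of N a b] by linarith
    have 2: "jacobi_fun_deriv N (a + 1) (b - 1) \<phi> = 2 * (real N + a + 1) * jacobi_fun N a b \<phi>
       - ((b - 1) * (sin \<phi> / cos \<phi>) + (a + 1) * (cos \<phi> / sin \<phi>)) * jacobi_fun N (a + 1) (b - 1) \<phi>"
      using jacobi_fun_lower_raise[OF \<phi>, of N a b] by linarith
    show "jacobi_fun_deriv N a b \<phi> * jacobi_fun N (a + 1) (b - 1) \<phi> + jacobi_fun N a b \<phi> * jacobi_fun_deriv N (a + 1) (b - 1) \<phi>
      + jacobi_fun N a b \<phi> * jacobi_fun N (a + 1) (b - 1) \<phi> * (cos \<phi> / sin \<phi> - sin \<phi> / cos \<phi>)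
      = 2 * (real N + a + 1) * (jacobi_fun N a b \<phi>)\<^sup>2 - 2 * (real N + b) * (jacobi_fun N (a + 1) (b - 1) \<phi>)\<^sup>2"
      unfolding 1 2 by algebra
  qed (use assms in auto)
  then show ?thesis by (simp only: mult.assoc mult_cancel_left) simp
qed

text \<open>Induction on N through \<open>jacobi_norm2_raise_raise\<close>, so that only N = 0 needs
  an argument on the integrand, which is positive inside the interval.\<close>

lemma jacobi_norm2_pos:
  assumes "a \<ge> -1/2" "b \<ge> -1/2"
  shows "jacobi_norm2 N a b > 0"
  using assms
proof (induction N arbitrary: a b)
  case 0
  let ?f = "\<lambda>\<phi>. jacobi_fun 0 a b \<phi> * jacobi_fun 0 a b \<phi> * sin \<phi> * cos \<phi>"
  have int: "set_integrable lborel {0..pi/2} ?f"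
    using 0 by (intro set_integrable_jacobi_fun_mult) auto
  have nonneg: "indicator {0..pi/2} \<phi> *\<^sub>R ?f \<phi> \<ge> 0" for \<phi>
    using sin_cos_ge_zero[of \<phi>] by (auto simp: indicator_def intro!: mult_nonneg_nonneg)
  have pos: "?f \<phi> > 0" if "\<phi> \<in> {0<..<pi/2}" for \<phi>
    using sin_cos_gt_zero[OF that] by (auto simp: jacobi_fun_alt jhom_def jcoeff_def)
  have "jacobi_norm2 0 a b \<noteq> 0"
  proof
    assume "jacobi_norm2 0 a b = 0"
    then have "AE \<phi> in lborel. indicator {0..pi/2} \<phi> *\<^sub>R ?f \<phi> = 0"
      using integral_nonneg_eq_0_iff_AE[OF int[unfolded set_integrable_def]] nonneg
      unfolding jacobi_norm2_def set_lebesgue_integral_def by auto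
    then have "AE \<phi> in lborel. \<phi> \<notin> {0<..<pi/2}"
    proof eventually_elim
      case (elim \<phi>)
      show "\<phi> \<notin> {0<..<pi/2}"
      proof
        assume h: "\<phi> \<in> {0<..<pi/2}"
        then have "indicator {0..pi/2} \<phi> *\<^sub>R ?f \<phi> = ?f \<phi>" by simp
        then show False using pos[OF h] elim by linarith
      qed
    qed
    then have "emeasure lborel {0<..<pi/2} = 0"
      by (intro null_setsD1) (simp only: AE_iff_null_sets[symmetric] sets_lborel borel_open open_greaterThanLessThan)
    then show False using emeasure_lborel_Ioo[of 0 "pi/2"] pi_gt_zero by (simp only:) simp
  qed
  moreover have "jacobi_norm2 0 a b \<ge> 0"
    unfolding jacobi_norm2_def set_lebesgue_integral_def using nonneg by (intro integral_nonneg_AE) auto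
  ultimately show ?case by simp
next
  case (Suc N)
  have "jacobi_norm2 N (a + 1) (b + 1) > 0" using Suc.prems by (intro Suc.IH) auto
  then have "(real (Suc N) + a + b + 1) * jacobi_norm2 N (a + 1) (b + 1) > 0"
    using Suc.prems by (intro mult_pos_pos) auto
  then show ?case
    unfolding jacobi_norm2_raise_raise[OF Suc.prems, symmetric] by (simp add: zero_less_mult_iff)
qed

section \<open>Weighted sums of squares of Jacobi functions\<close>


definition triples :: "nat \<Rightarrow> (nat \<times> nat \<times> nat) set" where
  "triples k = {(l, j, N). l + j + 2 * N = k}"

lemma finite_triples: "finite (triples k)"
  by (rule finite_subset[of _ "{..k} \<times> {..k} \<times> {..k}"]) (auto simp: triples_def)

text \<open>If 2 p + 1 is a natural number, this is the number of monomials of degree l in 2 p + 1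
  variables.\<close>

definition half_weight :: "real \<Rightarrow> nat \<Rightarrow> real" where
  "half_weight p l = pochhammer (2 * p + 1) l / fact l"

definition pred_seq :: "(nat \<Rightarrow> real) \<Rightarrow> nat \<Rightarrow> real" where
  "pred_seq e l = (case l of 0 \<Rightarrow> 0 | Suc l' \<Rightarrow> e l')"

text \<open>For such p this is the dimension of the spherical harmonics of degree l in dimension 2 p
  + 2. The two terms count the Cauchy data on a hyperplane: a homogeneous polynomial of degree l and
  one of degree l - 1.\<close>

definition full_weight :: "real \<Rightarrow> nat \<Rightarrow> real" where
  "full_weight p l = half_weight p l + pred_seq (half_weight p) l"

lemma pred_seq_simps [simp]: "pred_seq e 0 = 0" "pred_seq e (Suc l) = e l"
  by (simp_all add: pred_seq_def)

lemma half_weight_nonneg: "p \<ge> -1/2 \<Longrightarrow> half_weight p l \<ge> 0"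
  by (auto simp: half_weight_def pochhammer_prod intro!: divide_nonneg_pos prod_nonneg)

lemma pred_seq_half_weight_nonneg: "p \<ge> -1/2 \<Longrightarrow> pred_seq (half_weight p) l \<ge> 0"
  by (cases l) (auto simp: half_weight_nonneg)

lemma half_weight_le_full_weight: "p \<ge> -1/2 \<Longrightarrow> half_weight p l \<le> full_weight p l"
  by (simp add: full_weight_def pred_seq_half_weight_nonneg)

lemma full_weight_nonneg: "p \<ge> -1/2 \<Longrightarrow> full_weight p l \<ge> 0"
  using half_weight_nonneg half_weight_le_full_weight order_trans by blast

text \<open>A form of the recursion \<open>l * E l = (l + 2 * p) * E (l - 1)\<close>; it is the
  condition imposed on the weights in \<open>has_real_derivative_wsum\<close> when P = p.\<close>

lemma half_weight_diff:
  "(half_weight p l - pred_seq (half_weight p) l) * (real l + p) = full_weight p l * p"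
proof (cases l)
  case (Suc i)
  have "half_weight p (Suc i) * real (Suc i) = half_weight p i * (2 * p + 1 + real i)"
    unfolding half_weight_def by (simp add: pochhammer_Suc divide_simps del: of_nat_Suc)
  then show ?thesis unfolding Suc full_weight_def pred_seq_simps by (simp add: algebra_simps)
qed (simp add: half_weight_def full_weight_def)

definition jf :: "real \<Rightarrow> real \<Rightarrow> nat \<Rightarrow> nat \<Rightarrow> nat \<Rightarrow> real \<Rightarrow> real" where
  "jf P q l j N = jacobi_fun N (real l + P) (real j + q)"

definition jn :: "real \<Rightarrow> real \<Rightarrow> nat \<Rightarrow> nat \<Rightarrow> nat \<Rightarrow> real" where
  "jn P q l j N = jacobi_norm2 N (real l + P) (real j + q)"

text \<open>Each contiguous relation joins \<open>(l, j, N)\<close> to a neighbour. \<open>edge\<close> and \<open>edge'\<close> are the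
  contributions of such an edge to the derivative of \<open>wsum\<close> at its lower end; the contribution at the
  upper end is the opposite, by \<open>jn_raise_raise\<close> and \<open>jn_raise_lower\<close>.\<close>

definition edge :: "real \<Rightarrow> real \<Rightarrow> nat \<Rightarrow> nat \<Rightarrow> nat \<Rightarrow> real \<Rightarrow> real" where
  "edge P q l j N \<phi> = (case N of 0 \<Rightarrow> 0 | Suc M \<Rightarrow>
      half_weight q j * (- 2 * (real N + (real l + P) + (real j + q) + 1))
        * jf P q l j N \<phi> * jf P q (Suc l) (Suc j) M \<phi> / jn P q l j N)"

definition edge' :: "real \<Rightarrow> real \<Rightarrow> nat \<Rightarrow> nat \<Rightarrow> nat \<Rightarrow> real \<Rightarrow> real" where
  "edge' P q l j N \<phi> = (case j of 0 \<Rightarrow> 0 | Suc i \<Rightarrow>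
      half_weight q i * (- 2 * (real N + (real j + q)))
        * jf P q l j N \<phi> * jf P q (Suc l) i N \<phi> / jn P q l j N)"

text \<open>The weight in j is always the full one, but w stays free: it will be
  \<open>full_weight P\<close>, \<open>shifted_full p\<close> or the indicator of l = 0.\<close>

definition wsum :: "real \<Rightarrow> real \<Rightarrow> nat \<Rightarrow> (nat \<Rightarrow> real) \<Rightarrow> real \<Rightarrow> real" where
  "wsum P q k w \<phi> = (\<Sum>(l, j, N)\<in>triples k. w l * full_weight q j * (jf P q l j N \<phi>)\<^sup>2 / jn P q l j N)"

lemma jn_pos: "P \<ge> -1/2 \<Longrightarrow> q \<ge> 0 \<Longrightarrow> jn P q l j N > 0"
  unfolding jn_def by (rule jacobi_norm2_pos) auto

lemma jn_raise_raise:
  assumes "P \<ge> -1/2" "q \<ge> 0"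
  shows "real (Suc M) * jn P q l j (Suc M)
    = (real (Suc M) + (real l + P) + (real j + q) + 1) * jn P q (Suc l) (Suc j) M"
proof -
  have "real (Suc l) + P = (real l + P) + 1" "real (Suc j) + q = (real j + q) + 1" by simp_all
  then show ?thesis unfolding jn_def using assms by (simp only:) (rule jacobi_norm2_raise_raise, auto)
qed

lemma jn_raise_lower:
  assumes "P \<ge> -1/2" "q \<ge> 0"
  shows "(real N + (real (Suc i) + q)) * jn P q (Suc l) i N = (real N + (real l + P) + 1) * jn P q l (Suc i) N"
proof -
  have "real (Suc l) + P = (real l + P) + 1" "real i + q = (real (Suc i) + q) - 1" by simp_all
  then show ?thesis unfolding jn_def using assms by (simp only:) (rule jacobi_norm2_raise_lower, auto)
qed

text \<open>The product weight splits into four terms, one for each contiguous relation. The cot and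
  tan terms then recombine, by the two hypotheses, into the single expression
  \<open>q * t - p * c\<close>, which is independent of \<mu> and \<nu> and can be absorbed by a
  common prefactor.\<close>

lemma summand_algebra:
  fixes E :: real
  assumes "(E - Em) * \<mu> = (E + Em) * p" "(f - fm) * \<nu> = (f + fm) * q"
  shows "(E + Em) * (f + fm) * (H * H' + (q * t - p * c) * H\<^sup>2)
    = H * (E * f * (H' + (\<nu> * t - \<mu> * c) * H) + Em * fm * (H' + (\<mu> * c - \<nu> * t) * H)
      + E * fm * (H' - (\<nu> * t + \<mu> * c) * H) + Em * f * (H' + (\<nu> * t + \<mu> * c) * H))"
proof -
  have "H * (E * f * (H' + (\<nu> * t - \<mu> * c) * H) + Em * fm * (H' + (\<mu> * c - \<nu> * t) * H)
      + E * fm * (H' - (\<nu> * t + \<mu> * c) * H) + Em * f * (H' + (\<nu> * t + \<mu> * c) * H))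
    = H * H' * (E + Em) * (f + fm) + t * H\<^sup>2 * (E + Em) * ((f - fm) * \<nu>) - c * H\<^sup>2 * ((E - Em) * \<mu>) * (f + fm)"
    by algebra
  then show ?thesis unfolding assms by algebra
qed

text \<open>A conservation law at one vertex of the graph whose edges are the contiguous relations.
  The left side is half the derivative of one summand of \<open>sin \<phi> powr (- 2 * p) * cos
  \<phi> powr (- 2 * q) * wsum P q k w \<phi>\<close>, up to that prefactor; the right side is the
  flow through the two edges that raise l minus the flow through the two that lower it.\<close>

lemma wsum_summand:
  assumes P: "P \<ge> -1/2" "q \<ge> 0" and \<phi>: "\<phi> \<in> {0<..<pi/2}"
    and E: "(E l - Em l) * (real l + P) = (E l + Em l) * p" "l = 0 \<Longrightarrow> Em l = 0"
  shows "(E l + Em l) * full_weight q j / jn P q l j N *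
      (jf P q l j N \<phi> * jacobi_fun_deriv N (real l + P) (real j + q) \<phi>
        + (q * (sin \<phi> / cos \<phi>) - p * (cos \<phi> / sin \<phi>)) * (jf P q l j N \<phi>)\<^sup>2)
    = E l * (edge P q l j N \<phi> + edge' P q l j N \<phi>)
      - Em l * ((if l > 0 \<and> j > 0 then edge P q (l - 1) (j - 1) (Suc N) \<phi> else 0)
        + (if l > 0 then edge' P q (l - 1) (Suc j) N \<phi> else 0))"
proof -
  let ?f = "half_weight q j" and ?fm = "pred_seq (half_weight q) j"
  let ?H = "jf P q l j N \<phi>" and ?n = "jn P q l j N"
  let ?t = "sin \<phi> / cos \<phi>" and ?c = "cos \<phi> / sin \<phi>"
  let ?D = "jacobi_fun_deriv N (real l + P) (real j + q) \<phi>"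
  let ?\<mu> = "real l + P" and ?\<nu> = "real j + q"
  have n: "?n > 0" by (rule jn_pos[OF P])
  have 1: "?H * (E l * ?f * (?D + (?\<nu> * ?t - ?\<mu> * ?c) * ?H)) / ?n = E l * edge P q l j N \<phi>"
  proof (cases N)
    case 0
    then show ?thesis using jacobi_fun_raise_raise_0[of ?\<mu> ?\<nu> \<phi>] by (simp add: edge_def jf_def)
  next
    case (Suc M)
    have e: "real (Suc l) + P = ?\<mu> + 1" "real (Suc j) + q = ?\<nu> + 1" by simp_all
    show ?thesis
      unfolding edge_def Suc nat.case jf_def e jacobi_fun_raise_raise by (simp only: mult_ac times_divide_eq_right)
  qed
  have 2: "?H * (Em l * ?fm * (?D + (?\<mu> * ?c - ?\<nu> * ?t) * ?H)) / ?n
     = - (Em l * (if l > 0 \<and> j > 0 then edge P q (l - 1) (j - 1) (Suc N) \<phi> else 0))"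
  proof (cases "l = 0 \<or> j = 0")
    case True
    then show ?thesis using E(2) by auto
  next
    case False
    then obtain i i' where li: "l = Suc i" "j = Suc i'" by (meson not0_implies_Suc)
    have e: "real (Suc i) + P = (real i + P) + 1" "real (Suc i') + q = (real i' + q) + 1" by simp_all
    have m: "jn P q i i' (Suc N) > 0" by (rule jn_pos[OF P])
    have "edge P q i i' (Suc N) \<phi> = half_weight q i' * (- 2 * ((real (Suc N) + (real i + P) + (real i' + q) + 1)))
        * jf P q i i' (Suc N) \<phi> * ?H / jn P q i i' (Suc N)"
      unfolding edge_def li by simp
    also have "\<dots> = - (half_weight q i' * (2 * real (Suc N)) * jf P q i i' (Suc N) \<phi> * ?H / ?n)"
    proof -
      \<comment> \<open>The ratio of the norms exchanges the constant of the relation at the lower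
        end for that at the upper end. This is why the two contributions of an edge have opposite
        values.\<close>
      have r: "(real (Suc N) + (real i + P) + (real i' + q) + 1) / jn P q i i' (Suc N) = real (Suc N) / ?n"
        using jn_raise_raise[OF P, of N i i'] m n unfolding li by (subst frac_eq_eq) (simp_all only: mult_ac less_imp_neq[symmetric] not_False_eq_True)
      have neg: "h * (- 2 * A) * x * y / n = - (h * 2 * x * y * (A / n))" for h A x y n :: real
        by simp
      have "half_weight q i' * (- 2 * ((real (Suc N) + (real i + P) + (real i' + q) + 1)))
        * jf P q i i' (Suc N) \<phi> * ?H / jn P q i i' (Suc N)
        = - (half_weight q i' * 2 * jf P q i i' (Suc N) \<phi> * ?H * ((real (Suc N) + (real i + P) + (real i' + q) + 1) / jn P q i i' (Suc N)))"
        using neg by blast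
      then show ?thesis unfolding r by (simp add: mult_ac)
    qed
    finally have ed: "edge P q i i' (Suc N) \<phi> = - (half_weight q i' * (2 * real (Suc N)) * jf P q i i' (Suc N) \<phi> * ?H / ?n)" .
    have D: "?D + (?\<mu> * ?c - ?\<nu> * ?t) * ?H = 2 * real (Suc N) * jf P q i i' (Suc N) \<phi>"
      unfolding li jf_def e by (rule jacobi_fun_lower_lower[OF \<phi>])
    show ?thesis
      using ed unfolding D unfolding li by (simp add: mult_ac)
  qed
  have 3: "?H * (E l * ?fm * (?D - (?\<nu> * ?t + ?\<mu> * ?c) * ?H)) / ?n = E l * edge' P q l j N \<phi>"
  proof (cases j)
    case 0
    then show ?thesis by (simp add: edge'_def)
  next
    case (Suc i)
    have e: "real (Suc l) + P = ?\<mu> + 1" "real i + q = (real (Suc i) + q) - 1" by simp_all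
    show ?thesis
      unfolding edge'_def Suc nat.case jf_def e pred_seq_simps jacobi_fun_raise_lower[OF \<phi>] by (simp only: mult_ac times_divide_eq_right)
  qed
  have 4: "?H * (Em l * ?f * (?D + (?\<nu> * ?t + ?\<mu> * ?c) * ?H)) / ?n
     = - (Em l * (if l > 0 then edge' P q (l - 1) (Suc j) N \<phi> else 0))"
  proof (cases l)
    case 0
    then show ?thesis using E(2) by auto
  next
    case li: (Suc i)
    have e: "real (Suc i) + P = (real i + P) + 1" "real j + q = (real (Suc j) + q) - 1" by simp_all
    have m: "jn P q i (Suc j) N > 0" by (rule jn_pos[OF P])
    have r: "(real N + (real (Suc j) + q)) / jn P q i (Suc j) N = (real N + (real i + P) + 1) / ?n"
      using jn_raise_lower[OF P, of N j i] m n unfolding li by (subst frac_eq_eq) (simp_all only: mult_ac less_imp_neq[symmetric] not_False_eq_True)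
    have neg: "h * (- 2 * A) * x * y / n = - (h * 2 * x * y * (A / n))" for h A x y n :: real
      by simp
    have "edge' P q i (Suc j) N \<phi> = - (half_weight q j * 2 * jf P q i (Suc j) N \<phi> * ?H * ((real N + (real (Suc j) + q)) / jn P q i (Suc j) N))"
      unfolding edge'_def li nat.case by (rule neg)
    then have ed: "edge' P q i (Suc j) N \<phi> = - (half_weight q j * 2 * jf P q i (Suc j) N \<phi> * ?H * ((real N + (real i + P) + 1) / ?n))"
      unfolding r .
    have D: "?D + (?\<nu> * ?t + ?\<mu> * ?c) * ?H = 2 * (real N + (real i + P) + 1) * jf P q i (Suc j) N \<phi>"
      unfolding li jf_def e by (rule jacobi_fun_lower_raise[OF \<phi>])
    show ?thesis
      using ed unfolding D unfolding li by (simp add: mult_ac)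
  qed
  have "(E l + Em l) * full_weight q j / ?n * (?H * ?D + (q * ?t - p * ?c) * ?H\<^sup>2)
    = (E l + Em l) * (?f + ?fm) * (?H * ?D + (q * ?t - p * ?c) * ?H\<^sup>2) / ?n"
    by (simp add: full_weight_def)
  also have "\<dots> = ?H * (E l * ?f * (?D + (?\<nu> * ?t - ?\<mu> * ?c) * ?H) + Em l * ?fm * (?D + (?\<mu> * ?c - ?\<nu> * ?t) * ?H)
      + E l * ?fm * (?D - (?\<nu> * ?t + ?\<mu> * ?c) * ?H) + Em l * ?f * (?D + (?\<nu> * ?t + ?\<mu> * ?c) * ?H)) / ?n"
    by (subst summand_algebra[OF E(1) half_weight_diff[unfolded full_weight_def]]) (rule refl)
  also have "\<dots> = ?H * (E l * ?f * (?D + (?\<nu> * ?t - ?\<mu> * ?c) * ?H)) / ?n + ?H * (Em l * ?fm * (?D + (?\<mu> * ?c - ?\<nu> * ?t) * ?H)) / ?n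
      + ?H * (E l * ?fm * (?D - (?\<nu> * ?t + ?\<mu> * ?c) * ?H)) / ?n + ?H * (Em l * ?f * (?D + (?\<nu> * ?t + ?\<mu> * ?c) * ?H)) / ?n"
    by (simp only: distrib_left[of ?H] add_divide_distrib)
  finally show ?thesis unfolding 1 2 3 4 by (simp add: algebra_simps)
qed

text \<open>Both kinds of edge raise l by one, so counting them from the lower instead of the upper
  end replaces \<open>Em l\<close> by \<open>Em (Suc l)\<close>. Triples with N = 0 or j = 0, which
  are not the lower end of an edge of the respective kind, contribute zero by definition of
  \<open>edge\<close> and \<open>edge'\<close>.\<close>

lemma sum_edge_shift:
  "(\<Sum>(l, j, N)\<in>triples k. Em l * ((if l > 0 \<and> j > 0 then edge P q (l - 1) (j - 1) (Suc N) \<phi> else 0)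
        + (if l > 0 then edge' P q (l - 1) (Suc j) N \<phi> else 0)))
    = (\<Sum>(l, j, N)\<in>triples k. Em (Suc l) * (edge P q l j N \<phi> + edge' P q l j N \<phi>))"
proof -
  have 1: "(\<Sum>(l, j, N)\<in>triples k. Em l * (if l > 0 \<and> j > 0 then edge P q (l - 1) (j - 1) (Suc N) \<phi> else 0))
     = (\<Sum>(l, j, N)\<in>triples k. Em (Suc l) * edge P q l j N \<phi>)"
  proof -
    have "(\<Sum>(l, j, N)\<in>triples k. Em l * (if l > 0 \<and> j > 0 then edge P q (l - 1) (j - 1) (Suc N) \<phi> else 0))
      = (\<Sum>(l, j, N)\<in>{(l, j, N)\<in>triples k. l > 0 \<and> j > 0}. Em l * edge P q (l - 1) (j - 1) (Suc N) \<phi>)"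
      by (intro sum.mono_neutral_cong_right finite_triples) (auto split: if_splits)
    also have "\<dots> = (\<Sum>(l, j, N)\<in>{(l, j, N)\<in>triples k. N > 0}. Em (Suc l) * edge P q l j N \<phi>)"
      by (rule sum.reindex_bij_witness[of _ "\<lambda>(l, j, N). (Suc l, Suc j, N - 1)" "\<lambda>(l, j, N). (l - 1, j - 1, Suc N)"])
         (auto simp: triples_def)
    also have "\<dots> = (\<Sum>(l, j, N)\<in>triples k. Em (Suc l) * edge P q l j N \<phi>)"
      by (intro sum.mono_neutral_cong_left finite_triples) (auto simp: edge_def split: nat.splits)
    finally show ?thesis .
  qed
  have 2: "(\<Sum>(l, j, N)\<in>triples k. Em l * (if l > 0 then edge' P q (l - 1) (Suc j) N \<phi> else 0))
     = (\<Sum>(l, j, N)\<in>triples k. Em (Suc l) * edge' P q l j N \<phi>)"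
  proof -
    have "(\<Sum>(l, j, N)\<in>triples k. Em l * (if l > 0 then edge' P q (l - 1) (Suc j) N \<phi> else 0))
      = (\<Sum>(l, j, N)\<in>{(l, j, N)\<in>triples k. l > 0}. Em l * edge' P q (l - 1) (Suc j) N \<phi>)"
      by (intro sum.mono_neutral_cong_right finite_triples) (auto split: if_splits)
    also have "\<dots> = (\<Sum>(l, j, N)\<in>{(l, j, N)\<in>triples k. j > 0}. Em (Suc l) * edge' P q l j N \<phi>)"
      by (rule sum.reindex_bij_witness[of _ "\<lambda>(l, j, N). (Suc l, j - 1, N)" "\<lambda>(l, j, N). (l - 1, Suc j, N)"])
         (auto simp: triples_def)
    also have "\<dots> = (\<Sum>(l, j, N)\<in>triples k. Em (Suc l) * edge' P q l j N \<phi>)"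
      by (intro sum.mono_neutral_cong_left finite_triples) (auto simp: edge'_def split: nat.splits)
    finally show ?thesis .
  qed
  show ?thesis
    using 1 2 by (simp add: distrib_left sum.distrib split_def)
qed

text \<open>After telescoping, an edge from l to l + 1 keeps only the factor
  \<open>E l - Em (Suc l)\<close>. The Jacobi parameter \<open>P\<close> and the exponent
  \<open>p\<close> of the prefactor are separate: for P = p all these factors can be made zero, and
  for P = p - 1/2 all but those with l = 0.\<close>

theorem has_real_derivative_wsum:
  assumes P: "P \<ge> -1/2" "q \<ge> 0" and \<phi>: "\<phi> \<in> {0<..<pi/2}"
    and w: "\<And>l. w l = E l + Em l"
    and E: "\<And>l. (E l - Em l) * (real l + P) = w l * p" "Em 0 = 0"
  shows "((\<lambda>\<phi>. sin \<phi> powr (- 2 * p) * cos \<phi> powr (- 2 * q) * wsum P q k w \<phi>) has_real_derivative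
     2 * sin \<phi> powr (- 2 * p) * cos \<phi> powr (- 2 * q)
       * (\<Sum>(l, j, N)\<in>triples k. (E l - Em (Suc l)) * (edge P q l j N \<phi> + edge' P q l j N \<phi>))) (at \<phi>)"
proof -
  note sc = sin_cos_gt_zero[OF \<phi>]
  let ?t = "sin \<phi> / cos \<phi>" and ?c = "cos \<phi> / sin \<phi>"
  have 1: "((\<lambda>\<phi>. sin \<phi> powr (- 2 * p)) has_real_derivative - 2 * p * ?c * sin \<phi> powr (- 2 * p)) (at \<phi>)"
    using sc by (auto intro!: derivative_eq_intros simp: powr_diff)
  have 2: "((\<lambda>\<phi>. cos \<phi> powr (- 2 * q)) has_real_derivative 2 * q * ?t * cos \<phi> powr (- 2 * q)) (at \<phi>)"
    using sc by (auto intro!: derivative_eq_intros simp: powr_diff)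
  have 3: "(wsum P q k w has_real_derivative (\<Sum>(l, j, N)\<in>triples k. w l * full_weight q j / jn P q l j N
      * (2 * (jf P q l j N \<phi> * jacobi_fun_deriv N (real l + P) (real j + q) \<phi>)))) (at \<phi>)"
  proof -
    have "((\<lambda>\<phi>. w l * full_weight q j * (jf P q l j N \<phi>)\<^sup>2 / jn P q l j N) has_real_derivative
        w l * full_weight q j / jn P q l j N * (2 * (jf P q l j N \<phi> * jacobi_fun_deriv N (real l + P) (real j + q) \<phi>))) (at \<phi>)" for l j N
      using has_real_derivative_jacobi_fun[OF \<phi>, of N "real l + P" "real j + q"] unfolding jf_def
      using jn_pos[OF P, of l j N] by (auto intro!: derivative_eq_intros)
    then show ?thesis
      unfolding wsum_def[abs_def] split_def by (intro DERIV_sum) auto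
  qed
  have "(\<Sum>(l, j, N)\<in>triples k. (E l - Em (Suc l)) * (edge P q l j N \<phi> + edge' P q l j N \<phi>))
     = (\<Sum>(l, j, N)\<in>triples k. w l * full_weight q j / jn P q l j N *
      (jf P q l j N \<phi> * jacobi_fun_deriv N (real l + P) (real j + q) \<phi>
        + (q * ?t - p * ?c) * (jf P q l j N \<phi>)\<^sup>2))"
  proof -
    have "(\<Sum>(l, j, N)\<in>triples k. w l * full_weight q j / jn P q l j N *
      (jf P q l j N \<phi> * jacobi_fun_deriv N (real l + P) (real j + q) \<phi>
        + (q * ?t - p * ?c) * (jf P q l j N \<phi>)\<^sup>2))
      = (\<Sum>(l, j, N)\<in>triples k. E l * (edge P q l j N \<phi> + edge' P q l j N \<phi>)
      - Em l * ((if l > 0 \<and> j > 0 then edge P q (l - 1) (j - 1) (Suc N) \<phi> else 0)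
        + (if l > 0 then edge' P q (l - 1) (Suc j) N \<phi> else 0)))"
    proof -
      have E1: "(E l - Em l) * (real l + P) = (E l + Em l) * p" for l using E(1)[of l] unfolding w .
      have *: "(E l + Em l) * full_weight q j / jn P q l j N *
          (jf P q l j N \<phi> * jacobi_fun_deriv N (real l + P) (real j + q) \<phi> + (q * ?t - p * ?c) * (jf P q l j N \<phi>)\<^sup>2)
        = E l * (edge P q l j N \<phi> + edge' P q l j N \<phi>)
        - Em l * ((if l > 0 \<and> j > 0 then edge P q (l - 1) (j - 1) (Suc N) \<phi> else 0)
        + (if l > 0 then edge' P q (l - 1) (Suc j) N \<phi> else 0))" for l j N
        by (rule wsum_summand[OF P \<phi> E1]) (simp add: E(2))
      show ?thesis unfolding w * ..
    qed
    also have "\<dots> = (\<Sum>(l, j, N)\<in>triples k. E l * (edge P q l j N \<phi> + edge' P q l j N \<phi>))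
      - (\<Sum>(l, j, N)\<in>triples k. Em (Suc l) * (edge P q l j N \<phi> + edge' P q l j N \<phi>))"
      unfolding sum_edge_shift[symmetric] by (simp only: split_def sum_subtractf)
    also have "\<dots> = (\<Sum>(l, j, N)\<in>triples k. (E l - Em (Suc l)) * (edge P q l j N \<phi> + edge' P q l j N \<phi>))"
      by (simp only: split_def sum_subtractf[symmetric] left_diff_distrib)
    finally show ?thesis ..
  qed
  also have "\<dots> = (\<Sum>(l, j, N)\<in>triples k. w l * full_weight q j / jn P q l j N
      * (jf P q l j N \<phi> * jacobi_fun_deriv N (real l + P) (real j + q) \<phi>)) + (q * ?t - p * ?c) * wsum P q k w \<phi>"
    unfolding wsum_def sum_distrib_left split_def sum.distrib[symmetric]
    by (intro sum.cong refl) (simp add: distrib_left)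
  finally have S: "(\<Sum>(l, j, N)\<in>triples k. (E l - Em (Suc l)) * (edge P q l j N \<phi> + edge' P q l j N \<phi>)) = \<dots>" .
  have T: "(\<Sum>(l, j, N)\<in>triples k. w l * full_weight q j / jn P q l j N
      * (2 * (jf P q l j N \<phi> * jacobi_fun_deriv N (real l + P) (real j + q) \<phi>)))
     = 2 * (\<Sum>(l, j, N)\<in>triples k. w l * full_weight q j / jn P q l j N
      * (jf P q l j N \<phi> * jacobi_fun_deriv N (real l + P) (real j + q) \<phi>))"
    unfolding sum_distrib_left split_def by (intro sum.cong refl) simp
  show ?thesis
    by (rule DERIV_cong[OF DERIV_mult[OF DERIV_mult[OF 1 2] 3]]) (unfold S T, algebra)
qed


section \<open>Growth of the weights, and the sum in the case of equal parameters\<close>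

lemma positive_sequence_bounds:
  fixes r :: "nat \<Rightarrow> real"
  assumes "r \<longlonglongrightarrow> L" "L > 0" "\<And>n. r n > 0"
  shows "\<exists>c C. c > 0 \<and> C > 0 \<and> (\<forall>n. c \<le> r n \<and> r n \<le> C)"
proof -
  have "Bseq r" using assms(1) convergentI convergent_imp_Bseq by blast
  then obtain C where C: "C > 0" "\<And>n. norm (r n) \<le> C" by (auto simp: Bseq_def)
  have "(\<lambda>n. inverse (r n)) \<longlonglongrightarrow> inverse L" using assms by (intro tendsto_inverse) auto
  then have "Bseq (\<lambda>n. inverse (r n))" using convergentI convergent_imp_Bseq by blast
  then obtain D where D: "D > 0" "\<And>n. norm (inverse (r n)) \<le> D" by (auto simp: Bseq_def)
  have "inverse D \<le> r n" for n
    using D(2)[of n] D(1) assms(3)[of n] by (simp add: field_simps)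
  moreover have "r n \<le> C" for n using C(2)[of n] by simp
  ultimately show ?thesis using C(1) D(1) by (intro exI[of _ "inverse D"] exI[of _ C]) auto
qed

text \<open>\<open>pochhammer x n / fact n\<close> is asymptotic to
  \<open>n powr (x - 1) / Gamma x\<close> by Gauss's limit \<open>Gamma_series\<close>. With n + 1
  as the base, the quotient is positive at n = 0 too, so its positive limit yields two-sided bounds
  for all n.\<close>

lemma pochhammer_fact_bounds:
  fixes x :: real
  assumes "x > 0"
  shows "\<exists>c C. c > 0 \<and> C > 0 \<and> (\<forall>n. c * (real n + 1) powr (x - 1) \<le> pochhammer x n / fact n
      \<and> pochhammer x n / fact n \<le> C * (real n + 1) powr (x - 1))"
proof -
  define r where "r n = (pochhammer x n / fact n) / (real n + 1) powr (x - 1)" for n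
  have r: "r n = (real n / real (Suc n)) powr x * (real (Suc n) / (x + real n)) / Gamma_series x n" if "n > 0" for n
  proof -
    have "exp (x * ln (real n)) = real n powr x" using that by (simp add: powr_def)
    moreover have "pochhammer x n > 0" using assms by (rule pochhammer_pos)
    moreover have "(A / F) / (Y / m) = (X / Y) * (m / z) / (X * F / (A * z))"
      if "A > 0" "F > 0" "X > 0" "Y > 0" "m > 0" "z > 0" for A F X Y m z :: real
      using that by (simp add: divide_simps)
    ultimately show ?thesis
      using that assms unfolding r_def Gamma_series_def
      by (simp add: powr_diff powr_divide pochhammer_Suc add.commute)
  qed
  have 1: "(\<lambda>n. real n / real (Suc n)) \<longlonglongrightarrow> 1" by (rule LIMSEQ_n_over_Suc_n)
  have "(\<lambda>n. x * inverse (real (Suc n)) + real n / real (Suc n)) \<longlonglongrightarrow> x * 0 + 1"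
    by (intro tendsto_add tendsto_mult tendsto_const 1 LIMSEQ_inverse_real_of_nat)
  then have "(\<lambda>n. inverse (x * inverse (real (Suc n)) + real n / real (Suc n))) \<longlonglongrightarrow> inverse 1"
    by (intro tendsto_inverse) auto
  moreover have "inverse (x * inverse (real (Suc n)) + real n / real (Suc n)) = real (Suc n) / (x + real n)" for n
  proof -
    have "x * inverse (real (Suc n)) + real n / real (Suc n) = (x + real n) / real (Suc n)"
      by (simp add: divide_inverse distrib_right)
    then show ?thesis by (simp only: inverse_divide)
  qed
  ultimately have 2: "(\<lambda>n. real (Suc n) / (x + real n)) \<longlonglongrightarrow> 1" by simp
  have "(\<lambda>n. (real n / real (Suc n)) powr x * (real (Suc n) / (x + real n)) / Gamma_series x n) \<longlonglongrightarrow> 1 powr x * 1 / Gamma x"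
    using assms by (intro tendsto_divide tendsto_mult tendsto_powr 1 2 tendsto_const Gamma_series_LIMSEQ)
      (auto simp: Gamma_eq_zero_iff nonpos_Ints_def)
  then have "r \<longlonglongrightarrow> 1 powr x * 1 / Gamma x"
    by (rule Lim_transform_eventually) (use r in \<open>auto simp: eventually_at_top_linorder intro!: exI[of _ 1]\<close>)
  moreover have "r n > 0" for n
    using assms by (auto simp: r_def intro!: divide_pos_pos pochhammer_pos)
  ultimately obtain c C where "c > 0" "C > 0" and b: "\<And>n. c \<le> r n" "\<And>n. r n \<le> C"
    using positive_sequence_bounds[of r "1 powr x * 1 / Gamma x"] Gamma_real_pos[OF assms] by auto
  moreover have "pochhammer x n / fact n = r n * (real n + 1) powr (x - 1)" for n
    by (simp add: r_def)
  ultimately show ?thesis by (intro exI[of _ c] exI[of _ C]) (auto intro!: mult_right_mono)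
qed

text \<open>The hockey-stick identity: a monomial of degree at most k becomes one of degree k by
  adding a variable.\<close>

lemma sum_half_weight: "(\<Sum>l\<le>k. half_weight p l) = pochhammer (2 * p + 2) k / fact k"
proof (induction k)
  case (Suc k)
  have "half_weight p (Suc k) = (2 * p + 1) / (real k + 1) * (pochhammer (2 * p + 2) k / fact k)"
    unfolding half_weight_def by (simp add: pochhammer_rec add.commute field_simps)
  moreover have "pochhammer (2 * p + 2) (Suc k) / fact (Suc k) = (2 * p + 2 + real k) / (real k + 1) * (pochhammer (2 * p + 2) k / fact k)"
    by (simp add: pochhammer_Suc add.commute)
  moreover have "B + (2 * p + 1) / (real k + 1) * B = (2 * p + 2 + real k) / (real k + 1) * B" for B
    by (simp add: field_simps)
  ultimately show ?case unfolding sum.atMost_Suc Suc by (simp only:)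
qed (simp add: half_weight_def)

lemma sum_full_weight_le:
  assumes "p \<ge> -1/2"
  shows "\<exists>C>0. \<forall>k. (\<Sum>l\<le>k. full_weight p l) \<le> C * (real k + 1) powr (2 * p + 1)"
proof -
  obtain C where C: "C > 0" "\<And>n. pochhammer (2 * p + 2) n / fact n \<le> C * (real n + 1) powr (2 * p + 2 - 1)"
    using pochhammer_fact_bounds[of "2 * p + 2"] assms by auto
  have "(\<Sum>l\<le>k. full_weight p l) \<le> 2 * C * (real k + 1) powr (2 * p + 1)" for k
  proof -
    have "(\<Sum>l\<le>k. pred_seq (half_weight p) l) \<le> (\<Sum>l\<le>Suc k. pred_seq (half_weight p) l)"
      using pred_seq_half_weight_nonneg[OF assms] by (intro sum_mono2) auto
    also have "\<dots> = (\<Sum>l\<le>k. half_weight p l)" by (subst sum.atMost_Suc_shift) simp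
    finally have "(\<Sum>l\<le>k. full_weight p l) \<le> 2 * (pochhammer (2 * p + 2) k / fact k)"
      unfolding full_weight_def sum.distrib sum_half_weight by simp
    then show ?thesis using C(2)[of k] by (simp add: algebra_simps)
  qed
  then show ?thesis using C(1) by (intro exI[of _ "2 * C"]) auto
qed

lemma full_weight_ge:
  assumes "p > -1/2"
  shows "\<exists>c>0. \<forall>l. c * (real l + 1) powr (2 * p) \<le> full_weight p l"
proof -
  obtain c where c: "c > 0" "\<And>n. c * (real n + 1) powr (2 * p + 1 - 1) \<le> half_weight p n"
    using pochhammer_fact_bounds[of "2 * p + 1"] assms unfolding half_weight_def by auto
  then show ?thesis using half_weight_le_full_weight[of p] assms
    by (intro exI[of _ c]) (auto intro: order_trans)
qed

lemma borel_measurable_jf [measurable]: "jf P q l j N \<in> borel_measurable borel"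
  unfolding jf_def by measurable

lemma set_integral_wsum:
  assumes "P \<ge> -1/2" "q \<ge> 0"
  shows "(LINT \<phi>:{0..pi/2}|lborel. wsum P q k w \<phi> * sin \<phi> * cos \<phi>)
    = (\<Sum>(l, j, N)\<in>triples k. w l * full_weight q j)"
proof -
  let ?g = "\<lambda>x \<phi>. case x of (l, j, N) \<Rightarrow> w l * full_weight q j / jn P q l j N * (jf P q l j N \<phi> * jf P q l j N \<phi> * sin \<phi> * cos \<phi>)"
  have i: "set_integrable lborel {0..pi/2} (\<lambda>\<phi>. jf P q l j N \<phi> * jf P q l j N \<phi> * sin \<phi> * cos \<phi>)" for l j N
    unfolding jf_def by (rule set_integrable_jacobi_fun_mult) (use assms in auto)
  have "(LINT \<phi>:{0..pi/2}|lborel. wsum P q k w \<phi> * sin \<phi> * cos \<phi>) = (LINT \<phi>:{0..pi/2}|lborel. (\<Sum>x\<in>triples k. ?g x \<phi>))"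
    unfolding wsum_def sum_distrib_right by (intro arg_cong[of _ _ "set_lebesgue_integral lborel _"] ext sum.cong)
      (auto simp: power2_eq_square)
  also have "\<dots> = (\<Sum>x\<in>triples k. LINT \<phi>:{0..pi/2}|lborel. ?g x \<phi>)"
    unfolding set_lebesgue_integral_def scaleR_sum_right using i
    by (intro Bochner_Integration.integral_sum) (auto simp only: set_integrable_def[symmetric] split_paired_all prod.case intro!: set_integrable_mult_right)
  also have "\<dots> = (\<Sum>(l, j, N)\<in>triples k. w l * full_weight q j)"
  proof (intro sum.cong refl)
    fix x assume "x \<in> triples k"
    obtain l j N where x: "x = (l, j, N)" by (cases x)
    have "(LINT \<phi>:{0..pi/2}|lborel. ?g x \<phi>) = w l * full_weight q j / jn P q l j N * jn P q l j N"
      unfolding x prod.case set_integral_mult_right by (simp add: jn_def jacobi_norm2_def jf_def)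
    then show "(LINT \<phi>:{0..pi/2}|lborel. ?g x \<phi>) = (case x of (l, j, N) \<Rightarrow> w l * full_weight q j)"
      using jn_pos[OF assms, of l j N] by (simp add: x)
  qed
  finally show ?thesis .
qed

lemma wsum_full_weight_const:
  assumes "P \<ge> -1/2" "q \<ge> 0" "\<phi> \<in> {0<..<pi/2}"
  shows "wsum P q k (full_weight P) \<phi>
    = (\<Sum>(l, j, N)\<in>triples k. full_weight P l * full_weight q j) / jacobi_norm2 0 P q * (sin \<phi> powr (2 * P) * cos \<phi> powr (2 * q))"
proof -
  let ?G = "\<lambda>\<phi>. sin \<phi> powr (- 2 * P) * cos \<phi> powr (- 2 * q) * wsum P q k (full_weight P) \<phi>"
  define K where "K = ?G \<phi>"
  have der: "(?G has_real_derivative 0) (at x)" if "x \<in> {0<..<pi/2}" for x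
    using has_real_derivative_wsum[OF assms(1,2) that, of "full_weight P" "half_weight P" "pred_seq (half_weight P)" P k]
      half_weight_diff[of P] by (simp add: full_weight_def)
  have "?G x = K" if "x \<in> {0<..<pi/2}" for x
    unfolding K_def by (rule DERIV_isconst3[of 0 "pi/2"]) (use that assms(3) der in auto)
  note G = this
  have K: "wsum P q k (full_weight P) x = K * (sin x powr (2 * P) * cos x powr (2 * q))" if "x \<in> {0<..<pi/2}" for x
  proof -
    have "w = K * (A * B)" if "inverse A * inverse B * w = K" "A > 0" "B > 0" for A B w :: real
      using that by (auto simp: field_simps)
    note gen = this
    have "sin x powr (2 * P) > 0" "cos x powr (2 * q) > 0" using sin_cos_gt_zero[OF that] by auto
    from gen[OF G[OF that, unfolded mult_minus_left powr_minus] this] show ?thesis .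
  qed
  \<comment> \<open>Inside the interval the right-hand function of \<open>K\<close> is the square of
    the lowest Jacobi function, so integration against sin x cos x brings in
    \<open>jacobi_norm2 0 P q\<close> on one side and, by \<open>set_integral_wsum\<close>, the
    plain sum of weights on the other. At the ends sin x cos x vanishes.\<close>
  have *: "wsum P q k (full_weight P) x * sin x * cos x = K * (jacobi_fun 0 P q x * jacobi_fun 0 P q x * sin x * cos x)"
    if "x \<in> {0..pi/2}" for x
  proof (cases "x \<in> {0<..<pi/2}")
    case True
    have "jacobi_fun 0 P q x * jacobi_fun 0 P q x * sin x * cos x = (sin x powr (2 * P) * sin x) * (cos x powr (2 * q) * cos x)"
    proof -
      have 1: "y powr (c + c + 1) = y powr (2 * c) * y" if "y > 0" for y c :: real
        using that by (simp only: powr_add powr_one mult_2)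
      have 2: "jhom 0 P q S C = 1" for S C by (simp add: jhom_def jcoeff_def)
      show ?thesis
        unfolding jacobi_fun_mult_weight[OF that] 2 1[OF sin_cos_gt_zero(1)[OF True]] 1[OF sin_cos_gt_zero(2)[OF True]]
        by (simp only: mult_1_right)
    qed
    then show ?thesis unfolding K[OF True] by (simp only: mult_ac)
  next
    case False
    then have "x = 0 \<or> x = pi/2" using that by auto
    then have "sin x * cos x = 0" by (elim disjE) (simp_all only: sin_zero cos_pi_half mult_zero_left mult_zero_right)
    then show ?thesis by auto
  qed
  have "(\<Sum>(l, j, N)\<in>triples k. full_weight P l * full_weight q j) = (LINT x:{0..pi/2}|lborel. wsum P q k (full_weight P) x * sin x * cos x)"
    using set_integral_wsum[OF assms(1,2)] by simp
  also have "\<dots> = (LINT x:{0..pi/2}|lborel. K * (jacobi_fun 0 P q x * jacobi_fun 0 P q x * sin x * cos x))"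
    by (intro set_lebesgue_integral_cong) (use * in auto)
  also have "\<dots> = K * jacobi_norm2 0 P q"
    unfolding set_integral_mult_right jacobi_norm2_def ..
  finally have "K = (\<Sum>(l, j, N)\<in>triples k. full_weight P l * full_weight q j) / jacobi_norm2 0 P q"
    using jacobi_norm2_pos[of P q 0] assms by (simp add: field_simps)
  then show ?thesis using K[OF assms(3)] by simp
qed

lemma wsum_mono:
  assumes "P \<ge> -1/2" "q \<ge> 0" "\<And>l. w l \<le> w' l"
  shows "wsum P q k w \<phi> \<le> wsum P q k w' \<phi>"
  unfolding wsum_def
proof (intro sum_mono, clarify)
  fix l j N
  show "w l * full_weight q j * (jf P q l j N \<phi>)\<^sup>2 / jn P q l j N \<le> w' l * full_weight q j * (jf P q l j N \<phi>)\<^sup>2 / jn P q l j N"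
    using assms(2) jn_pos[OF assms(1,2), of l j N] full_weight_nonneg[of q j]
    by (intro divide_right_mono mult_right_mono assms(3)) auto
qed

lemma wsum_scale: "wsum P q k (\<lambda>l. c * w l) \<phi> = c * wsum P q k w \<phi>"
  unfolding wsum_def sum_distrib_left by (intro sum.cong) auto

lemma wsum_full_weight_le:
  assumes "P \<ge> -1/2" "q \<ge> 0"
  shows "\<exists>C>0. \<forall>k. \<forall>\<phi>\<in>{0<..<pi/2}. wsum P q k (full_weight P) \<phi>
    \<le> C * (real k + 1) powr (2 * P + 2 * q + 2) * (sin \<phi> powr (2 * P) * cos \<phi> powr (2 * q))"
proof -
  obtain C1 where C1: "C1 > 0" "\<And>k. (\<Sum>l\<le>k. full_weight P l) \<le> C1 * (real k + 1) powr (2 * P + 1)"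
    using sum_full_weight_le[OF assms(1)] by blast
  obtain C2 where C2: "C2 > 0" "\<And>k. (\<Sum>l\<le>k. full_weight q l) \<le> C2 * (real k + 1) powr (2 * q + 1)"
    using sum_full_weight_le[of q] assms by auto
  have n: "jacobi_norm2 0 P q > 0" using assms by (intro jacobi_norm2_pos) auto
  have W: "full_weight P l \<ge> 0" "full_weight q l \<ge> 0" for l using assms full_weight_nonneg by auto
  have "(\<Sum>(l, j, N)\<in>triples k. full_weight P l * full_weight q j) \<le> C1 * C2 * (real k + 1) powr (2 * P + 2 * q + 2)" for k
  proof -
    \<comment> \<open>N is determined by (l, j), so forgetting it is injective. The sum is then
      dominated by the sum over a full square, which factorises and gives the exponent (2 P + 1) +
      (2 q + 1).\<close>
    have "(\<Sum>(l, j, N)\<in>triples k. full_weight P l * full_weight q j)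
      = (\<Sum>(l, j)\<in>(\<lambda>(l, j, N). (l, j)) ` triples k. full_weight P l * full_weight q j)"
      by (subst sum.reindex) (auto simp: inj_on_def triples_def split_def)
    also have "\<dots> \<le> (\<Sum>(l, j)\<in>{..k} \<times> {..k}. full_weight P l * full_weight q j)"
      using W by (intro sum_mono2) (auto simp: triples_def)
    also have "\<dots> = (\<Sum>l\<le>k. full_weight P l) * (\<Sum>l\<le>k. full_weight q l)"
      by (simp add: sum_product sum.cartesian_product)
    also have "\<dots> \<le> (C1 * (real k + 1) powr (2 * P + 1)) * (C2 * (real k + 1) powr (2 * q + 1))"
      using C1 C2 W by (intro mult_mono sum_nonneg) auto
    also have "\<dots> = C1 * C2 * (real k + 1) powr (2 * P + 2 * q + 2)"
      by (simp add: powr_add[symmetric] algebra_simps)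
    finally show ?thesis .
  qed
  then have "wsum P q k (full_weight P) \<phi> \<le> C1 * C2 / jacobi_norm2 0 P q * (real k + 1) powr (2 * P + 2 * q + 2) * (sin \<phi> powr (2 * P) * cos \<phi> powr (2 * q))"
    if "\<phi> \<in> {0<..<pi/2}" for k \<phi>
    unfolding wsum_full_weight_const[OF assms that] using n by (intro mult_right_mono) (auto simp: field_simps)
  then show ?thesis using C1 C2 n by (intro exI[of _ "C1 * C2 / jacobi_norm2 0 P q"]) auto
qed

text \<open>The exponent s is not bound to P, since the exceptional case combines the Jacobi
  parameter p + 1/2 with the growth 2 p.\<close>

definition jsum :: "real \<Rightarrow> real \<Rightarrow> real \<Rightarrow> nat \<Rightarrow> real \<Rightarrow> real" where
  "jsum P s q k \<phi> = (\<Sum>(l, j, N)\<in>triples k. (real l + 1) powr s * (real j + 1) powr (2 * q) * (jf P q l j N \<phi>)\<^sup>2 / jn P q l j N)"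

lemma jsum_le_wsum:
  assumes "P \<ge> -1/2" "q \<ge> 0" "c > 0" "\<And>l. c * (real l + 1) powr s \<le> w l"
  shows "\<exists>C>0. \<forall>k \<phi>. jsum P s q k \<phi> \<le> C * wsum P q k w \<phi>"
proof -
  obtain d where d: "d > 0" "\<And>l. d * (real l + 1) powr (2 * q) \<le> full_weight q l"
    using full_weight_ge[of q] assms by auto
  have "jsum P s q k \<phi> \<le> 1 / (c * d) * wsum P q k w \<phi>" for k \<phi>
    unfolding jsum_def wsum_def sum_distrib_left
  proof (intro sum_mono, clarify)
    fix l j N
    let ?x = "(jf P q l j N \<phi>)\<^sup>2 / jn P q l j N"
    have x: "?x \<ge> 0" using jn_pos[OF assms(1,2), of l j N] by simp
    have "(c * (real l + 1) powr s) * (d * (real j + 1) powr (2 * q)) \<le> w l * full_weight q j"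
      using d assms by (intro mult_mono) (auto intro: order_trans[OF _ assms(4)])
    then have "(real l + 1) powr s * (real j + 1) powr (2 * q) \<le> 1 / (c * d) * (w l * full_weight q j)"
      using assms(3) d(1) by (simp add: field_simps)
    then have "(real l + 1) powr s * (real j + 1) powr (2 * q) * ?x \<le> 1 / (c * d) * (w l * full_weight q j) * ?x"
      by (rule mult_right_mono) (rule x)
    then show "(real l + 1) powr s * (real j + 1) powr (2 * q) * (jf P q l j N \<phi>)\<^sup>2 / jn P q l j N
      \<le> 1 / (c * d) * (w l * full_weight q j * (jf P q l j N \<phi>)\<^sup>2 / jn P q l j N)" by simp
  qed
  then show ?thesis using assms(3) d(1) by (intro exI[of _ "1 / (c * d)"]) auto
qed

theorem jsum_le:
  assumes "p \<ge> 0" "q \<ge> 0"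
  shows "\<exists>C>0. \<forall>k. \<forall>\<phi>\<in>{0<..<pi/2}. jsum p (2 * p) q k \<phi>
    \<le> C * (real k + 1) powr (2 * p + 2 * q + 2) * (sin \<phi> powr (2 * p) * cos \<phi> powr (2 * q))"
proof -
  obtain c where c: "c > 0" "\<And>l. c * (real l + 1) powr (2 * p) \<le> full_weight p l"
    using full_weight_ge[of p] assms by auto
  obtain C where C: "C > 0" "\<And>k \<phi>. jsum p (2 * p) q k \<phi> \<le> C * wsum p q k (full_weight p) \<phi>"
    using jsum_le_wsum[of p q c "2 * p" "full_weight p"] c assms by auto
  obtain D where D: "D > 0" "\<And>k \<phi>. \<phi> \<in> {0<..<pi/2} \<Longrightarrow> wsum p q k (full_weight p) \<phi>
    \<le> D * (real k + 1) powr (2 * p + 2 * q + 2) * (sin \<phi> powr (2 * p) * cos \<phi> powr (2 * q))"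
    using wsum_full_weight_le[of p q] assms by auto
  have "jsum p (2 * p) q k \<phi> \<le> C * D * (real k + 1) powr (2 * p + 2 * q + 2) * (sin \<phi> powr (2 * p) * cos \<phi> powr (2 * q))"
    if "\<phi> \<in> {0<..<pi/2}" for k \<phi>
    using order_trans[OF C(2) mult_left_mono[OF D(2)[OF that] less_imp_le[OF C(1)]]] by (simp add: mult_ac)
  then show ?thesis using C(1) D(1) by (intro exI[of _ "C * D"]) auto
qed


section \<open>Weights of growth 2 p for the Jacobi parameter p + 1/2\<close>

definition shifted_weight :: "real \<Rightarrow> nat \<Rightarrow> real" where
  "shifted_weight p l = pochhammer (2 * p + 1/2) l / pochhammer (1/2) l"

text \<open>For P = p - 1/2 the weight condition with \<open>Em l = E (l - 1)\<close> becomes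
  \<open>E l * (l - 1/2) = E (l - 1) * (l - 1/2 + 2 * p)\<close>. Its solution is a quotient of two
  Pochhammer symbols, normalised to 1 at l = 0.\<close>

lemma shifted_weight_Suc:
  "shifted_weight p (Suc i) * (real i + 1/2) = shifted_weight p i * (real i + 1/2 + 2 * p)"
proof -
  have "pochhammer (1/2 :: real) i > 0" by (rule pochhammer_pos) simp
  then show ?thesis
    unfolding shifted_weight_def by (simp add: pochhammer_Suc divide_simps) (simp add: algebra_simps)
qed

lemma shifted_weight_bounds:
  assumes "p \<ge> 0"
  shows "\<exists>c C. c > 0 \<and> C > 0 \<and> (\<forall>n. c * (real n + 1) powr (2 * p) \<le> shifted_weight p n
      \<and> shifted_weight p n \<le> C * (real n + 1) powr (2 * p))"
proof -
  obtain c1 C1 where 1: "c1 > 0" "C1 > 0"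
      "\<And>n. c1 * (real n + 1) powr (2 * p + 1/2 - 1) \<le> pochhammer (2 * p + 1/2) n / fact n"
      "\<And>n. pochhammer (2 * p + 1/2) n / fact n \<le> C1 * (real n + 1) powr (2 * p + 1/2 - 1)"
    using pochhammer_fact_bounds[of "2 * p + 1/2"] assms by auto
  obtain c2 C2 where 2: "c2 > 0" "C2 > 0"
      "\<And>n. c2 * (real n + 1) powr (1/2 - 1) \<le> pochhammer (1/2) n / fact n"
      "\<And>n. pochhammer (1/2) n / fact n \<le> C2 * (real n + 1) powr (1/2 - 1)"
    using pochhammer_fact_bounds[of "1/2"] by auto
  have e: "shifted_weight p n = (pochhammer (2 * p + 1/2) n / fact n) / (pochhammer (1/2) n / fact n)" for n
    by (simp add: shifted_weight_def)
  have w: "(c * (real n + 1) powr (2 * p + 1/2 - 1)) / (d * (real n + 1) powr (1/2 - 1)) = c / d * (real n + 1) powr (2 * p)" for n c d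
  proof -
    have "(real n + 1) powr (2 * p + 1/2 - 1) / (real n + 1) powr (1/2 - 1) = (real n + 1) powr (2 * p)"
      by (subst powr_diff[symmetric]) simp
    then show ?thesis by (simp only: times_divide_times_eq[symmetric])
  qed
  have pos: "pochhammer (1/2 :: real) n / fact n > 0" "pochhammer (2 * p + 1/2 :: real) n / fact n > 0" for n
    using assms by (intro divide_pos_pos pochhammer_pos; simp)+
  have "c1 / C2 * (real n + 1) powr (2 * p) \<le> shifted_weight p n" for n
    unfolding e w[symmetric] using 1 2 pos[of n] by (intro frac_le) (auto intro: less_imp_le)
  moreover have "shifted_weight p n \<le> C1 / c2 * (real n + 1) powr (2 * p)" for n
    unfolding e w[symmetric] using 1 2 pos[of n] by (intro frac_le) (auto intro: less_imp_le)
  ultimately show ?thesis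
    using 1 2 by (intro exI[of _ "c1 / C2"] exI[of _ "C1 / c2"]) auto
qed

text \<open>The sums \<open>E l + E (l - 1)\<close> for l > 0. At l = 0 the condition would be
  \<open>E 0 * (p - 1/2) = E 0 * p\<close>, which admits only the weight 0.\<close>

definition shifted_full :: "real \<Rightarrow> nat \<Rightarrow> real" where
  "shifted_full p l = (case l of 0 \<Rightarrow> 0 | Suc i \<Rightarrow> shifted_weight p (Suc i) + shifted_weight p i)"

lemma shifted_full_simps [simp]:
  "shifted_full p 0 = 0" "shifted_full p (Suc i) = shifted_weight p (Suc i) + shifted_weight p i"
  by (simp_all add: shifted_full_def)

text \<open>The weights \<open>shifted_full\<close> solve the telescoping recursion except on the edges from \<open>l = 0\<close> to
  \<open>l = 1\<close>, and so do the weights \<open>(1, 0, 0, \<dots>)\<close>, with the opposite defect. Hence the derivatives of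
  the two sums are proportional.\<close>

lemma shifted_sum_decreasing:
  assumes pq: "p \<ge> 0" "q \<ge> 0" and xy: "0 < x" "x \<le> y" "y < pi/2"
  defines "P \<equiv> p - 1/2" and "u \<equiv> (\<lambda>l. if l = 0 then 1 else 0 :: real)"
  shows "sin y powr (- 2 * p) * cos y powr (- 2 * q) * wsum P q k (shifted_full p) y
    \<le> sin x powr (- 2 * p) * cos x powr (- 2 * q) * wsum P q k (shifted_full p) x
      + sin x powr (- 2 * P) * cos x powr (- 2 * q) * wsum P q k u x / sin x"
proof -
  let ?T = "\<lambda>\<phi>. sin \<phi> powr (- 2 * p) * cos \<phi> powr (- 2 * q) * wsum P q k (shifted_full p) \<phi>"
  let ?U = "\<lambda>\<phi>. sin \<phi> powr (- 2 * P) * cos \<phi> powr (- 2 * q) * wsum P q k u \<phi>"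
  have P: "P \<ge> -1/2" using pq by (simp add: P_def)
  have u_nonneg: "?U \<phi> \<ge> 0" for \<phi>
  proof -
    have "wsum P q k u \<phi> \<ge> 0"
      unfolding wsum_def using jn_pos[OF P pq(2)] full_weight_nonneg[of q] pq
      by (intro sum_nonneg) (auto simp: u_def intro!: divide_nonneg_pos mult_nonneg_nonneg)
    then show ?thesis by simp
  qed
  have der: "\<exists>D. ((\<lambda>\<phi>. ?T \<phi> + ?U \<phi> / sin \<phi>) has_real_derivative D) (at \<phi>) \<and> D \<le> 0" if \<phi>: "\<phi> \<in> {0<..<pi/2}" for \<phi>
  proof -
    note sc = sin_cos_gt_zero[OF \<phi>]
    define S where "S = (\<Sum>(l, j, N)\<in>triples k. u l * (edge P q l j N \<phi> + edge' P q l j N \<phi>))"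
    define E where "E l = (if l = 0 then 0 else shifted_weight p l)" for l
    have cond: "(E l - pred_seq (shifted_weight p) l) * (real l + P) = shifted_full p l * p" for l
    proof (cases l)
      case (Suc i)
      have "shifted_weight p (Suc i) * (real i + 1/2) = shifted_weight p i * (real i + 1/2 + 2 * p)"
        by (rule shifted_weight_Suc)
      then show ?thesis by (simp add: Suc E_def P_def algebra_simps)
    qed (simp add: E_def)
    have "shifted_full p l = E l + pred_seq (shifted_weight p) l" for l
      by (cases l) (auto simp: E_def)
    from has_real_derivative_wsum[OF P pq(2) \<phi> this cond] have
      "(?T has_real_derivative 2 * sin \<phi> powr (- 2 * p) * cos \<phi> powr (- 2 * q)
       * (\<Sum>(l, j, N)\<in>triples k. (E l - pred_seq (shifted_weight p) (Suc l)) * (edge P q l j N \<phi> + edge' P q l j N \<phi>))) (at \<phi>)"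
      by simp
    moreover have "E l - pred_seq (shifted_weight p) (Suc l) = - u l" for l
      by (cases l) (auto simp: E_def u_def shifted_weight_def)
    ultimately have T: "(?T has_real_derivative - (2 * sin \<phi> powr (- 2 * p) * cos \<phi> powr (- 2 * q) * S)) (at \<phi>)"
      unfolding S_def by (simp add: split_def sum_negf)
    have U: "(?U has_real_derivative 2 * sin \<phi> powr (- 2 * P) * cos \<phi> powr (- 2 * q) * S) (at \<phi>)"
      using has_real_derivative_wsum[OF P pq(2) \<phi>, of u u "\<lambda>_. 0" P k]
      unfolding S_def by (simp add: u_def)
    \<comment> \<open>The two prefactors differ by one factor sin \<phi>, so the derivative of
      \<open>?T\<close> is minus the derivative of \<open>?U\<close> divided by sin \<phi>. In the
      derivative of \<open>?T + ?U / sin\<close> only the term from 1 / sin \<phi> survives, and it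
      has a sign because \<open>?U\<close> is nonnegative. The unknown sum \<open>S\<close> is
      thereby eliminated.\<close>
    have "sin \<phi> powr (- 2 * P) = sin \<phi> powr (- 2 * p) * sin \<phi>"
      using sc powr_add[of "sin \<phi>" "- 2 * p" 1] by (simp add: P_def algebra_simps)
    then have e: "2 * sin \<phi> powr (- 2 * P) * cos \<phi> powr (- 2 * q) * S / sin \<phi> = 2 * sin \<phi> powr (- 2 * p) * cos \<phi> powr (- 2 * q) * S"
      using sc by simp
    have "((\<lambda>\<phi>. ?T \<phi> + ?U \<phi> / sin \<phi>) has_real_derivative
      - (2 * sin \<phi> powr (- 2 * p) * cos \<phi> powr (- 2 * q) * S)
        + (2 * sin \<phi> powr (- 2 * P) * cos \<phi> powr (- 2 * q) * S * sin \<phi> - ?U \<phi> * cos \<phi>) / (sin \<phi> * sin \<phi>)) (at \<phi>)"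
      by (intro DERIV_add T DERIV_divide U) (use sc in \<open>auto intro!: derivative_eq_intros\<close>)
    moreover have "- (2 * sin \<phi> powr (- 2 * p) * cos \<phi> powr (- 2 * q) * S)
        + (2 * sin \<phi> powr (- 2 * P) * cos \<phi> powr (- 2 * q) * S * sin \<phi> - ?U \<phi> * cos \<phi>) / (sin \<phi> * sin \<phi>)
      = - (?U \<phi> * cos \<phi> / (sin \<phi> * sin \<phi>))"
      using e sc by (simp add: diff_divide_distrib)
    moreover have "?U \<phi> * cos \<phi> / (sin \<phi> * sin \<phi>) \<ge> 0"
      using sc by (intro divide_nonneg_nonneg mult_nonneg_nonneg[OF u_nonneg]) auto
    ultimately show ?thesis by (intro exI conjI) auto
  qed
  have "?T y + ?U y / sin y \<le> ?T x + ?U x / sin x"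
    by (rule DERIV_nonpos_imp_nonincreasing[OF xy(2)]) (use der xy in auto)
  moreover have "?U y / sin y \<ge> 0"
    using u_nonneg[of y] sin_cos_gt_zero[of y] xy by (intro divide_nonneg_nonneg) auto
  ultimately show ?thesis by linarith
qed

text \<open>Leads from the parameter p - 1/2, for which the weights telescope, to p + 1/2, for which
  the bound is wanted.\<close>

lemma wsum_shift:
  assumes "w 0 = 0"
  shows "wsum P q (Suc k) w \<phi> = wsum (P + 1) q k (\<lambda>l. w (Suc l)) \<phi>"
proof -
  have j: "jf P q (Suc l) j N = jf (P + 1) q l j N" "jn P q (Suc l) j N = jn (P + 1) q l j N" for l j N
    by (simp_all add: jf_def jn_def add_ac)
  have "wsum P q (Suc k) w \<phi> = (\<Sum>(l, j, N)\<in>{(l, j, N)\<in>triples (Suc k). l > 0}. w l * full_weight q j * (jf P q l j N \<phi>)\<^sup>2 / jn P q l j N)"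
    unfolding wsum_def using assms by (intro sum.mono_neutral_right finite_triples) (auto intro!: gr0I)
  also have "\<dots> = (\<Sum>(l, j, N)\<in>triples k. w (Suc l) * full_weight q j * (jf P q (Suc l) j N \<phi>)\<^sup>2 / jn P q (Suc l) j N)"
    by (rule sum.reindex_bij_witness[of _ "\<lambda>(l, j, N). (Suc l, j, N)" "\<lambda>(l, j, N). (l - 1, j, N)"])
       (auto simp: triples_def)
  finally show ?thesis unfolding wsum_def j .
qed

text \<open>Two regimes. Comparison with the full weights for the parameter p + 1/2 overshoots by
  the factor (k + 1) sin \<phi>, which is harmless while sin \<phi> \<le> 1/(k + 2). For larger
  angles \<open>shifted_sum_decreasing\<close> goes back to the angle x where equality holds. The
  additional term is \<open>?U / sin x\<close>; there \<open>?U\<close> has one power of k + 1 less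
  than the target and 1 / sin x = k + 2 restores it.\<close>

lemma shifted_wsum_le:
  assumes pq: "p \<ge> 0" "q \<ge> 0"
  shows "\<exists>C>0. \<forall>k. \<forall>\<phi>\<in>{0<..<pi/2}. sin \<phi> powr (- 2 * p) * cos \<phi> powr (- 2 * q) * wsum (p - 1/2) q (Suc k) (shifted_full p) \<phi>
    \<le> C * (real k + 1) powr (2 * p + 2 * q + 2)"
proof -
  define P where "P = p - 1/2"
  have P: "P \<ge> -1/2" "P + 1 \<ge> -1/2" "P + 1 > -1/2" using pq by (auto simp: P_def)
  let ?T = "\<lambda>k \<phi>. sin \<phi> powr (- 2 * p) * cos \<phi> powr (- 2 * q) * wsum P q k (shifted_full p) \<phi>"
  let ?u = "\<lambda>l. if l = 0 then 1 else 0 :: real"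
  let ?U = "\<lambda>k \<phi>. sin \<phi> powr (- 2 * P) * cos \<phi> powr (- 2 * q) * wsum P q k ?u \<phi>"
  obtain C1 where C1: "C1 > 0" "\<And>n. shifted_weight p n \<le> C1 * (real n + 1) powr (2 * p)"
    using shifted_weight_bounds[OF pq(1)] by blast
  obtain c2 where c2: "c2 > 0" "\<And>l. c2 * (real l + 1) powr (2 * (P + 1)) \<le> full_weight (P + 1) l"
    using full_weight_ge[OF P(3)] by blast
  define C3 where "C3 = (C1 * 2 powr (2 * p) + C1) / c2"
  have C3: "C3 > 0" using C1 c2 by (simp add: C3_def add_pos_pos)
  have w: "shifted_full p (Suc i) \<le> C3 * full_weight (P + 1) i" for i
  proof -
    have "shifted_weight p (Suc i) \<le> C1 * (2 powr (2 * p) * (real i + 1) powr (2 * p))"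
    proof -
      have "(real (Suc i) + 1) powr (2 * p) \<le> (2 * (real i + 1)) powr (2 * p)"
        using pq by (intro powr_mono2) auto
      also have "\<dots> = 2 powr (2 * p) * (real i + 1) powr (2 * p)" by (subst powr_mult) auto
      finally show ?thesis using C1(2)[of "Suc i"] C1(1)
        by (meson mult_left_mono order_trans less_imp_le)
    qed
    then have "shifted_full p (Suc i) \<le> (C1 * 2 powr (2 * p) + C1) * (real i + 1) powr (2 * p)"
      using C1(2)[of i] by (simp add: algebra_simps)
    \<comment> \<open>Since 2 (P + 1) = 2 p + 1, a power of i + 1 is given away here. It reappears
      in \<open>near\<close> as the factor (k + 1) sin \<phi>.\<close>
    also have "\<dots> \<le> (C1 * 2 powr (2 * p) + C1) * (real i + 1) powr (2 * (P + 1))"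
      using C1 by (intro mult_left_mono powr_mono) (auto simp: P_def)
    also have "\<dots> = C3 * (c2 * (real i + 1) powr (2 * (P + 1)))" using c2(1) by (simp add: C3_def)
    also have "\<dots> \<le> C3 * full_weight (P + 1) i" using C3 c2(2) by (intro mult_left_mono) auto
    finally show ?thesis .
  qed
  obtain D1 where D1: "D1 > 0" "\<And>k \<phi>. \<phi> \<in> {0<..<pi/2} \<Longrightarrow> wsum (P + 1) q k (full_weight (P + 1)) \<phi>
      \<le> D1 * (real k + 1) powr (2 * (P + 1) + 2 * q + 2) * (sin \<phi> powr (2 * (P + 1)) * cos \<phi> powr (2 * q))"
    using wsum_full_weight_le[OF P(2) pq(2)] by blast
  have near: "?T (Suc k) \<phi> \<le> C3 * D1 * (real k + 1) powr (2 * p + 2 * q + 2) * ((real k + 1) * sin \<phi>)" if \<phi>: "\<phi> \<in> {0<..<pi/2}" for k \<phi>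
  proof -
    note sc = sin_cos_gt_zero[OF \<phi>]
    have "wsum P q (Suc k) (shifted_full p) \<phi> = wsum (P + 1) q k (\<lambda>i. shifted_full p (Suc i)) \<phi>"
      by (rule wsum_shift) simp
    also have "\<dots> \<le> wsum (P + 1) q k (\<lambda>i. C3 * full_weight (P + 1) i) \<phi>"
      using w by (intro wsum_mono P pq) auto
    also have "\<dots> \<le> C3 * (D1 * (real k + 1) powr (2 * (P + 1) + 2 * q + 2) * (sin \<phi> powr (2 * (P + 1)) * cos \<phi> powr (2 * q)))"
      unfolding wsum_scale using C3 D1(2)[OF \<phi>] by (intro mult_left_mono) auto
    finally have "?T (Suc k) \<phi> \<le> sin \<phi> powr (- 2 * p) * cos \<phi> powr (- 2 * q) * (C3 * (D1 * (real k + 1) powr (2 * (P + 1) + 2 * q + 2) * (sin \<phi> powr (2 * (P + 1)) * cos \<phi> powr (2 * q))))"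
      by (intro mult_left_mono) auto
    also have "\<dots> = C3 * D1 * (real k + 1) powr (2 * (P + 1) + 2 * q + 2) * ((sin \<phi> powr (- 2 * p) * sin \<phi> powr (2 * (P + 1))) * (cos \<phi> powr (- 2 * q) * cos \<phi> powr (2 * q)))"
      by (simp only: mult_ac)
    also have "sin \<phi> powr (- 2 * p) * sin \<phi> powr (2 * (P + 1)) = sin \<phi>"
      using sc unfolding powr_add[symmetric] P_def by simp
    also have "cos \<phi> powr (- 2 * q) * cos \<phi> powr (2 * q) = 1"
      using sc unfolding powr_add[symmetric] by simp
    also have "(real k + 1) powr (2 * (P + 1) + 2 * q + 2) = (real k + 1) powr (2 * p + 2 * q + 2) * (real k + 1)"
      using powr_add[of "real k + 1" "2 * p + 2 * q + 2" 1] by (simp add: P_def algebra_simps)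
    finally show ?thesis by (simp add: mult_ac)
  qed
  obtain D2 where D2: "D2 > 0" "\<And>k \<phi>. \<phi> \<in> {0<..<pi/2} \<Longrightarrow> wsum P q k (full_weight P) \<phi>
      \<le> D2 * (real k + 1) powr (2 * P + 2 * q + 2) * (sin \<phi> powr (2 * P) * cos \<phi> powr (2 * q))"
    using wsum_full_weight_le[OF P(1) pq(2)] by blast
  have U: "?U (Suc k) \<phi> \<le> D2 * 2 powr (2 * p + 2 * q + 1) * (real k + 1) powr (2 * p + 2 * q + 1)" if \<phi>: "\<phi> \<in> {0<..<pi/2}" for k \<phi>
  proof -
    note sc = sin_cos_gt_zero[OF \<phi>]
    have "wsum P q (Suc k) ?u \<phi> \<le> wsum P q (Suc k) (full_weight P) \<phi>"
    proof (intro wsum_mono P pq)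
      \<comment> \<open>Equality at l = 0, where the full weight is 1. The dominating sum has the
        exponent 2 P + 2 q + 2 = 2 p + 2 q + 1.\<close>
      show "?u l \<le> full_weight P l" for l
        using full_weight_nonneg[OF P(1), of l] by (cases l) (auto simp: full_weight_def half_weight_def)
    qed
    also note D2(2)[OF \<phi>]
    finally have "?U (Suc k) \<phi> \<le> sin \<phi> powr (- 2 * P) * cos \<phi> powr (- 2 * q) * (D2 * (real (Suc k) + 1) powr (2 * P + 2 * q + 2) * (sin \<phi> powr (2 * P) * cos \<phi> powr (2 * q)))"
      by (intro mult_left_mono) auto
    also have "\<dots> = D2 * (real (Suc k) + 1) powr (2 * P + 2 * q + 2) * ((sin \<phi> powr (- 2 * P) * sin \<phi> powr (2 * P)) * (cos \<phi> powr (- 2 * q) * cos \<phi> powr (2 * q)))"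
      by (simp only: mult_ac)
    also have "sin \<phi> powr (- 2 * P) * sin \<phi> powr (2 * P) = 1"
      using sc unfolding powr_add[symmetric] by simp
    also have "cos \<phi> powr (- 2 * q) * cos \<phi> powr (2 * q) = 1"
      using sc unfolding powr_add[symmetric] by simp
    also have "2 * P + 2 * q + 2 = 2 * p + 2 * q + 1" by (simp add: P_def)
    also have "D2 * (real (Suc k) + 1) powr (2 * p + 2 * q + 1) * (1 * 1) \<le> D2 * (2 * (real k + 1)) powr (2 * p + 2 * q + 1)"
      using D2 pq by (simp, intro powr_mono2) auto
    also have "\<dots> = D2 * 2 powr (2 * p + 2 * q + 1) * (real k + 1) powr (2 * p + 2 * q + 1)" by (subst powr_mult) auto
    finally show ?thesis .
  qed
  define E where "E = C3 * D1 + 2 * (D2 * 2 powr (2 * p + 2 * q + 1))"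
  have "?T (Suc k) \<phi> \<le> E * (real k + 1) powr (2 * p + 2 * q + 2)" if \<phi>: "\<phi> \<in> {0<..<pi/2}" for k \<phi>
  proof -
    \<comment> \<open>The angle that separates the two regimes. With k + 1 instead of k + 2 it would
      be pi/2 for k = 0, outside the open interval.\<close>
    define x where "x = arcsin (1 / (real k + 2))"
    have sx: "sin x = 1 / (real k + 2)" unfolding x_def by (intro sin_arcsin) (auto simp: field_simps)
    have x: "x \<in> {0<..<pi/2}"
      using arcsin_less_mono[of 0 "1 / (real k + 2)"] arcsin_less_mono[of "1 / (real k + 2)" 1]
      unfolding x_def by (auto simp: field_simps)
    have nearx: "?T (Suc k) y \<le> C3 * D1 * (real k + 1) powr (2 * p + 2 * q + 2)" if y: "y \<in> {0<..<pi/2}" "y \<le> x" for y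
    proof -
      have "sin y \<le> sin x" using y x by (intro sin_monotone_2pi_le) auto
      then have "(real k + 1) * sin y \<le> (real k + 1) * (1 / (real k + 2))"
        unfolding sx by (intro mult_left_mono) auto
      also have "\<dots> \<le> 1" by (simp add: field_simps)
      finally have "C3 * D1 * (real k + 1) powr (2 * p + 2 * q + 2) * ((real k + 1) * sin y) \<le> C3 * D1 * (real k + 1) powr (2 * p + 2 * q + 2) * 1"
        using C3 D1(1) by (intro mult_left_mono) auto
      then show ?thesis using near[OF y(1), of k] by linarith
    qed
    have E2: "2 * (D2 * 2 powr (2 * p + 2 * q + 1)) * (real k + 1) powr (2 * p + 2 * q + 2) \<ge> 0"
      using D2 by simp
    show ?thesis
    proof (cases "\<phi> \<le> x")
      case True
      then show ?thesis using nearx[OF \<phi>] E2 unfolding E_def by (simp add: algebra_simps)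
    next
      case False
      have "?T (Suc k) \<phi> \<le> ?T (Suc k) x + ?U (Suc k) x / sin x"
        using shifted_sum_decreasing[OF pq, of x \<phi> "Suc k"] x \<phi> False unfolding P_def by auto
      also have "?U (Suc k) x / sin x \<le> D2 * 2 powr (2 * p + 2 * q + 1) * (real k + 1) powr (2 * p + 2 * q + 1) * (real k + 2)"
        using U[OF x, of k] unfolding sx by (simp add: mult_right_mono)
      also have "\<dots> \<le> D2 * 2 powr (2 * p + 2 * q + 1) * (real k + 1) powr (2 * p + 2 * q + 1) * (2 * (real k + 1))"
        using D2 by (intro mult_left_mono) auto
      also have "\<dots> = 2 * (D2 * 2 powr (2 * p + 2 * q + 1)) * (real k + 1) powr (2 * p + 2 * q + 2)"
        using powr_add[of "real k + 1" "2 * p + 2 * q + 1" 1] by (simp add: algebra_simps)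
      finally show ?thesis using nearx[OF x] unfolding E_def by (simp add: algebra_simps)
    qed
  qed
  moreover have "E > 0" using C3 D1 D2 by (simp add: E_def add_pos_pos)
  ultimately show ?thesis unfolding P_def by (intro exI[of _ E]) auto
qed

theorem jsum_shifted_le:
  assumes "p \<ge> 0" "q \<ge> 0"
  shows "\<exists>C>0. \<forall>k. \<forall>\<phi>\<in>{0<..<pi/2}. jsum (p + 1/2) (2 * p) q k \<phi>
    \<le> C * (real k + 1) powr (2 * p + 2 * q + 2) * (sin \<phi> powr (2 * p) * cos \<phi> powr (2 * q))"
proof -
  obtain c where c: "c > 0" "\<And>n. c * (real n + 1) powr (2 * p) \<le> shifted_weight p n"
    using shifted_weight_bounds[OF assms(1)] by blast
  have "shifted_weight p n \<ge> 0" for n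
    using order_trans[OF _ c(2)[of n]] c(1) by simp
  then have w: "c * (real l + 1) powr (2 * p) \<le> shifted_full p (Suc l)" for l
    using c(2)[of l] by (simp add: add_increasing)
  obtain C where C: "C > 0" "\<And>k \<phi>. jsum (p + 1/2) (2 * p) q k \<phi> \<le> C * wsum (p + 1/2) q k (\<lambda>l. shifted_full p (Suc l)) \<phi>"
    using jsum_le_wsum[of "p + 1/2" q c "2 * p" "\<lambda>l. shifted_full p (Suc l)"] c(1) w assms by auto
  obtain D where D: "D > 0" "\<And>k \<phi>. \<phi> \<in> {0<..<pi/2} \<Longrightarrow>
      sin \<phi> powr (- 2 * p) * cos \<phi> powr (- 2 * q) * wsum (p - 1/2) q (Suc k) (shifted_full p) \<phi> \<le> D * (real k + 1) powr (2 * p + 2 * q + 2)"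
    using shifted_wsum_le[OF assms] by blast
  have "jsum (p + 1/2) (2 * p) q k \<phi> \<le> C * D * (real k + 1) powr (2 * p + 2 * q + 2) * (sin \<phi> powr (2 * p) * cos \<phi> powr (2 * q))"
    if \<phi>: "\<phi> \<in> {0<..<pi/2}" for k \<phi>
  proof -
    note sc = sin_cos_gt_zero[OF \<phi>]
    let ?w = "wsum (p + 1/2) q k (\<lambda>l. shifted_full p (Suc l)) \<phi>" and ?s = "sin \<phi> powr (2 * p) * cos \<phi> powr (2 * q)"
    have "wsum (p - 1/2) q (Suc k) (shifted_full p) \<phi> = ?w"
    proof -
      have e: "p - 1/2 + 1 = p + 1/2" by simp
      show ?thesis using wsum_shift[of "shifted_full p" "p - 1/2" q k \<phi>] unfolding e by simp
    qed
    then have "inverse ?s * ?w \<le> D * (real k + 1) powr (2 * p + 2 * q + 2)"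
      using D(2)[OF \<phi>, of k] by (simp add: powr_minus)
    moreover have "?s > 0" using sc by simp
    ultimately have "?w \<le> D * (real k + 1) powr (2 * p + 2 * q + 2) * ?s"
      by (simp add: field_simps del: powr_gt_zero)
    then have "C * ?w \<le> C * (D * (real k + 1) powr (2 * p + 2 * q + 2) * ?s)"
      using C(1) by (intro mult_left_mono) auto
    then show ?thesis using C(2)[of k \<phi>] by (simp add: mult_ac)
  qed
  then show ?thesis using C(1) D(1) by (intro exI[of _ "C * D"]) auto
qed

section \<open>Finite-dimensional spaces of bounded functions\<close>


text \<open>Closed under products, conjugates and finite sums, and integrable over every finite
  measure: all integrals below exist for this reason alone.\<close>

definition bounded_measurable :: "'a measure \<Rightarrow> ('a \<Rightarrow> complex) \<Rightarrow> bool" where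
  "bounded_measurable M f \<longleftrightarrow> f \<in> borel_measurable M \<and> (\<exists>B. \<forall>x\<in>space M. cmod (f x) \<le> B)"

lemma bounded_measurable_const: "bounded_measurable M (\<lambda>x. c)"
  by (auto simp: bounded_measurable_def)

lemma bounded_measurable_add:
  assumes "bounded_measurable M f" "bounded_measurable M g"
  shows "bounded_measurable M (\<lambda>x. f x + g x)"
proof -
  from assms obtain A B where "\<forall>x\<in>space M. cmod (f x) \<le> A" "\<forall>x\<in>space M. cmod (g x) \<le> B"
    by (auto simp: bounded_measurable_def)
  then have "\<forall>x\<in>space M. cmod (f x + g x) \<le> A + B" by (auto intro!: norm_triangle_le add_mono)
  then show ?thesis using assms by (auto simp: bounded_measurable_def)
qed

lemma bounded_measurable_mult:
  assumes "bounded_measurable M f" "bounded_measurable M g"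
  shows "bounded_measurable M (\<lambda>x. f x * g x)"
proof -
  from assms obtain A B where *: "\<forall>x\<in>space M. cmod (f x) \<le> A" "\<forall>x\<in>space M. cmod (g x) \<le> B"
    by (auto simp: bounded_measurable_def)
  have "\<forall>x\<in>space M. cmod (f x * g x) \<le> A * B"
    using * by (auto simp: norm_mult intro!: mult_mono order_trans[OF norm_ge_zero])
  then show ?thesis using assms by (auto simp: bounded_measurable_def)
qed

lemma bounded_measurable_cnj: "bounded_measurable M f \<Longrightarrow> bounded_measurable M (\<lambda>x. cnj (f x))"
proof -
  assume f: "bounded_measurable M f"
  have [measurable]: "cnj \<in> borel_measurable borel"
    by (intro borel_measurable_continuous_onI continuous_intros)
  have [measurable]: "f \<in> borel_measurable M" using f by (simp add: bounded_measurable_def)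
  have "(\<lambda>x. cnj (f x)) \<in> borel_measurable M" by measurable
  then show ?thesis using f by (simp add: bounded_measurable_def)
qed

lemma bounded_measurable_sum:
  "(\<And>i. i \<in> I \<Longrightarrow> bounded_measurable M (f i)) \<Longrightarrow> bounded_measurable M (\<lambda>x. \<Sum>i\<in>I. f i x)"
  by (induction I rule: infinite_finite_induct) (auto simp: bounded_measurable_const bounded_measurable_add)

lemma (in finite_measure) integrable_bounded_measurable: "bounded_measurable M f \<Longrightarrow> integrable M f"
  unfolding bounded_measurable_def by (auto intro!: integrable_const_bound)

lemmas bounded_measurable_intros = bounded_measurable_const bounded_measurable_add
  bounded_measurable_mult bounded_measurable_cnj bounded_measurable_sum

lemma sum_fun_apply: "(\<Sum>i\<in>I. f i) x = (\<Sum>i\<in>I. f i x)"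
  by (induction I rule: infinite_finite_induct) auto

lemma sum_mem_cspan:
  assumes "finite I"
  shows "(\<lambda>x. \<Sum>i\<in>I. u i * e i x) \<in> cspan (e ` I)"
proof -
  have "(\<Sum>i\<in>I. (\<lambda>x. u i * e i x)) \<in> cspan (e ` I)"
    by (intro cfun.span_sum cfun.span_scale cfun.span_base imageI)
  moreover have "(\<Sum>i\<in>I. (\<lambda>x. u i * e i x)) = (\<lambda>x. \<Sum>i\<in>I. u i * e i x)"
    by (rule ext) (simp add: sum_fun_apply)
  ultimately show ?thesis by simp
qed

lemma cspan_image_finite:
  assumes "finite I" "f \<in> cspan (e ` I)"
  shows "\<exists>u. \<forall>x. f x = (\<Sum>i\<in>I. u i * e i x)"
  using assms(2)
proof (induction rule: cfun.span_induct_alt)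
  case base
  show ?case by (intro exI[of _ "\<lambda>_. 0"]) (simp add: zero_fun_def)
next
  case (step c g h)
  then obtain i u where i: "i \<in> I" "g = e i" and u: "\<And>x. h x = (\<Sum>i\<in>I. u i * e i x)" by auto
  have "c * g x + h x = (\<Sum>j\<in>I. (u j + (if j = i then c else 0)) * e j x)" for x
    using assms(1) i u[of x] by (simp add: distrib_right sum.distrib if_distrib[of "\<lambda>c. c * _"] sum.delta cong: if_cong)
  then show ?case by (intro exI[of _ "\<lambda>j. u j + (if j = i then c else 0)"]) (simp add: plus_fun_def)
qed

definition kernel_diag :: "'i set \<Rightarrow> ('i \<Rightarrow> 'a \<Rightarrow> complex) \<Rightarrow> 'a \<Rightarrow> real" where
  "kernel_diag I e z = (\<Sum>i\<in>I. (cmod (e i z))\<^sup>2)"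

lemma kernel_diag_nonneg: "kernel_diag I e z \<ge> 0"
  by (auto simp: kernel_diag_def intro!: sum_nonneg)

context finite_measure
begin

lemma L2_inner_sum:
  assumes "\<And>i. i \<in> I \<Longrightarrow> bounded_measurable M (e i)" "\<And>j. j \<in> J \<Longrightarrow> bounded_measurable M (g j)"
  shows "L2_inner M (\<lambda>x. \<Sum>i\<in>I. u i * e i x) (\<lambda>x. \<Sum>j\<in>J. v j * g j x)
    = (\<Sum>i\<in>I. \<Sum>j\<in>J. u i * cnj (v j) * L2_inner M (e i) (g j))"
proof -
  have int: "integrable M (\<lambda>x. u i * cnj (v j) * (e i x * cnj (g j x)))" if "i \<in> I" "j \<in> J" for i j
    using assms that by (intro integrable_bounded_measurable bounded_measurable_intros)
  have "L2_inner M (\<lambda>x. \<Sum>i\<in>I. u i * e i x) (\<lambda>x. \<Sum>j\<in>J. v j * g j x)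
    = (\<integral>x. (\<Sum>i\<in>I. \<Sum>j\<in>J. u i * cnj (v j) * (e i x * cnj (g j x))) \<partial>M)"
    unfolding L2_inner_def by (intro Bochner_Integration.integral_cong refl) (simp add: sum_product mult_ac)
  also have "\<dots> = (\<Sum>i\<in>I. \<Sum>j\<in>J. \<integral>x. u i * cnj (v j) * (e i x * cnj (g j x)) \<partial>M)"
    using int by (simp add: Bochner_Integration.integral_sum)
  finally show ?thesis by (simp add: L2_inner_def)
qed

lemma L2_inner_orthonormal_sum:
  assumes "orthonormal_basis M I e V" "\<And>i. i \<in> I \<Longrightarrow> bounded_measurable M (e i)"
  shows "L2_inner M (\<lambda>x. \<Sum>i\<in>I. u i * e i x) (\<lambda>x. \<Sum>i\<in>I. u i * e i x) = of_real (\<Sum>i\<in>I. (cmod (u i))\<^sup>2)"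
proof -
  have "L2_inner M (\<lambda>x. \<Sum>i\<in>I. u i * e i x) (\<lambda>x. \<Sum>i\<in>I. u i * e i x)
    = (\<Sum>i\<in>I. \<Sum>j\<in>I. u i * cnj (u j) * L2_inner M (e i) (e j))"
    by (rule L2_inner_sum) (use assms(2) in auto)
  also have "\<dots> = (\<Sum>i\<in>I. \<Sum>j\<in>I. if i = j then u i * cnj (u i) else 0)"
    using assms(1) by (intro sum.cong refl) (auto simp: orthonormal_basis_def)
  also have "\<dots> = (\<Sum>i\<in>I. u i * cnj (u i))"
    using assms(1) by (simp add: orthonormal_basis_def)
  finally show ?thesis by (simp only: complex_norm_square of_real_sum)
qed

text \<open>Together with \<open>kernel_diag_leI\<close> this identifies
  \<open>kernel_diag I e z\<close> as the squared norm of evaluation at z on V. In this form it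
  visibly depends on V only, and isometries that preserve V act on it.\<close>

lemma pointwise_bound:
  assumes e: "orthonormal_basis M I e V" "\<And>i. i \<in> I \<Longrightarrow> bounded_measurable M (e i)" and f: "f \<in> V"
  shows "(cmod (f z))\<^sup>2 \<le> kernel_diag I e z * Re (L2_inner M f f)"
proof -
  have fin: "finite I" and V: "V = cspan (e ` I)" using e by (auto simp: orthonormal_basis_def)
  obtain u where u: "\<And>x. f x = (\<Sum>i\<in>I. u i * e i x)" using cspan_image_finite[OF fin] f V by blast
  have "cmod (f z) \<le> (\<Sum>i\<in>I. cmod (u i) * cmod (e i z))"
    unfolding u by (rule order_trans[OF norm_sum]) (simp add: norm_mult)
  then have "(cmod (f z))\<^sup>2 \<le> (\<Sum>i\<in>I. cmod (u i) * cmod (e i z))\<^sup>2" by (intro power_mono) auto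
  also have "\<dots> \<le> (\<Sum>i\<in>I. (cmod (u i))\<^sup>2) * kernel_diag I e z"
    unfolding kernel_diag_def by (rule Cauchy_Schwarz_ineq_sum)
  also have "(\<Sum>i\<in>I. (cmod (u i))\<^sup>2) = Re (L2_inner M f f)"
  proof -
    have "f = (\<lambda>x. \<Sum>i\<in>I. u i * e i x)" using u by (rule ext)
    then show ?thesis using L2_inner_orthonormal_sum[OF e, where u=u] by simp
  qed
  finally show ?thesis by (simp add: mult.commute)
qed

text \<open>The test function is the reproducing kernel at z, whose value at z and whose squared
  norm both equal \<open>kernel_diag I e z\<close>; one factor cancels.\<close>

lemma kernel_diag_leI:
  assumes e: "orthonormal_basis M I e V" "\<And>i. i \<in> I \<Longrightarrow> bounded_measurable M (e i)"
    and A: "A \<ge> 0" "\<And>f. f \<in> V \<Longrightarrow> (cmod (f z))\<^sup>2 \<le> A * Re (L2_inner M f f)"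
  shows "kernel_diag I e z \<le> A"
proof -
  let ?k = "kernel_diag I e z"
  let ?f = "\<lambda>x. \<Sum>i\<in>I. cnj (e i z) * e i x"
  have "?f \<in> V" using e by (auto simp: orthonormal_basis_def intro!: sum_mem_cspan)
  moreover have "?f z = of_real ?k" unfolding kernel_diag_def of_real_sum complex_norm_square by (simp add: mult.commute)
  moreover have "L2_inner M ?f ?f = of_real ?k"
    using L2_inner_orthonormal_sum[OF e, where u="\<lambda>i. cnj (e i z)"] by (simp add: kernel_diag_def)
  ultimately have "?k\<^sup>2 \<le> A * ?k" using A(2)[of ?f] by (simp add: norm_of_real)
  then have "?k * ?k \<le> A * ?k" by (simp add: power2_eq_square)
  then show ?thesis
    using kernel_diag_nonneg[of I e z] A(1) by (cases "?k = 0") (auto simp: mult_le_cancel_right)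
qed

lemma kernel_diag_unique_le:
  assumes "orthonormal_basis M I e V" "\<And>i. i \<in> I \<Longrightarrow> bounded_measurable M (e i)"
    and "orthonormal_basis M I' e' V" "\<And>i. i \<in> I' \<Longrightarrow> bounded_measurable M (e' i)"
  shows "kernel_diag I e z \<le> kernel_diag I' e' z"
  using kernel_diag_leI[OF assms(1,2) kernel_diag_nonneg pointwise_bound[OF assms(3,4)]] .

lemma orthonormal_independent:
  assumes "finite I" "\<And>i j. i \<in> I \<Longrightarrow> j \<in> I \<Longrightarrow> L2_inner M (e i) (e j) = (if i = j then 1 else 0)"
    and bm: "\<And>i. i \<in> I \<Longrightarrow> bounded_measurable M (e i)"
    and z: "\<And>x. x \<in> space M \<Longrightarrow> (\<Sum>i\<in>I. u i * e i x) = 0" and i: "i \<in> I"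
  shows "u i = 0"
proof -
  have "0 = L2_inner M (\<lambda>x. \<Sum>i\<in>I. u i * e i x) (\<lambda>x. \<Sum>j\<in>{i}. 1 * e j x)"
    unfolding L2_inner_def using z by (simp cong: Bochner_Integration.integral_cong)
  also have "\<dots> = (\<Sum>k\<in>I. \<Sum>j\<in>{i}. u k * cnj 1 * L2_inner M (e k) (e j))"
    by (rule L2_inner_sum) (use bm i in auto)
  also have "\<dots> = (\<Sum>k\<in>I. if k = i then u i else 0)"
    using assms(2) i by (intro sum.cong refl) auto
  finally show ?thesis using assms(1) i by simp
qed

text \<open>With it the dimension of the span is the number of indices, which is how the index set
  in \<open>G_kernel\<close> is matched with an explicit basis.\<close>

lemma orthonormal_inj_independent:
  assumes fin: "finite I" and on: "\<And>i j. i \<in> I \<Longrightarrow> j \<in> I \<Longrightarrow> L2_inner M (e i) (e j) = (if i = j then 1 else 0)"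
    and bm: "\<And>i. i \<in> I \<Longrightarrow> bounded_measurable M (e i)"
  shows "inj_on e I" "\<not> cfun.dependent (e ` I)"
proof -
  show inj: "inj_on e I"
  proof (rule inj_onI)
    fix i j assume "i \<in> I" "j \<in> I" "e i = e j"
    then show "i = j" using on[of i j] on[of i i] by (auto split: if_splits)
  qed
  show "\<not> cfun.dependent (e ` I)"
  proof
    assume "cfun.dependent (e ` I)"
    then obtain u v where uv: "v \<in> e ` I" "u v \<noteq> 0" "(\<Sum>w\<in>e ` I. (\<lambda>x. u w * w x)) = 0"
      using fin by (auto simp: cfun.dependent_finite)
    then obtain i where i: "i \<in> I" "v = e i" by auto
    have "(\<Sum>i\<in>I. u (e i) * e i x) = 0" for x
    proof -
      have "(\<Sum>w\<in>e ` I. (\<lambda>x. u w * w x)) x = 0" unfolding uv(3) by simp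
      then show ?thesis unfolding sum_fun_apply sum.reindex[OF inj] by simp
    qed
    then have "u (e i) = 0"
      using orthonormal_independent[OF fin on bm, of "\<lambda>i. u (e i)"] i(1) by blast
    then show False using uv i by simp
  qed
qed

end

section \<open>The surface measure\<close>


abbreviation (input) radial :: "'a::euclidean_space \<Rightarrow> 'a" where
  "radial x \<equiv> x /\<^sub>R norm x"

definition cone :: "'a::euclidean_space set \<Rightarrow> 'a set" where
  "cone A = {x \<in> ball 0 1 - {0}. radial x \<in> A}"

lemma space_sphere_measure [simp]: "space (sphere_measure :: 'a::euclidean_space measure) = sphere 0 1"
  by (simp add: sphere_measure_def space_scale_measure space_restrict_space)

lemma sets_sphere_measure [measurable_cong]:
  "sets (sphere_measure :: 'a::euclidean_space measure) = sets (restrict_space borel (sphere 0 1))"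
  by (simp add: sphere_measure_def)

lemma radial_measurable:
  "(radial :: 'a::euclidean_space \<Rightarrow> 'a) \<in> measurable (restrict_space lborel (ball 0 1 - {0})) (restrict_space borel (sphere 0 1))"
  by (intro measurable_restrict_space2 measurable_restrict_space1) (auto simp: space_restrict_space)

lemma cone_borel: "A \<in> sets sphere_measure \<Longrightarrow> cone A \<in> sets borel"
proof -
  assume "A \<in> sets sphere_measure"
  then obtain B where "B \<in> sets borel" "A = sphere 0 1 \<inter> B" by (auto simp: sets_sphere_measure sets_restrict_space)
  then have "cone A = (ball 0 1 - {0}) \<inter> (radial -` B \<inter> space borel)" by (auto simp: cone_def)
  moreover have "(radial -` B \<inter> space borel) \<in> sets borel"
    by (rule measurable_sets[OF _ \<open>B \<in> sets borel\<close>]) measurable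
  ultimately show ?thesis by auto
qed

lemma emeasure_sphere_measure:
  assumes "A \<in> sets (sphere_measure :: 'a::euclidean_space measure)"
  shows "emeasure sphere_measure A = of_nat DIM('a) * emeasure lborel (cone A)"
proof -
  have A: "A \<in> sets (restrict_space borel (sphere 0 1))" using assms by (simp add: sets_sphere_measure)
  have "emeasure sphere_measure A = of_nat DIM('a) * emeasure (restrict_space lborel (ball 0 1 - {0})) (radial -` A \<inter> space (restrict_space lborel (ball 0 1 - {0})))"
    unfolding sphere_measure_def emeasure_scale_measure by (subst emeasure_distr[OF radial_measurable A]) simp
  also have "radial -` A \<inter> space (restrict_space lborel (ball 0 1 - {0})) = cone A"
    by (auto simp: cone_def space_restrict_space)
  also have "emeasure (restrict_space lborel (ball 0 1 - {0})) (cone A) = emeasure lborel (cone A)"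
    by (rule emeasure_restrict_space) (auto simp: cone_def)
  finally show ?thesis .
qed

lemma finite_sphere_measure: "finite_measure (sphere_measure :: 'a::euclidean_space measure)"
proof
  have "emeasure lborel (cone (sphere 0 1 :: 'a set)) \<le> emeasure lborel (ball (0::'a) 1)"
    by (rule emeasure_mono) (auto simp: cone_def)
  also have "\<dots> < \<infinity>" by (rule emeasure_lborel_ball_finite)
  finally show "emeasure (sphere_measure :: 'a measure) (space sphere_measure) \<noteq> \<infinity>"
    by (subst emeasure_sphere_measure) (auto simp: ennreal_mult_eq_top_iff sets.top[of sphere_measure, simplified])
qed

interpretation sphere: finite_measure "sphere_measure :: 'a::euclidean_space measure"
  by (rule finite_sphere_measure)

lemma emeasure_lborel_unit_ball_pos: "emeasure lborel (ball (0::'a::euclidean_space) 1) \<noteq> 0"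
proof
  assume "emeasure lborel (ball (0::'a) 1) = 0"
  then have "ball (0::'a) 1 \<in> null_sets lebesgue" by (intro null_setsI) (auto simp: emeasure_completion)
  then have "negligible (ball (0::'a) 1)" by (simp add: negligible_iff_null_sets)
  then show False using open_not_negligible[of "ball (0::'a) 1"] by auto
qed

lemma measure_sphere_pos: "measure (sphere_measure :: 'a::euclidean_space measure) (sphere 0 1) > 0"
proof -
  have "sphere 0 1 \<in> sets (sphere_measure :: 'a measure)" using sets.top[of "sphere_measure :: 'a measure"] by simp
  note e = emeasure_sphere_measure[OF this]
  have "cone (sphere 0 1 :: 'a set) = ball 0 1 - {0}" by (auto simp: cone_def)
  moreover have "emeasure lborel (ball 0 1 - {0::'a}) = emeasure lborel (ball (0::'a) 1)"
    by (rule emeasure_Diff_null_set) auto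
  moreover note emeasure_lborel_unit_ball_pos[where 'a='a]
  ultimately have "emeasure (sphere_measure :: 'a measure) (sphere 0 1) \<noteq> 0" using e by simp
  then show ?thesis unfolding sphere.emeasure_eq_measure by (simp add: zero_less_measure_iff ennreal_eq_0_iff not_le)
qed

lemma nn_integral_lborel_translate:
  fixes f :: "'a::euclidean_space \<Rightarrow> ennreal"
  assumes "f \<in> borel_measurable borel"
  shows "(\<integral>\<^sup>+x. f (c + x) \<partial>lborel) = (\<integral>\<^sup>+x. f x \<partial>lborel)"
  using nn_integral_distr[of "(+) c" lborel borel f] assms lborel_distr_plus[of c] by simp

lemma orthogonal_transformation_borel_measurable:
  fixes T :: "'a::euclidean_space \<Rightarrow> 'a"
  assumes "orthogonal_transformation T"
  shows "T \<in> borel_measurable borel"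
  using assms
  by (intro borel_measurable_continuous_onI linear_continuous_on)
     (simp add: orthogonal_transformation_linear linear_conv_bounded_linear[symmetric])

text \<open>Uniqueness of Haar measure: both sides are translation invariant and agree on the unit ball.\<close>

lemma emeasure_lborel_orthogonal_vimage:
  fixes T :: "'a::euclidean_space \<Rightarrow> 'a"
  assumes T: "orthogonal_transformation T" and A[measurable]: "A \<in> sets borel"
  shows "emeasure lborel (T -` A) = emeasure lborel A"
proof -
  let ?B = "ball (0::'a) 1" and ?b = "emeasure lborel (ball (0::'a) 1)"
  note [measurable] = orthogonal_transformation_borel_measurable[OF T]
  have [measurable]: "?B \<in> sets borel" by simp
  have lin: "T (x + y) = T x + T y" "T (x - y) = T x - T y" for x y
    using orthogonal_transformation_linear[OF T] by (simp_all add: linear_add linear_diff)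
  have nT: "norm (T x) = norm x" for x using T by (simp add: orthogonal_transformation_norm)
  have surj: "T (inv T x) = x" for x using orthogonal_transformation_surj[OF T] by (rule surj_f_inv_f)
  have shift: "(\<integral>\<^sup>+x. indicator ?B (y - x) \<partial>lborel) = ?b" for y :: 'a
  proof -
    have "(\<integral>\<^sup>+x. indicator ?B (y - x) \<partial>lborel) = (\<integral>\<^sup>+x. indicator ?B (y - (y + x)) \<partial>lborel)"
      by (rule nn_integral_lborel_translate[symmetric]) measurable
    also have "\<dots> = (\<integral>\<^sup>+x. indicator ?B x \<partial>lborel)" by (simp add: indicator_def)
    finally show ?thesis by simp
  qed
  \<comment> \<open>T preserves the unit ball B, so 1_B(T y) may replace 1_B(y). The double integral
    of 1_A(T y + x) 1_B(T y) is computed in two orders: x first gives the measure of A; the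
    translation of y by T^-1 x followed by x first gives the measure of T^-1 A with the integral of
    1_B(T y - x) over x, which is again the measure of B.\<close>
  have "emeasure lborel A * ?b = (\<integral>\<^sup>+y. indicator ?B (T y) * emeasure lborel A \<partial>lborel)"
  proof -
    have "indicator ?B (T y) = (indicator ?B y :: ennreal)" for y
      by (auto simp: indicator_def nT)
    then show ?thesis by (simp add: nn_integral_multc nn_integral_cmult mult.commute)
  qed
  also have "\<dots> = (\<integral>\<^sup>+y. \<integral>\<^sup>+x. indicator A (T y + x) * indicator ?B (T y) \<partial>lborel \<partial>lborel)"
  proof (rule nn_integral_cong)
    fix y
    have "(\<integral>\<^sup>+x. indicator A (T y + x) * indicator ?B (T y) \<partial>lborel) = (\<integral>\<^sup>+x. indicator A (T y + x) \<partial>lborel) * indicator ?B (T y)"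
      by (rule nn_integral_multc) measurable
    also have "(\<integral>\<^sup>+x. indicator A (T y + x) \<partial>lborel) = emeasure lborel A"
      using nn_integral_lborel_translate[of "indicator A" "T y"] by simp
    finally show "indicator ?B (T y) * emeasure lborel A = (\<integral>\<^sup>+x. indicator A (T y + x) * indicator ?B (T y) \<partial>lborel)"
      by (simp add: mult.commute)
  qed
  also have "\<dots> = (\<integral>\<^sup>+x. \<integral>\<^sup>+y. indicator A (T y + x) * indicator ?B (T y) \<partial>lborel \<partial>lborel)"
    by (rule lborel_pair.Fubini') measurable
  also have "\<dots> = (\<integral>\<^sup>+x. \<integral>\<^sup>+y. indicator A (T y) * indicator ?B (T y - x) \<partial>lborel \<partial>lborel)"
  proof (rule nn_integral_cong)
    fix x
    have "(\<integral>\<^sup>+y. indicator A (T y) * indicator ?B (T y - x) \<partial>lborel)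
      = (\<integral>\<^sup>+y. indicator A (T (inv T x + y)) * indicator ?B (T (inv T x + y) - x) \<partial>lborel)"
      by (rule nn_integral_lborel_translate[symmetric]) measurable
    then show "(\<integral>\<^sup>+y. indicator A (T y + x) * indicator ?B (T y) \<partial>lborel) = (\<integral>\<^sup>+y. indicator A (T y) * indicator ?B (T y - x) \<partial>lborel)"
      by (simp add: lin surj add.commute)
  qed
  also have "\<dots> = (\<integral>\<^sup>+y. \<integral>\<^sup>+x. indicator A (T y) * indicator ?B (T y - x) \<partial>lborel \<partial>lborel)"
    by (rule lborel_pair.Fubini') measurable
  also have "\<dots> = (\<integral>\<^sup>+y. indicator A (T y) * ?b \<partial>lborel)"
  proof (rule nn_integral_cong)
    fix y
    have "(\<integral>\<^sup>+x. indicator A (T y) * indicator ?B (T y - x) \<partial>lborel) = indicator A (T y) * (\<integral>\<^sup>+x. indicator ?B (T y - x) \<partial>lborel)"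
      by (rule nn_integral_cmult) measurable
    then show "(\<integral>\<^sup>+x. indicator A (T y) * indicator ?B (T y - x) \<partial>lborel) = indicator A (T y) * ?b"
      unfolding shift .
  qed
  also have "\<dots> = emeasure lborel (T -` A) * ?b"
  proof -
    have "T -` A \<in> sets lborel" using measurable_sets[OF orthogonal_transformation_borel_measurable[OF T] A] by simp
    then have "(\<integral>\<^sup>+y. indicator (T -` A) y \<partial>lborel) = emeasure lborel (T -` A)" by simp
    moreover have "indicator A (T y) = (indicator (T -` A) y :: ennreal)" for y by (auto simp: indicator_def)
    ultimately show ?thesis by (simp add: nn_integral_multc)
  qed
  finally have "emeasure lborel A * ?b = emeasure lborel (T -` A) * ?b" .
  moreover have "?b \<noteq> 0" by (rule emeasure_lborel_unit_ball_pos)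
  moreover have "?b \<noteq> \<infinity>" using emeasure_lborel_ball_finite[of "0::'a" 1] by simp
  ultimately show ?thesis by (auto simp: mult.commute[of _ ?b] ennreal_mult_cancel_left)
qed

lemma orthogonal_transformation_sphere_measurable:
  fixes T :: "real^'n \<Rightarrow> real^'n"
  assumes T: "orthogonal_transformation T"
  shows "T \<in> measurable sphere_measure sphere_measure"
proof -
  have "T \<in> borel_measurable borel" by (rule orthogonal_transformation_borel_measurable[OF T])
  then have "T \<in> measurable (restrict_space borel (sphere 0 1)) (restrict_space borel (sphere 0 1))"
    using T by (intro measurable_restrict_space2 measurable_restrict_space1) (auto simp: space_restrict_space orthogonal_transformation_norm)
  then show ?thesis
    using measurable_cong_sets[OF sets_sphere_measure sets_sphere_measure] by blast
qed

text \<open>T commutes with the radial projection, so the cone over a preimage is the preimage of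
  the cone, and the claim becomes the invariance of Lebesgue measure.\<close>

lemma distr_sphere_measure_orthogonal:
  fixes T :: "real^'n \<Rightarrow> real^'n"
  assumes T: "orthogonal_transformation T"
  shows "distr sphere_measure sphere_measure T = sphere_measure"
proof (rule measure_eqI)
  fix A :: "(real^'n) set" assume "A \<in> sets (distr sphere_measure sphere_measure T)"
  then have A: "A \<in> sets sphere_measure" by simp
  note Tm = orthogonal_transformation_sphere_measurable[OF T]
  have vA: "T -` A \<inter> sphere 0 1 \<in> sets sphere_measure" using measurable_sets[OF Tm A] by simp
  have lin: "T (c *\<^sub>R x) = c *\<^sub>R T x" for c x using T by (simp add: orthogonal_transformation_scaleR)
  have nT: "norm (T x) = norm x" for x using T by (simp add: orthogonal_transformation_norm)
  have T0: "T x = 0 \<longleftrightarrow> x = 0" for x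
    unfolding norm_eq_zero[of "T x", symmetric] nT by simp
  have c: "cone (T -` A \<inter> sphere 0 1) = T -` cone A"
    unfolding cone_def by (rule set_eqI) (auto simp: T0 nT lin[symmetric])
  have "emeasure (distr sphere_measure sphere_measure T) A = emeasure sphere_measure (T -` A \<inter> sphere 0 1)"
    by (subst emeasure_distr[OF Tm A]) simp
  also have "\<dots> = of_nat DIM(real^'n) * emeasure lborel (T -` cone A)"
    unfolding emeasure_sphere_measure[OF vA] c ..
  also have "emeasure lborel (T -` cone A) = emeasure lborel (cone A)"
    by (rule emeasure_lborel_orthogonal_vimage[OF T cone_borel[OF A]])
  finally show "emeasure (distr sphere_measure sphere_measure T) A = emeasure sphere_measure A"
    unfolding emeasure_sphere_measure[OF A] .
qed simp

lemma integral_sphere_orthogonal: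
  fixes T :: "real^'n \<Rightarrow> real^'n" and f :: "real^'n \<Rightarrow> 'b::{banach, second_countable_topology}"
  assumes T: "orthogonal_transformation T" and f: "f \<in> borel_measurable sphere_measure"
  shows "(\<integral>x. f (T x) \<partial>sphere_measure) = (\<integral>x. f x \<partial>sphere_measure)"
  using integral_distr[OF orthogonal_transformation_sphere_measurable[OF T] f]
  unfolding distr_sphere_measure_orthogonal[OF T] by simp

section \<open>Polynomials and their partial derivatives\<close>


text \<open>Polynomials generated by constants and coordinates, so that differentiation, restriction
  to lines and substitution can be treated by rule induction.\<close>

inductive cpoly :: "(real^'n \<Rightarrow> complex) \<Rightarrow> bool" where
  cpoly_const: "cpoly (\<lambda>x. c)"
| cpoly_coord: "cpoly (\<lambda>x. of_real (x $ i))"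
| cpoly_add: "cpoly f \<Longrightarrow> cpoly g \<Longrightarrow> cpoly (\<lambda>x. f x + g x)"
| cpoly_mult: "cpoly f \<Longrightarrow> cpoly g \<Longrightarrow> cpoly (\<lambda>x. f x * g x)"

lemma cpoly_sum: "(\<And>i. i \<in> I \<Longrightarrow> cpoly (f i)) \<Longrightarrow> cpoly (\<lambda>x. \<Sum>i\<in>I. f i x)"
  by (induction I rule: infinite_finite_induct) (auto intro: cpoly.intros)

lemma cpoly_diff: "cpoly f \<Longrightarrow> cpoly g \<Longrightarrow> cpoly (\<lambda>x. f x - g x)"
  using cpoly_add[OF _ cpoly_mult[OF cpoly_const[of "-1"]], of f g] by simp

lemma real_polynomial_function_cpoly:
  fixes f :: "real^'n \<Rightarrow> real"
  assumes "real_polynomial_function f"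
  shows "cpoly (\<lambda>x. of_real (f x))"
  using assms
proof induction
  case (linear f)
  have e: "f x = (\<Sum>i\<in>UNIV. x $ i * f (axis i 1))" for x
  proof -
    have "f x = f (\<Sum>i\<in>UNIV. x $ i *\<^sub>R axis i 1)" using basis_expansion[of x] by (simp add: scalar_mult_eq_scaleR)
    then show ?thesis using linear by (simp add: bounded_linear.linear linear_sum linear_scale)
  qed
  have "cpoly (\<lambda>x. \<Sum>i\<in>UNIV. of_real (x $ i) * of_real (f (axis i 1)))"
    by (intro cpoly_sum cpoly_mult cpoly_coord cpoly_const)
  moreover have "(\<lambda>x. of_real (f x)) = (\<lambda>x. \<Sum>i\<in>UNIV. of_real (x $ i) * complex_of_real (f (axis i 1)))"
    by (rule ext) (subst e, simp)
  ultimately show ?case by (rule ssubst[where P=cpoly, rotated])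
qed (auto intro: cpoly.intros)

lemma polynomial_function_cpoly:
  fixes p :: "real^'n \<Rightarrow> complex"
  assumes "polynomial_function p"
  shows "cpoly p"
proof -
  have "cpoly (\<lambda>x. of_real (Re (p x)))" "cpoly (\<lambda>x. of_real (Im (p x)))"
    using assms bounded_linear_Re bounded_linear_Im
    by (auto simp: polynomial_function_def o_def intro!: real_polynomial_function_cpoly)
  then have "cpoly (\<lambda>x. of_real (Re (p x)) + \<i> * of_real (Im (p x)))"
    by (intro cpoly_add cpoly_mult cpoly_const)
  then show ?thesis by (simp add: complex_eq[symmetric])
qed

text \<open>A total derivative with prescribed partial derivatives. It supplies the chain rule along
  curves, while \<open>pd\<close> is the directional derivative that occurs in
  \<open>laplacian\<close>; \<open>has_grad_pd\<close> connects the two.\<close>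

definition has_grad :: "(real^'n \<Rightarrow> complex) \<Rightarrow> ('n \<Rightarrow> real^'n \<Rightarrow> complex) \<Rightarrow> bool" where
  "has_grad f G \<longleftrightarrow> (\<forall>x. (f has_derivative (\<lambda>v. \<Sum>i\<in>UNIV. of_real (v $ i) * G i x)) (at x))"

definition pd :: "'n \<Rightarrow> (real^'n \<Rightarrow> complex) \<Rightarrow> real^'n \<Rightarrow> complex" where
  "pd i f x = vector_derivative (\<lambda>t. f (x + t *\<^sub>R axis i 1)) (at 0)"

lemma has_grad_line:
  assumes "has_grad f G"
  shows "((\<lambda>t. f (x + t *\<^sub>R v)) has_vector_derivative (\<Sum>i\<in>UNIV. of_real (v $ i) * G i (x + s *\<^sub>R v))) (at s)"
proof -
  have "((\<lambda>t. x + t *\<^sub>R v) has_derivative (\<lambda>t. t *\<^sub>R v)) (at s)"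
    by (auto intro!: derivative_eq_intros)
  from diff_chain_at[OF this, of f "\<lambda>u. \<Sum>i\<in>UNIV. of_real (u $ i) * G i (x + s *\<^sub>R v)"] assms
  have "((\<lambda>t. f (x + t *\<^sub>R v)) has_derivative (\<lambda>t. \<Sum>i\<in>UNIV. of_real ((t *\<^sub>R v) $ i) * G i (x + s *\<^sub>R v))) (at s)"
    by (simp add: has_grad_def o_def)
  moreover have "(\<lambda>t. \<Sum>i\<in>UNIV. of_real ((t *\<^sub>R v) $ i) * G i (x + s *\<^sub>R v))
      = (\<lambda>t. t *\<^sub>R (\<Sum>i\<in>UNIV. of_real (v $ i) * G i (x + s *\<^sub>R v)))"
    by (simp add: sum_distrib_left scaleR_conv_of_real[where 'a=complex] mult.assoc)
  ultimately show ?thesis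
    unfolding has_vector_derivative_def by (simp only:)
qed

lemma sum_axis: "(\<Sum>i\<in>UNIV. complex_of_real (axis k 1 $ i) * g i) = g k"
proof -
  have "(\<Sum>i\<in>UNIV. complex_of_real (axis k 1 $ i) * g i) = (\<Sum>i\<in>UNIV. if i = k then g i else 0)"
    by (intro sum.cong) (auto simp: axis_def)
  then show ?thesis by simp
qed

lemma has_grad_axis:
  assumes "has_grad f G"
  shows "((\<lambda>t. f (x + t *\<^sub>R axis k 1)) has_vector_derivative G k (x + s *\<^sub>R axis k 1)) (at s)"
  using has_grad_line[OF assms, of x "axis k 1" s] unfolding sum_axis .

lemma has_grad_pd: "has_grad f G \<Longrightarrow> pd k f = G k"
  unfolding pd_def using has_grad_axis[of f G _ k 0] by (auto simp: fun_eq_iff intro!: vector_derivative_at)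

lemma has_grad_const: "has_grad (\<lambda>x. c) (\<lambda>i x. 0)"
  by (simp add: has_grad_def)

lemma has_grad_coord: "has_grad (\<lambda>x. of_real (x $ j)) (\<lambda>i x. if i = j then 1 else 0)"
proof -
  have e: "(\<lambda>v::real^'a. \<Sum>i\<in>UNIV. complex_of_real (v $ i) * (if i = j then 1 else 0)) = (\<lambda>v. of_real (v $ j))"
    by (simp add: if_distrib[of "\<lambda>c. _ * c"] cong: if_cong)
  have "bounded_linear (\<lambda>v::real^'a. complex_of_real (v $ j))"
    by (intro bounded_linear_compose[OF bounded_linear_of_real] bounded_linear_vec_nth)
  then show ?thesis unfolding has_grad_def e by (auto intro: bounded_linear_imp_has_derivative)
qed

lemma has_grad_add: "has_grad f F \<Longrightarrow> has_grad g G \<Longrightarrow> has_grad (\<lambda>x. f x + g x) (\<lambda>i x. F i x + G i x)"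
  unfolding has_grad_def by (auto simp: distrib_left sum.distrib intro!: has_derivative_add)

lemma has_grad_mult:
  assumes "has_grad f F" "has_grad g G"
  shows "has_grad (\<lambda>x. f x * g x) (\<lambda>i x. F i x * g x + f x * G i x)"
  unfolding has_grad_def
proof
  fix x
  have "((\<lambda>x. f x * g x) has_derivative (\<lambda>v. f x * (\<Sum>i\<in>UNIV. of_real (v $ i) * G i x) + (\<Sum>i\<in>UNIV. of_real (v $ i) * F i x) * g x)) (at x)"
    using assms unfolding has_grad_def by (intro has_derivative_mult) auto
  moreover have "(\<lambda>v::real^'a. f x * (\<Sum>i\<in>UNIV. of_real (v $ i) * G i x) + (\<Sum>i\<in>UNIV. of_real (v $ i) * F i x) * g x)
    = (\<lambda>v. \<Sum>i\<in>UNIV. of_real (v $ i) * (F i x * g x + f x * G i x))"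
    by (auto simp: fun_eq_iff sum_distrib_left sum_distrib_right sum.distrib[symmetric] algebra_simps intro!: sum.cong)
  ultimately show "((\<lambda>x. f x * g x) has_derivative (\<lambda>v. \<Sum>i\<in>UNIV. of_real (v $ i) * (F i x * g x + f x * G i x))) (at x)"
    by simp
qed

lemma cpoly_grad_exists: "cpoly f \<Longrightarrow> \<exists>G. has_grad f G \<and> (\<forall>i. cpoly (G i))"
proof (induction rule: cpoly.induct)
  case (cpoly_const c)
  then show ?case using has_grad_const by (blast intro: cpoly.intros)
next
  case (cpoly_coord i)
  have "cpoly (\<lambda>x. if j = i then 1 else 0)" for j by (rule cpoly.cpoly_const)
  then show ?case by (intro exI[of _ "\<lambda>j x. if j = i then 1 else 0"] conjI has_grad_coord allI)
next
  case (cpoly_add f g)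
  then obtain F G where "has_grad f F" "has_grad g G" "\<And>i. cpoly (F i)" "\<And>i. cpoly (G i)" by blast
  then show ?case
    by (intro exI[of _ "\<lambda>i x. F i x + G i x"] conjI has_grad_add allI cpoly.cpoly_add)
next
  case (cpoly_mult f g)
  then obtain F G where "has_grad f F" "has_grad g G" "\<And>i. cpoly (F i)" "\<And>i. cpoly (G i)" by blast
  then show ?case using cpoly_mult.hyps
    by (intro exI[of _ "\<lambda>i x. F i x * g x + f x * G i x"] conjI has_grad_mult allI cpoly.cpoly_add cpoly.cpoly_mult)
qed

lemma cpoly_has_grad: "cpoly f \<Longrightarrow> has_grad f (\<lambda>i. pd i f)"
  and cpoly_pd: "cpoly f \<Longrightarrow> cpoly (pd i f)"
proof -
  assume "cpoly f"
  then obtain G where G: "has_grad f G" "\<And>i. cpoly (G i)" using cpoly_grad_exists by blast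
  have "(\<lambda>i. pd i f) = G" using has_grad_pd[OF G(1)] by (rule ext)
  then show "has_grad f (\<lambda>i. pd i f)" using G(1) by (simp only:)
  show "cpoly (pd i f)" unfolding has_grad_pd[OF G(1)] by (rule G(2))
qed

lemma pd_const: "pd k (\<lambda>x. c) = (\<lambda>x. 0)"
  by (rule has_grad_pd[OF has_grad_const])

lemma pd_coord: "pd k (\<lambda>x. of_real (x $ j)) = (\<lambda>x. if k = j then 1 else 0)"
  by (rule has_grad_pd[OF has_grad_coord])

lemma pd_add: "cpoly f \<Longrightarrow> cpoly g \<Longrightarrow> pd k (\<lambda>x. f x + g x) = (\<lambda>x. pd k f x + pd k g x)"
  by (rule has_grad_pd[OF has_grad_add[OF cpoly_has_grad cpoly_has_grad]])

lemma pd_mult: "cpoly f \<Longrightarrow> cpoly g \<Longrightarrow> pd k (\<lambda>x. f x * g x) = (\<lambda>x. pd k f x * g x + f x * pd k g x)"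
  by (rule has_grad_pd[OF has_grad_mult[OF cpoly_has_grad cpoly_has_grad]])

lemma pd_diff: "cpoly f \<Longrightarrow> cpoly g \<Longrightarrow> pd k (\<lambda>x. f x - g x) = (\<lambda>x. pd k f x - pd k g x)"
  using pd_add[of f "\<lambda>x. -1 * g x" k] pd_mult[OF cpoly_const[of "-1"], of g k] cpoly_mult[OF cpoly_const[of "-1"], of g]
  by (simp add: pd_const)

lemma pd_sum:
  assumes "finite I" "\<And>i. i \<in> I \<Longrightarrow> cpoly (f i)"
  shows "pd k (\<lambda>x. \<Sum>i\<in>I. f i x) = (\<lambda>x. \<Sum>i\<in>I. pd k (f i) x)"
  using assms by (induction I rule: finite_induct) (auto simp: pd_const pd_add cpoly_sum)

lemma pd_commute: "cpoly f \<Longrightarrow> pd i (pd j f) = pd j (pd i f)"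
proof (induction rule: cpoly.induct)
  case (cpoly_coord k)
  show ?case by (simp add: pd_coord pd_const)
qed (auto simp: pd_const pd_add pd_mult cpoly_pd cpoly_mult add_ac)

lemma pd_cnj:
  assumes "cpoly f"
  shows "cpoly (\<lambda>x. cnj (f x))" "pd k (\<lambda>x. cnj (f x)) = (\<lambda>x. cnj (pd k f x))"
proof -
  show "cpoly (\<lambda>x. cnj (f x))"
    using assms by induction (auto intro: cpoly.intros)
  have "has_grad (\<lambda>x. cnj (f x)) (\<lambda>i x. cnj (pd i f x))"
    unfolding has_grad_def
  proof
    fix x
    have "((\<lambda>x. cnj (f x)) has_derivative (\<lambda>v. cnj (\<Sum>i\<in>UNIV. of_real (v $ i) * pd i f x))) (at x)"
      using cpoly_has_grad[OF assms] unfolding has_grad_def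
      by (intro bounded_linear.has_derivative[OF bounded_linear_cnj]) auto
    then show "((\<lambda>x. cnj (f x)) has_derivative (\<lambda>v. \<Sum>i\<in>UNIV. of_real (v $ i) * cnj (pd i f x))) (at x)" by simp
  qed
  then show "pd k (\<lambda>x. cnj (f x)) = (\<lambda>x. cnj (pd k f x))" using has_grad_pd by fastforce
qed

lemma cpoly_continuous: "cpoly f \<Longrightarrow> continuous_on A f"
  by (induction rule: cpoly.induct) (auto intro!: continuous_intros)

lemma cpoly_bounded_measurable: "cpoly f \<Longrightarrow> bounded_measurable sphere_measure f"
proof -
  assume f: "cpoly f"
  have "f \<in> borel_measurable borel"
    by (intro borel_measurable_continuous_onI cpoly_continuous f)
  then have "f \<in> borel_measurable (restrict_space borel (sphere 0 1))" by (rule measurable_restrict_space1)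
  then have "f \<in> borel_measurable sphere_measure" using measurable_cong_sets[OF sets_sphere_measure refl] by blast
  moreover have "bounded (f ` sphere 0 1)"
    by (intro compact_imp_bounded compact_continuous_image cpoly_continuous f) simp
  ultimately show ?thesis by (auto simp: bounded_measurable_def bounded_iff)
qed

lemma Basis_real_vec: "(Basis :: (real^'n) set) = range (\<lambda>i. axis i 1)"
  by (auto simp: Basis_vec_def)

lemma laplacian_cpoly:
  fixes f :: "real^'n \<Rightarrow> complex"
  assumes "cpoly f"
  shows "laplacian f x = (\<Sum>i\<in>UNIV. pd i (pd i f) x)"
proof -
  have 1: "vector_derivative (\<lambda>t. f (x + t *\<^sub>R axis i 1)) (at s) = pd i f (x + s *\<^sub>R axis i 1)" for i s
    by (rule vector_derivative_at[OF has_grad_axis[OF cpoly_has_grad[OF assms]]])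
  have "inj (\<lambda>i::'n. axis i (1::real))" by (auto simp: inj_on_def axis_eq_axis)
  then show ?thesis
    unfolding laplacian_def Basis_real_vec by (subst sum.reindex) (auto simp: 1 pd_def[symmetric])
qed

definition homogeneous :: "nat \<Rightarrow> (real^'n \<Rightarrow> complex) \<Rightarrow> bool" where
  "homogeneous l f \<longleftrightarrow> (\<forall>t x. f (t *\<^sub>R x) = of_real (t ^ l) * f x)"

definition solid_harmonic :: "nat \<Rightarrow> (real^'n \<Rightarrow> complex) \<Rightarrow> bool" where
  "solid_harmonic l f \<longleftrightarrow> cpoly f \<and> homogeneous l f \<and> (\<forall>x. (\<Sum>i\<in>UNIV. pd i (pd i f) x) = 0)"

lemma spherical_harmonicsE:
  fixes Y :: "real^'n \<Rightarrow> complex"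
  assumes "Y \<in> spherical_harmonics l"
  obtains p where "solid_harmonic l p" "Y = (\<lambda>\<omega>. if \<omega> \<in> sphere 0 1 then p \<omega> else 0)" "polynomial_function p"
proof -
  from assms obtain p where p: "polynomial_function p" "\<And>t x. p (t *\<^sub>R x) = of_real (t ^ l) * p x"
      "\<And>x. laplacian p x = 0" and Y: "Y = (\<lambda>\<omega>. if \<omega> \<in> sphere 0 1 then p \<omega> else 0)"
    unfolding spherical_harmonics_def by blast
  have "cpoly p" by (rule polynomial_function_cpoly[OF p(1)])
  then have "solid_harmonic l p" using p by (simp add: solid_harmonic_def homogeneous_def laplacian_cpoly)
  then show thesis using that Y p(1) by blast
qed

lemma spherical_harmonicsI:
  fixes p :: "real^'n \<Rightarrow> complex"
  assumes "solid_harmonic l p" "polynomial_function p"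
  shows "(\<lambda>\<omega>. if \<omega> \<in> sphere 0 1 then p \<omega> else 0) \<in> spherical_harmonics l"
  using assms unfolding spherical_harmonics_def solid_harmonic_def homogeneous_def
  by (auto simp: laplacian_cpoly intro!: exI[of _ p])

lemma solid_harmonic_cnj: "solid_harmonic l f \<Longrightarrow> solid_harmonic l (\<lambda>x. cnj (f x))"
  unfolding solid_harmonic_def homogeneous_def
  by (auto simp: pd_cnj cpoly_pd cnj_sum[symmetric] simp del: cnj_sum)

text \<open>Differentiate f (t x) = t^l f x in t at t = 1.\<close>

lemma euler_identity:
  assumes "cpoly f" "homogeneous l f"
  shows "(\<Sum>i\<in>UNIV. of_real (x $ i) * pd i f x) = of_nat l * f x"
proof -
  have "((\<lambda>t. f (0 + t *\<^sub>R x)) has_vector_derivative (\<Sum>i\<in>UNIV. of_real (x $ i) * pd i f (0 + 1 *\<^sub>R x))) (at 1)"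
    by (rule has_grad_line[OF cpoly_has_grad[OF assms(1)]])
  moreover have "((\<lambda>t. of_real (t ^ l) * f x) has_vector_derivative of_nat l * f x) (at 1)"
  proof -
    have "((\<lambda>t. t ^ l) has_real_derivative real l) (at 1)" by (auto intro!: derivative_eq_intros)
    then have "((\<lambda>t. complex_of_real (t ^ l)) has_vector_derivative of_real (real l)) (at 1)"
      by (intro has_vector_derivative_of_real) (simp only: has_real_derivative_iff_has_vector_derivative)
    from has_vector_derivative_mult_left[OF this, of "f x"] show ?thesis by simp
  qed
  moreover have "(\<lambda>t. f (0 + t *\<^sub>R x)) = (\<lambda>t. of_real (t ^ l) * f x)"
    using assms(2) by (simp add: homogeneous_def)
  ultimately show ?thesis using vector_derivative_unique_at by fastforce
qed

text \<open>Apply x_j d/dx_j to Euler's identity and sum over j; the diagonal terms form Euler's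
  identity once more.\<close>

lemma euler_identity2:
  assumes f: "cpoly f" "homogeneous l f"
  shows "(\<Sum>j\<in>UNIV. \<Sum>i\<in>UNIV. of_real (x $ j) * of_real (x $ i) * pd j (pd i f) x) = (of_nat l * of_nat l - of_nat l) * f x"
proof -
  note c = cpoly_coord cpoly_pd[OF f(1)] cpoly_mult cpoly_sum
  have 1: "pd j (\<lambda>x. \<Sum>i\<in>UNIV. of_real (x $ i) * pd i f x) x = pd j f x + (\<Sum>i\<in>UNIV. of_real (x $ i) * pd j (pd i f) x)" for j x
    by (subst pd_sum) (auto simp: pd_mult pd_coord c sum.distrib if_distrib[of "\<lambda>c. c * _"] cong: if_cong)
  have 2: "(\<lambda>x. \<Sum>i\<in>UNIV. of_real (x $ i) * pd i f x) = (\<lambda>x. of_nat l * f x)"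
    using euler_identity[OF f] by (rule ext)
  have 3: "pd j (\<lambda>x. of_nat l * f x) x = of_nat l * pd j f x" for j x
    using pd_mult[OF cpoly_const f(1)] by (simp add: pd_const)
  have *: "pd j f x + (\<Sum>i\<in>UNIV. of_real (x $ i) * pd j (pd i f) x) = of_nat l * pd j f x" for j x
    unfolding 1[symmetric] 2 by (rule 3)
  have "(\<Sum>j\<in>UNIV. of_real (x $ j) * (pd j f x + (\<Sum>i\<in>UNIV. of_real (x $ i) * pd j (pd i f) x))) = of_nat l * (of_nat l * f x)"
    unfolding * euler_identity[OF f, symmetric] by (simp add: sum_distrib_left mult.left_commute)
  then have "(\<Sum>j\<in>UNIV. of_real (x $ j) * pd j f x) + (\<Sum>j\<in>UNIV. \<Sum>i\<in>UNIV. of_real (x $ j) * of_real (x $ i) * pd j (pd i f) x) = of_nat l * (of_nat l * f x)"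
    by (simp add: distrib_left sum.distrib sum_distrib_left mult.assoc)
  then show ?thesis unfolding euler_identity[OF f] by (simp add: algebra_simps)
qed

text \<open>The infinitesimal rotation in the (i, j) plane. Being tangent to the spheres, it allows
  integration by parts on them.\<close>

definition rot_field :: "'n \<Rightarrow> 'n \<Rightarrow> (real^'n \<Rightarrow> complex) \<Rightarrow> real^'n \<Rightarrow> complex" where
  "rot_field i j f x = of_real (x $ i) * pd j f x - of_real (x $ j) * pd i f x"

lemma cpoly_rot_field: "cpoly f \<Longrightarrow> cpoly (rot_field i j f)"
  unfolding rot_field_def[abs_def] by (intro cpoly_diff cpoly_mult cpoly_coord cpoly_pd)

lemma rot_field_mult:
  assumes "cpoly f" "cpoly g"
  shows "rot_field i j (\<lambda>x. f x * g x) x = rot_field i j f x * g x + f x * rot_field i j g x"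
  using assms by (simp add: rot_field_def pd_mult algebra_simps)

text \<open>On the unit sphere the sum of squares over ordered pairs is twice the Laplace-Beltrami
  operator. In the expansion the terms of the form |x|^2 times the Laplacian vanish, and the rest is
  given by the two Euler identities.\<close>

lemma rot_field_casimir:
  fixes f :: "real^'n \<Rightarrow> complex"
  assumes "solid_harmonic l f"
  shows "(\<Sum>i\<in>UNIV. \<Sum>j\<in>UNIV. rot_field i j (rot_field i j f) x) = - 2 * (of_nat l * (of_nat l + of_nat CARD('n) - 2)) * f x"
proof -
  have f: "cpoly f" "homogeneous l f" "(\<Sum>i\<in>UNIV. pd i (pd i f) x) = 0" using assms by (auto simp: solid_harmonic_def)
  let ?x = "\<lambda>i. complex_of_real (x $ i)" and ?d = "\<lambda>i j. if i = j then 1 else 0 :: complex"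
  have e: "rot_field i j (rot_field i j f) x = ?d i j * (2 * (?x i * pd i f x)) + ?x i * ?x i * pd j (pd j f) x + ?x j * ?x j * pd i (pd i f) x
      - ?x i * pd i f x - ?x j * pd j f x - 2 * (?x i * ?x j * pd i (pd j f) x)" for i j
  proof -
    note c = cpoly_coord cpoly_pd cpoly_mult f(1)
    have P: "pd k (rot_field i j f) x = ?d k i * pd j f x + ?x i * pd k (pd j f) x - (?d k j * pd i f x + ?x j * pd k (pd i f) x)" for k
      unfolding rot_field_def[abs_def] by (simp add: pd_diff pd_mult pd_coord c)
    show ?thesis
      unfolding rot_field_def[of i j "rot_field i j f"] P using pd_commute[OF f(1), of j i]
      by (cases "i = j") (simp_all add: algebra_simps)
  qed
  have s: "(\<Sum>i\<in>UNIV. \<Sum>j\<in>UNIV. ?x i * ?x i * pd j (pd j f) x) = 0" "(\<Sum>i\<in>UNIV. \<Sum>j\<in>UNIV. ?x j * ?x j * pd i (pd i f) x) = 0"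
    using f(3) by (simp_all add: sum_distrib_left[symmetric] sum_distrib_right[symmetric])
  have "(\<Sum>i\<in>UNIV. \<Sum>j\<in>UNIV. rot_field i j (rot_field i j f) x)
    = 2 * (\<Sum>i\<in>UNIV. ?x i * pd i f x) - of_nat CARD('n) * (\<Sum>i\<in>UNIV. ?x i * pd i f x) - of_nat CARD('n) * (\<Sum>i\<in>UNIV. ?x i * pd i f x)
      - 2 * (\<Sum>i\<in>UNIV. \<Sum>j\<in>UNIV. ?x i * ?x j * pd i (pd j f) x)"
    unfolding e sum.distrib sum_subtractf s
    by (simp add: sum_distrib_left if_distrib[of "\<lambda>c. c * _"] cong: if_cong)
  then show ?thesis unfolding euler_identity[OF f(1,2)] euler_identity2[OF f(1,2)] by (simp add: algebra_simps)
qed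

section \<open>Rotations and orthogonality of spherical harmonics\<close>


definition plane_rotation :: "'n \<Rightarrow> 'n \<Rightarrow> real \<Rightarrow> real^'n \<Rightarrow> real^'n" where
  "plane_rotation i j t x = x + (cos t - 1) *\<^sub>R (x $ i *\<^sub>R axis i 1 + x $ j *\<^sub>R axis j 1)
     + sin t *\<^sub>R (x $ i *\<^sub>R axis j 1 - x $ j *\<^sub>R axis i 1)"

lemma plane_rotation_nth:
  assumes "i \<noteq> j"
  shows "plane_rotation i j t x $ k = (if k = i then cos t * x $ i - sin t * x $ j
     else if k = j then sin t * x $ i + cos t * x $ j else x $ k)"
  using assms by (auto simp: plane_rotation_def axis_def algebra_simps)

lemma orthogonal_plane_rotation:
  assumes "i \<noteq> j"
  shows "orthogonal_transformation (plane_rotation i j t)"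
  unfolding orthogonal_transformation
proof
  show "linear (plane_rotation i j t)"
    by (rule linearI) (simp_all add: vec_eq_iff plane_rotation_nth[OF assms] algebra_simps)
  show "\<forall>x. norm (plane_rotation i j t x) = norm x"
  proof
    fix x
    let ?d = "\<lambda>k. (plane_rotation i j t x $ k)\<^sup>2 - (x $ k)\<^sup>2"
    have "(\<Sum>k\<in>UNIV. ?d k) = (\<Sum>k\<in>{i, j}. ?d k)"
      by (rule sum.mono_neutral_right) (auto simp: plane_rotation_nth[OF assms])
    also have "\<dots> = ((cos t * x $ i - sin t * x $ j)\<^sup>2 - (x $ i)\<^sup>2) + ((sin t * x $ i + cos t * x $ j)\<^sup>2 - (x $ j)\<^sup>2)"
      using assms by (simp add: plane_rotation_nth[OF assms])
    also have "\<dots> = ((cos t)\<^sup>2 + (sin t)\<^sup>2 - 1) * ((x $ i)\<^sup>2 + (x $ j)\<^sup>2)"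
      by algebra
    finally have "(\<Sum>k\<in>UNIV. (plane_rotation i j t x $ k)\<^sup>2) = (\<Sum>k\<in>UNIV. (x $ k)\<^sup>2)"
      by (simp add: sum_subtractf)
    then show "norm (plane_rotation i j t x) = norm x" by (simp add: norm_vec_def L2_set_def)
  qed
qed

lemma has_vector_derivative_plane_rotation:
  assumes f: "cpoly f" and ij: "i \<noteq> j"
  shows "((\<lambda>t. f (plane_rotation i j t x)) has_vector_derivative rot_field i j f (plane_rotation i j t x)) (at t)"
proof -
  let ?y = "plane_rotation i j t x"
  let ?v = "- sin t *\<^sub>R (x $ i *\<^sub>R axis i 1 + x $ j *\<^sub>R axis j 1) + cos t *\<^sub>R (x $ i *\<^sub>R axis j 1 - x $ j *\<^sub>R axis i (1::real))"
  have v: "?v = (?y $ i) *\<^sub>R axis j 1 - (?y $ j) *\<^sub>R axis i 1"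
    using ij by (simp add: plane_rotation_nth[OF ij] algebra_simps)
  have "((\<lambda>t. plane_rotation i j t x) has_vector_derivative ?v) (at t)"
    unfolding plane_rotation_def has_vector_derivative_def
    by (auto intro!: derivative_eq_intros simp: algebra_simps)
  then have d: "((\<lambda>t. plane_rotation i j t x) has_derivative (\<lambda>h. h *\<^sub>R ?v)) (at t)"
    by (simp add: has_vector_derivative_def)
  have "(f has_derivative (\<lambda>u. \<Sum>k\<in>UNIV. of_real (u $ k) * pd k f ?y)) (at ?y)"
    using cpoly_has_grad[OF f] by (simp add: has_grad_def)
  from diff_chain_at[OF d this] have
    "((\<lambda>t. f (plane_rotation i j t x)) has_derivative (\<lambda>h. \<Sum>k\<in>UNIV. of_real ((h *\<^sub>R ?v) $ k) * pd k f ?y)) (at t)"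
    by (simp only: o_def)
  moreover have "(\<Sum>k\<in>UNIV. of_real ((h *\<^sub>R ?v) $ k) * pd k f ?y) = h *\<^sub>R rot_field i j f ?y" for h
  proof -
    have "(\<Sum>k\<in>UNIV. of_real ((h *\<^sub>R ?v) $ k) * pd k f ?y)
      = of_real h * (of_real (?y $ i) * (\<Sum>k\<in>UNIV. of_real (axis j 1 $ k) * pd k f ?y)
          - of_real (?y $ j) * (\<Sum>k\<in>UNIV. of_real (axis i 1 $ k) * pd k f ?y))"
      unfolding v by (simp add: sum_distrib_left sum_subtractf[symmetric] algebra_simps)
    then show ?thesis unfolding sum_axis rot_field_def by (simp add: scaleR_conv_of_real)
  qed
  ultimately show ?thesis unfolding has_vector_derivative_def by simp
qed

lemma plane_rotation_0: "plane_rotation i j 0 x = x"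
  by (simp add: plane_rotation_def)

text \<open>The integral of f over the sphere does not change under rotation by t, and its
  derivative at t = 0 is the integral of \<open>rot_field i j f\<close>. The difference quotients
  \<open>?h m\<close> have integral 0 and converge to it. Their constant majorant comes from the
  mean value inequality, because the orbit of a point of the sphere stays on the sphere, where
  \<open>rot_field i j f\<close> is bounded.\<close>

lemma integral_rot_field:
  fixes f :: "real^'n \<Rightarrow> complex"
  assumes f: "cpoly f"
  shows "(\<integral>x. rot_field i j f x \<partial>sphere_measure) = 0"
proof (cases "i = j")
  case True
  then show ?thesis by (simp add: rot_field_def)
next
  case ij: False
  let ?g = "rot_field i j f" and ?R = "plane_rotation i j"
  let ?h = "\<lambda>m x. (f (?R (inverse (real (Suc m))) x) - f x) * of_nat (Suc m)"
  have g: "cpoly ?g" by (rule cpoly_rot_field[OF f])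
  have bf: "bounded_measurable sphere_measure f" and bg: "bounded_measurable sphere_measure ?g"
    using f g by (auto intro: cpoly_bounded_measurable)
  then have [measurable]: "f \<in> borel_measurable sphere_measure" "?g \<in> borel_measurable sphere_measure"
    by (auto simp: bounded_measurable_def)
  have [measurable]: "?R t \<in> measurable sphere_measure sphere_measure" for t
    by (rule orthogonal_transformation_sphere_measurable[OF orthogonal_plane_rotation[OF ij]])
  obtain B where B: "\<And>x. x \<in> sphere 0 1 \<Longrightarrow> cmod (?g x) \<le> B"
    using bg unfolding bounded_measurable_def space_sphere_measure by blast
  have "(\<lambda>m. \<integral>x. ?h m x \<partial>sphere_measure) \<longlonglongrightarrow> (\<integral>x. ?g x \<partial>sphere_measure)"
  proof (rule integral_dominated_convergence[where w="\<lambda>_. B"])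
    show "AE x in sphere_measure. (\<lambda>m. ?h m x) \<longlonglongrightarrow> ?g x"
    proof (intro AE_I2)
      fix x :: "real^'n"
      let ?F = "\<lambda>t. f (?R t x)"
      have "(?F has_derivative (\<lambda>h. h *\<^sub>R ?g x)) (at 0)"
        using has_vector_derivative_plane_rotation[OF f ij, of x 0] by (simp add: has_vector_derivative_def plane_rotation_0)
      then have "((\<lambda>h. norm (?F (0 + h) - ?F 0 - h *\<^sub>R ?g x) / norm h) \<longlongrightarrow> 0) (at 0)"
        by (simp add: has_derivative_at)
      moreover have "filterlim (\<lambda>m. inverse (real (Suc m))) (at 0) sequentially"
        unfolding filterlim_at using LIMSEQ_inverse_real_of_nat by (simp del: of_nat_Suc)
      ultimately have "(\<lambda>m. norm (?F (0 + inverse (real (Suc m))) - ?F 0 - inverse (real (Suc m)) *\<^sub>R ?g x) / norm (inverse (real (Suc m)))) \<longlonglongrightarrow> 0"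
        by (rule filterlim_compose)
      moreover have "norm (?F (0 + inverse (real (Suc m))) - ?F 0 - inverse (real (Suc m)) *\<^sub>R ?g x) / norm (inverse (real (Suc m))) = norm (?h m x - ?g x)" for m
      proof -
        have "?h m x - ?g x = (?F (0 + inverse (real (Suc m))) - ?F 0 - inverse (real (Suc m)) *\<^sub>R ?g x) * of_nat (Suc m)"
          by (simp add: plane_rotation_0 scaleR_conv_of_real field_simps del: of_nat_Suc)
        then show ?thesis by (simp add: norm_mult divide_inverse del: of_nat_Suc)
      qed
      ultimately show "(\<lambda>m. ?h m x) \<longlonglongrightarrow> ?g x"
        by (simp add: tendsto_norm_zero_iff LIM_zero_iff)
    qed
    show "AE x in sphere_measure. norm (?h m x) \<le> B" for m
    proof (intro AE_I2)
      fix x :: "real^'n" assume "x \<in> space sphere_measure"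
      then have x: "?R t x \<in> sphere 0 1" for t
        using orthogonal_plane_rotation[OF ij] by (simp add: orthogonal_transformation_norm)
      have "norm (f (?R (inverse (real (Suc m))) x) - f (?R 0 x)) \<le> B * norm (inverse (real (Suc m)) - 0)"
      proof (rule differentiable_bound[of UNIV])
        show "((\<lambda>t. f (?R t x)) has_derivative (\<lambda>h. h *\<^sub>R ?g (?R t x))) (at t within UNIV)" for t
          using has_vector_derivative_plane_rotation[OF f ij, of x t] by (simp add: has_vector_derivative_def)
        show "onorm (\<lambda>h. h *\<^sub>R ?g (?R t x)) \<le> B" for t
        proof (rule onorm_le)
          fix h :: real
          have "norm (h *\<^sub>R ?g (?R t x)) = \<bar>h\<bar> * cmod (?g (?R t x))" by simp
          also have "\<dots> \<le> \<bar>h\<bar> * B" by (rule mult_left_mono[OF B[OF x]]) simp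
          finally show "norm (h *\<^sub>R ?g (?R t x)) \<le> B * norm h" by (simp add: mult.commute)
        qed
      qed auto
      then have "cmod (f (?R (inverse (real (Suc m))) x) - f x) * real (Suc m) \<le> B"
        by (simp add: plane_rotation_0 field_simps del: of_nat_Suc)
      then show "norm (?h m x) \<le> B" by (simp only: norm_mult norm_of_nat)
    qed
  qed auto
  moreover have "(\<integral>x. ?h m x \<partial>sphere_measure) = 0" for m
  proof -
    have i1: "integrable sphere_measure f" by (rule sphere.integrable_bounded_measurable[OF bf])
    have i2: "integrable sphere_measure (\<lambda>x. f (?R t x))" for t
    proof -
      obtain A where "\<And>x. x \<in> sphere 0 1 \<Longrightarrow> cmod (f x) \<le> A"
        using bf unfolding bounded_measurable_def space_sphere_measure by blast
      then show ?thesis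
        using orthogonal_plane_rotation[OF ij, of t]
        by (intro sphere.integrable_const_bound[where B=A]) (auto simp: orthogonal_transformation_norm)
    qed
    have "(\<integral>x. ?h m x \<partial>sphere_measure) = ((\<integral>x. f (?R (inverse (real (Suc m))) x) \<partial>sphere_measure) - (\<integral>x. f x \<partial>sphere_measure)) * of_nat (Suc m)"
      using i1 i2 by (simp del: of_nat_Suc)
    also have "(\<integral>x. f (?R (inverse (real (Suc m))) x) \<partial>sphere_measure) = (\<integral>x. f x \<partial>sphere_measure)"
      by (rule integral_sphere_orthogonal[OF orthogonal_plane_rotation[OF ij]]) measurable
    finally show ?thesis by simp
  qed
  ultimately have "0 = (\<integral>x. ?g x \<partial>sphere_measure)" by (simp only: LIMSEQ_const_iff)
  then show ?thesis by simp
qed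

lemma integral_rot_field_skew:
  assumes "cpoly f" "cpoly g"
  shows "(\<integral>x. rot_field i j f x * g x \<partial>sphere_measure) = - (\<integral>x. f x * rot_field i j g x \<partial>sphere_measure)"
proof -
  have "integrable sphere_measure (\<lambda>x. rot_field i j f x * g x)" "integrable sphere_measure (\<lambda>x. f x * rot_field i j g x)"
    using assms by (auto intro!: sphere.integrable_bounded_measurable cpoly_bounded_measurable cpoly_mult cpoly_rot_field)
  then have "(\<integral>x. rot_field i j f x * g x \<partial>sphere_measure) + (\<integral>x. f x * rot_field i j g x \<partial>sphere_measure)
    = (\<integral>x. rot_field i j (\<lambda>x. f x * g x) x \<partial>sphere_measure)"
    by (simp add: rot_field_mult[OF assms])
  then show ?thesis unfolding integral_rot_field[OF cpoly_mult[OF assms]] by (simp add: eq_neg_iff_add_eq_0)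
qed

text \<open>Moving each rotation field twice to the other factor makes the sum of squares symmetric,
  and f and g are eigenfunctions. The eigenvalues differ since l (l + n - 2) is strictly increasing
  in l for n \<ge> 2. The pairing is bilinear; conjugation enters later through
  \<open>solid_harmonic_cnj\<close>.\<close>

lemma solid_harmonic_orthogonal:
  fixes f g :: "real^'n \<Rightarrow> complex"
  assumes f: "solid_harmonic l f" and g: "solid_harmonic l' g" and ne: "l \<noteq> l'" and n: "CARD('n) \<ge> 2"
  shows "(\<integral>x. f x * g x \<partial>sphere_measure) = 0"
proof -
  have c: "cpoly f" "cpoly g" using f g by (auto simp: solid_harmonic_def)
  define \<Lambda> where "\<Lambda> l = (- 2 * (of_nat l * (of_nat l + of_nat CARD('n) - 2)) :: complex)" for l :: nat
  have int: "integrable sphere_measure (\<lambda>x. a x * b x)" if "cpoly a" "cpoly b" for a b :: "real^'n \<Rightarrow> complex"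
    using that by (auto intro!: sphere.integrable_bounded_measurable cpoly_bounded_measurable cpoly_mult)
  have s: "(\<integral>x. rot_field i j (rot_field i j f) x * g x \<partial>sphere_measure) = (\<integral>x. f x * rot_field i j (rot_field i j g) x \<partial>sphere_measure)" for i j
    using integral_rot_field_skew[OF cpoly_rot_field[OF c(1)] c(2), of i j i j]
      integral_rot_field_skew[OF c(1) cpoly_rot_field[OF c(2)], of i j i j] by simp
  have "\<Lambda> l * (\<integral>x. f x * g x \<partial>sphere_measure) = (\<integral>x. (\<Sum>i\<in>UNIV. \<Sum>j\<in>UNIV. rot_field i j (rot_field i j f) x * g x) \<partial>sphere_measure)"
  proof -
    have "(\<Sum>i\<in>UNIV. \<Sum>j\<in>UNIV. rot_field i j (rot_field i j f) x * g x) = \<Lambda> l * (f x * g x)" for x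
    proof -
      have "(\<Sum>i\<in>UNIV. \<Sum>j\<in>UNIV. rot_field i j (rot_field i j f) x * g x)
        = (\<Sum>i\<in>UNIV. \<Sum>j\<in>UNIV. rot_field i j (rot_field i j f) x) * g x"
        by (simp only: sum_distrib_right)
      then show ?thesis unfolding rot_field_casimir[OF f] \<Lambda>_def by (simp only: mult.assoc)
    qed
    then show ?thesis by simp
  qed
  also have "\<dots> = (\<Sum>i\<in>UNIV. \<Sum>j\<in>UNIV. \<integral>x. rot_field i j (rot_field i j f) x * g x \<partial>sphere_measure)"
    using c by (simp add: Bochner_Integration.integral_sum int cpoly_rot_field)
  also have "\<dots> = (\<Sum>i\<in>UNIV. \<Sum>j\<in>UNIV. \<integral>x. f x * rot_field i j (rot_field i j g) x \<partial>sphere_measure)"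
    unfolding s ..
  also have "\<dots> = (\<integral>x. (\<Sum>i\<in>UNIV. \<Sum>j\<in>UNIV. f x * rot_field i j (rot_field i j g) x) \<partial>sphere_measure)"
    using c by (simp add: Bochner_Integration.integral_sum int cpoly_rot_field)
  also have "\<dots> = \<Lambda> l' * (\<integral>x. f x * g x \<partial>sphere_measure)"
  proof -
    have "(\<Sum>i\<in>UNIV. \<Sum>j\<in>UNIV. f x * rot_field i j (rot_field i j g) x) = f x * (\<Lambda> l' * g x)" for x
      unfolding \<Lambda>_def rot_field_casimir[OF g, symmetric] by (simp only: sum_distrib_left)
    then show ?thesis by (simp add: mult.left_commute)
  qed
  finally have "(\<Lambda> l - \<Lambda> l') * (\<integral>x. f x * g x \<partial>sphere_measure) = 0" by (simp add: algebra_simps)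
  moreover have "\<Lambda> l \<noteq> \<Lambda> l'"
  proof
    assume "\<Lambda> l = \<Lambda> l'"
    obtain k where k: "CARD('n) = k + 2" using le_Suc_ex[OF n] by (auto simp: add.commute)
    from \<open>\<Lambda> l = \<Lambda> l'\<close> have "(of_nat (l * (l + k)) :: complex) = of_nat (l' * (l' + k))" unfolding \<Lambda>_def k by simp
    then have e: "l * (l + k) = l' * (l' + k)" by (simp only: of_nat_eq_iff)
    have "a * (a + k) < b * (b + k)" if "a < b" for a b :: nat
    proof -
      have "a * (a + k) \<le> a * (b + k)" using that by (intro mult_left_mono) auto
      also have "\<dots> < b * (b + k)" using that by (intro mult_strict_right_mono) auto
      finally show ?thesis .
    qed
    from this[of l l'] this[of l' l] show False using ne e by linarith
  qed
  ultimately show ?thesis by simp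
qed

section \<open>The dimension of the space of spherical harmonics\<close>


lemma poly_eq_0_infinite:
  fixes p :: "complex poly"
  assumes "\<And>t::real. t > 0 \<Longrightarrow> poly p (of_real t) = 0"
  shows "p = 0"
proof (rule ccontr)
  assume "p \<noteq> 0"
  then have "finite {x. poly p x = 0}" by (rule poly_roots_finite)
  moreover have "complex_of_real ` {0<..} \<subseteq> {x. poly p x = 0}" using assms by auto
  ultimately have "finite (complex_of_real ` {0<..})" by (rule finite_subset[rotated])
  then have "finite {0::real<..}" by (rule finite_imageD) (simp add: inj_on_def)
  then show False using infinite_Ioi by blast
qed

lemma cpoly_line:
  assumes "cpoly f"
  shows "\<exists>P. \<forall>t. f (x + t *\<^sub>R v) = poly P (of_real t)"
  using assms
proof induction
  case (cpoly_const c)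
  show ?case by (intro exI[of _ "[:c:]"]) simp
next
  case (cpoly_coord i)
  show ?case by (intro exI[of _ "[:of_real (x $ i), of_real (v $ i):]"]) (simp add: mult.commute)
next
  case (cpoly_add f g)
  then obtain P Q where "\<And>t. f (x + t *\<^sub>R v) = poly P (of_real t)" "\<And>t. g (x + t *\<^sub>R v) = poly Q (of_real t)" by blast
  then show ?case by (intro exI[of _ "P + Q"]) simp
next
  case (cpoly_mult f g)
  then obtain P Q where "\<And>t. f (x + t *\<^sub>R v) = poly P (of_real t)" "\<And>t. g (x + t *\<^sub>R v) = poly Q (of_real t)" by blast
  then show ?case by (intro exI[of _ "P * Q"]) simp
qed

text \<open>For t > 0, f (x + t v) = t^l f (v + x / t). Thus P (t) = t^l Q (1/t) for the polynomial
  Q of the line with the roles of x and v exchanged, and comparison with the reversal of Q bounds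
  the degree of P. The hypothesis is restricted to t \<noteq> 0 in accordance with
  \<open>pd_homogeneous\<close>, which divides by t.\<close>

lemma homogeneous_line:
  assumes f: "cpoly f" and hom: "\<And>t x. t \<noteq> 0 \<Longrightarrow> f (t *\<^sub>R x) = of_real (t ^ l) * f x"
  shows "\<exists>P. degree P \<le> l \<and> (\<forall>t. f (x + t *\<^sub>R v) = poly P (of_real t))"
proof -
  obtain P where P: "\<And>t. f (x + t *\<^sub>R v) = poly P (of_real t)" using cpoly_line[OF f] by blast
  obtain Q where Q: "\<And>t. f (v + t *\<^sub>R x) = poly Q (of_real t)" using cpoly_line[OF f] by blast
  have "monom 1 (degree Q) * P - monom 1 l * reflect_poly Q = 0"
  proof (rule poly_eq_0_infinite)
    fix t :: real assume t: "t > 0"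
    have "poly P (of_real t) = f (t *\<^sub>R (v + inverse t *\<^sub>R x))"
      unfolding P[symmetric] using t by (simp add: scaleR_add_right add.commute)
    also have "\<dots> = of_real (t ^ l) * poly Q (of_real (inverse t))" using hom[of t] t Q by simp
    finally show "poly (monom 1 (degree Q) * P - monom 1 l * reflect_poly Q) (of_real t) = 0"
      using t by (simp add: poly_monom poly_reflect_poly_nz)
  qed
  then have e: "monom 1 (degree Q) * P = monom 1 l * reflect_poly Q" by simp
  have "degree P \<le> l"
  proof (cases "P = 0")
    case False
    then have "degree Q + degree P = degree (monom 1 (degree Q) * P)"
      by (subst degree_mult_eq) (auto simp: degree_monom_eq)
    also have "\<dots> \<le> degree (monom (1::complex) l) + degree (reflect_poly Q)"
      unfolding e by (rule degree_mult_le)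
    also have "\<dots> \<le> l + degree Q"
      using degree_reflect_poly_le[of Q] by (simp add: degree_monom_eq)
    finally show ?thesis by simp
  qed simp
  then show ?thesis using P by blast
qed

text \<open>A harmonic polynomial is determined by its Cauchy data on the hyperplane \<open>x $ i0 = 0\<close>, and these
  homogeneous polynomials are determined by their values on the grid.\<close>

definition grid :: "'n::finite \<Rightarrow> 'n \<Rightarrow> nat \<Rightarrow> (real^'n) set" where
  "grid i0 i1 l = (\<lambda>h. \<chi> i. if i = i0 then 0 else if i = i1 then 1 else real (h i)) ` (PiE (UNIV - {i0, i1}) (\<lambda>_. {..l}))"

lemma finite_grid: "finite (grid i0 i1 l)"
  unfolding grid_def by (intro finite_imageI finite_PiE) auto

lemma card_grid:
  fixes i0 i1 :: "'n::finite"
  assumes "i0 \<noteq> i1"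
  shows "card (grid i0 i1 l) \<le> (l + 1) ^ (CARD('n) - 2)"
proof -
  have "card (grid i0 i1 l) \<le> card (PiE (UNIV - {i0, i1}) (\<lambda>_. {..l}))"
    unfolding grid_def by (intro card_image_le finite_PiE) auto
  also have "\<dots> = (l + 1) ^ card (UNIV - {i0, i1})" by (subst card_PiE) auto
  also have "card (UNIV - {i0, i1}) = CARD('n) - 2" using assms by (subst card_Diff_subset) auto
  finally show ?thesis .
qed

lemma mem_grid:
  assumes "x $ i0 = 0" "x $ i1 = 1" "\<And>i. i \<noteq> i0 \<Longrightarrow> i \<noteq> i1 \<Longrightarrow> x $ i \<in> real ` {..l}" "i0 \<noteq> i1"
  shows "x \<in> grid i0 i1 l"
proof -
  define h where "h = restrict (\<lambda>i. nat \<lfloor>x $ i\<rfloor>) (UNIV - {i0, i1})"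
  have r: "x $ i = real (nat \<lfloor>x $ i\<rfloor>) \<and> nat \<lfloor>x $ i\<rfloor> \<le> l" if "i \<noteq> i0" "i \<noteq> i1" for i
    using assms(3)[OF that] by auto
  have "h \<in> PiE (UNIV - {i0, i1}) (\<lambda>_. {..l})" using r by (auto simp: h_def)
  moreover have "x = (\<chi> i. if i = i0 then 0 else if i = i1 then 1 else real (h i))"
    using assms r by (auto simp: vec_eq_iff h_def)
  ultimately show ?thesis unfolding grid_def by blast
qed

lemma poly_zero_on_grid:
  fixes P :: "complex poly"
  assumes "degree P \<le> l" "\<And>k. k \<le> l \<Longrightarrow> poly P (of_nat k) = 0"
  shows "P = 0"
proof (rule ccontr)
  assume "P \<noteq> 0"
  have "card (of_nat ` {..l} :: complex set) \<le> card {x. poly P x = 0}"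
    using assms(2) \<open>P \<noteq> 0\<close> by (intro card_mono poly_roots_finite) auto
  moreover have "card (of_nat ` {..l} :: complex set) = l + 1" by (subst card_image) (auto simp: inj_on_def)
  moreover have "card {x. poly P x = 0} \<le> degree P" using \<open>P \<noteq> 0\<close> by (rule card_poly_roots_bound)
  ultimately show False using assms(1) by simp
qed

text \<open>The coordinates other than i0 and i1 are freed from the grid one at a time: along each
  axis f is a polynomial of degree at most d \<le> l with l + 1 zeros. Scaling then passes from x $
  i1 = 1 to every nonzero value, and for the value 0 a polynomial in this coordinate that vanishes
  at all positive arguments is zero.\<close>

lemma vanish_on_grid:
  fixes f :: "real^'n \<Rightarrow> complex"
  assumes f: "cpoly f" and hom: "\<And>t x. t \<noteq> 0 \<Longrightarrow> f (t *\<^sub>R x) = of_real (t ^ d) * f x" and d: "d \<le> l"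
    and ne: "i0 \<noteq> i1" and z: "\<And>x. x \<in> grid i0 i1 l \<Longrightarrow> f x = 0" and x0: "x $ i0 = 0"
  shows "f x = 0"
proof -
  have J: "\<forall>x. x $ i0 = 0 \<longrightarrow> x $ i1 = 1 \<longrightarrow> (\<forall>i. i \<notin> J \<longrightarrow> i \<noteq> i0 \<longrightarrow> i \<noteq> i1 \<longrightarrow> x $ i \<in> real ` {..l}) \<longrightarrow> f x = 0"
    if "finite J" "J \<inter> {i0, i1} = {}" for J
    using that
  proof (induction J)
    case empty
    show ?case using z mem_grid[OF _ _ _ ne] by blast
  next
    case (insert j J)
    show ?case
    proof (intro allI impI)
      fix x :: "real^'n" assume x: "x $ i0 = 0" "x $ i1 = 1" "\<forall>i. i \<notin> insert j J \<longrightarrow> i \<noteq> i0 \<longrightarrow> i \<noteq> i1 \<longrightarrow> x $ i \<in> real ` {..l}"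
      have j: "j \<noteq> i0" "j \<noteq> i1" using insert.prems by auto
      define y where "y = x - (x $ j) *\<^sub>R axis j 1"
      obtain P where P: "degree P \<le> d" "\<And>t. f (y + t *\<^sub>R axis j 1) = poly P (of_real t)"
        using homogeneous_line[OF f hom] by blast
      have "P = 0"
      proof (rule poly_zero_on_grid)
        show "degree P \<le> l" using P(1) d by simp
        fix k assume k: "k \<le> l"
        have "f (y + real k *\<^sub>R axis j 1) = 0"
        proof -
          let ?w = "y + real k *\<^sub>R axis j 1"
          have "?w $ i = (if i = j then real k else x $ i)" for i by (simp add: y_def axis_def)
          then show ?thesis using insert.IH insert.prems x j k by (auto simp: insert_iff)
        qed
        then show "poly P (of_nat k) = 0" using P(2)[of "real k"] by simp
      qed
      moreover have "x = y + (x $ j) *\<^sub>R axis j 1" by (simp add: y_def)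
      ultimately show "f x = 0" using P(2)[of "x $ j"] by simp
    qed
  qed
  have 1: "f x = 0" if "x $ i0 = 0" "x $ i1 = 1" for x
    using J[of "UNIV - {i0, i1}"] that by auto
  have 2: "f x = 0" if "x $ i0 = 0" "x $ i1 \<noteq> 0" for x
    using hom[of "x $ i1" "inverse (x $ i1) *\<^sub>R x"] 1[of "inverse (x $ i1) *\<^sub>R x"] that by simp
  obtain P where P: "\<And>t. f (x - (x $ i1) *\<^sub>R axis i1 1 + t *\<^sub>R axis i1 1) = poly P (of_real t)"
    using cpoly_line[OF f] by blast
  have "P = 0"
  proof (rule poly_eq_0_infinite)
    fix t :: real assume "t > 0"
    then show "poly P (of_real t) = 0" unfolding P[symmetric] using x0 ne by (intro 2) (auto simp: axis_def)
  qed
  then show ?thesis using P[of "x $ i1"] by simp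
qed

lemma cpoly_pd_iter: "cpoly f \<Longrightarrow> cpoly ((pd i ^^ m) f)"
  by (induction m) (auto intro: cpoly_pd)

lemma pd_vanish_hyperplane:
  assumes "\<And>x. x $ i0 = 0 \<Longrightarrow> g x = 0" "i \<noteq> i0" "x $ i0 = 0"
  shows "pd i g x = 0"
proof -
  have "(\<lambda>t. g (x + t *\<^sub>R axis i 1)) = (\<lambda>t. 0)"
    using assms by (intro ext assms(1)) (auto simp: axis_def)
  then show ?thesis by (simp add: pd_def)
qed

lemma harmonic_pd:
  assumes "cpoly f" "\<And>x. (\<Sum>i\<in>UNIV. pd i (pd i f) x) = 0"
  shows "(\<Sum>i\<in>UNIV. pd i (pd i (pd k f)) x) = 0"
proof -
  have "pd i (pd i (pd k f)) = pd k (pd i (pd i f))" for i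
    using assms(1) pd_commute cpoly_pd by metis
  then have "(\<Sum>i\<in>UNIV. pd i (pd i (pd k f)) x) = pd k (\<lambda>x. \<Sum>i\<in>UNIV. pd i (pd i f) x) x"
    using assms(1) by (subst pd_sum) (auto intro!: cpoly_pd)
  then show ?thesis unfolding assms(2) by (simp add: pd_const)
qed

lemma pd_iter_line:
  assumes "cpoly f" "\<And>t. f (x + t *\<^sub>R axis i 1) = poly P (of_real t)"
  shows "(pd i ^^ m) f (x + t *\<^sub>R axis i 1) = poly ((pderiv ^^ m) P) (of_real t)"
proof (induction m arbitrary: t)
  case 0
  show ?case using assms(2) by simp
next
  case (Suc m)
  let ?g = "(pd i ^^ m) f" and ?Q = "(pderiv ^^ m) P"
  have "((\<lambda>s. ?g (x + s *\<^sub>R axis i 1)) has_vector_derivative pd i ?g (x + t *\<^sub>R axis i 1)) (at t)"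
    by (rule has_grad_axis[OF cpoly_has_grad[OF cpoly_pd_iter[OF assms(1)]]])
  moreover have "((\<lambda>s. poly ?Q (of_real s)) has_vector_derivative poly (pderiv ?Q) (of_real t)) (at t)"
    by (rule has_vector_derivative_real_field) (rule poly_DERIV)
  ultimately show ?case unfolding Suc.IH using vector_derivative_unique_at by fastforce
qed

text \<open>On the hyperplane the Laplace equation expresses the second normal derivative by
  tangential ones. Every normal derivative of f is harmonic too, so by induction all of them vanish
  there, and hence so do all coefficients of f along the axis i0.\<close>

lemma harmonic_cauchy_uniqueness:
  assumes f: "cpoly f" and harm: "\<And>x. (\<Sum>i\<in>UNIV. pd i (pd i f) x) = 0"
    and z: "\<And>x. x $ i0 = 0 \<Longrightarrow> f x = 0" "\<And>x. x $ i0 = 0 \<Longrightarrow> pd i0 f x = 0"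
  shows "f x = 0"
proof -
  let ?D = "\<lambda>m. (pd i0 ^^ m) f"
  have h: "(\<Sum>i\<in>UNIV. pd i (pd i (?D m)) x) = 0" for m x
    by (induction m arbitrary: x) (auto intro!: harm harmonic_pd cpoly_pd_iter f)
  have "(\<forall>x. x $ i0 = 0 \<longrightarrow> ?D m x = 0) \<and> (\<forall>x. x $ i0 = 0 \<longrightarrow> ?D (Suc m) x = 0)" for m
  proof (induction m)
    case 0
    then show ?case using z by simp
  next
    case (Suc m)
    have "?D (Suc (Suc m)) x = 0" if x: "x $ i0 = 0" for x
    proof -
      have "pd i (pd i (?D m)) x = 0" if i: "i \<noteq> i0" for i
        using Suc.IH i x by (intro pd_vanish_hyperplane[of i0 "pd i (?D m)"] pd_vanish_hyperplane[of i0 "?D m"]) auto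
      then have "(\<Sum>i\<in>UNIV. pd i (pd i (?D m)) x) = pd i0 (pd i0 (?D m)) x"
        by (subst sum.remove[of _ i0]) auto
      then show ?thesis using h[of m x] by simp
    qed
    then show ?case using Suc.IH by blast
  qed
  then have D0: "?D m x = 0" if "x $ i0 = 0" for m x using that by blast
  define y where "y = x - (x $ i0) *\<^sub>R axis i0 1"
  have y: "y $ i0 = 0" by (simp add: y_def axis_def)
  obtain P where P: "\<And>t. f (y + t *\<^sub>R axis i0 1) = poly P (of_real t)" using cpoly_line[OF f] by blast
  have "poly ((pderiv ^^ m) P) 0 = 0" for m
    using pd_iter_line[OF f P, of m 0] D0[OF y] by simp
  then have "coeff P m = 0" for m
    by (simp add: poly_0_coeff_0 coeff_higher_pderiv pochhammer_fact[symmetric])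
  then have "P = 0" by (simp add: poly_eq_iff)
  then show ?thesis using P[of "x $ i0"] by (simp add: y_def)
qed

text \<open>After restriction to X the functions lie in the span of the unit functions at the points
  of X. The case of a family that is not injective is separate because dependence is a notion for
  sets, which forget repetitions; there two equal members give the relation directly.\<close>

lemma exists_linear_relation:
  fixes F :: "'i \<Rightarrow> 'b \<Rightarrow> complex"
  assumes I: "finite I" and X: "finite X" and c: "card X < card I"
  shows "\<exists>a. (\<exists>i\<in>I. a i \<noteq> 0) \<and> (\<forall>x\<in>X. (\<Sum>i\<in>I. a i * F i x) = 0)"
proof -
  define F' where "F' i x = (if x \<in> X then F i x else 0)" for i x
  define \<delta> where "\<delta> y x = (if x = y then 1 else 0 :: complex)" for x y :: 'b
  have F': "F' i \<in> cspan (\<delta> ` X)" for i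
  proof -
    have "F' i = (\<lambda>x. \<Sum>y\<in>X. F i y * \<delta> y x)"
      using X by (auto simp: F'_def \<delta>_def fun_eq_iff if_distrib[of "\<lambda>c. _ * c"] cong: if_cong)
    then show ?thesis using sum_mem_cspan[OF X] by metis
  qed
  show ?thesis
  proof (cases "inj_on F' I")
    case False
    then obtain i j where ij: "i \<in> I" "j \<in> I" "i \<noteq> j" "F' i = F' j" by (auto simp: inj_on_def)
    let ?a = "\<lambda>k. if k = i then 1 else if k = j then -1 else 0 :: complex"
    have "(\<Sum>k\<in>I. ?a k * F k x) = 0" if "x \<in> X" for x
    proof -
      have "(\<Sum>k\<in>I. ?a k * F k x) = (\<Sum>k\<in>{i, j}. ?a k * F k x)"
        using I ij by (intro sum.mono_neutral_right) auto
      also have "\<dots> = F' i x - F' j x" using ij(3) that by (simp add: F'_def)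
      finally show ?thesis using ij(4) by simp
    qed
    then show ?thesis using ij by (intro exI[of _ ?a]) auto
  next
    case inj: True
    have "cfun.dependent (F' ` I)"
    proof (rule ccontr)
      assume "\<not> cfun.dependent (F' ` I)"
      then have "card (F' ` I) \<le> card (\<delta> ` X)"
        using X F' by (intro cfun.independent_span_bound[THEN conjunct2]) auto
      also have "\<dots> \<le> card X" using X by (rule card_image_le)
      finally show False using c card_image[OF inj] by simp
    qed
    then obtain u v where uv: "v \<in> F' ` I" "u v \<noteq> 0" "(\<Sum>w\<in>F' ` I. (\<lambda>x. u w * w x)) = 0"
      using I by (auto simp: cfun.dependent_finite)
    have "(\<Sum>i\<in>I. u (F' i) * F i x) = 0" if "x \<in> X" for x
    proof -
      have "(\<Sum>w\<in>F' ` I. (\<lambda>x. u w * w x)) x = 0" unfolding uv(3) by simp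
      then show ?thesis unfolding sum_fun_apply sum.reindex[OF inj] using that by (simp add: F'_def)
    qed
    then show ?thesis using uv by (intro exI[of _ "\<lambda>i. u (F' i)"]) auto
  qed
qed

lemma solid_harmonic_sum:
  assumes "finite I" "\<And>i. i \<in> I \<Longrightarrow> solid_harmonic l (f i)"
  shows "solid_harmonic l (\<lambda>x. \<Sum>i\<in>I. a i * f i x)"
proof -
  have c: "cpoly (f i)" if "i \<in> I" for i using assms(2)[OF that] by (simp add: solid_harmonic_def)
  have c2: "cpoly (\<lambda>x. a i * f i x)" if "i \<in> I" for i by (intro cpoly_mult cpoly_const c that)
  have p: "pd k (\<lambda>x. a i * f i x) = (\<lambda>x. a i * pd k (f i) x)" if "i \<in> I" for i k
    using pd_mult[OF cpoly_const c[OF that]] by (simp add: pd_const)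
  have p2: "pd k (\<lambda>x. a i * pd k (f i) x) = (\<lambda>x. a i * pd k (pd k (f i)) x)" if "i \<in> I" for i k
    using pd_mult[OF cpoly_const cpoly_pd[OF c[OF that]]] by (simp add: pd_const)
  have "pd k (pd k (\<lambda>x. \<Sum>i\<in>I. a i * f i x)) x = (\<Sum>i\<in>I. a i * pd k (pd k (f i)) x)" for k x
  proof -
    have "pd k (\<lambda>x. \<Sum>i\<in>I. a i * f i x) = (\<lambda>x. \<Sum>i\<in>I. a i * pd k (f i) x)"
      using pd_sum[OF assms(1) c2] p by (simp cong: sum.cong)
    moreover have "pd k (\<lambda>x. \<Sum>i\<in>I. a i * pd k (f i) x) = (\<lambda>x. \<Sum>i\<in>I. a i * pd k (pd k (f i)) x)"
      using pd_sum[OF assms(1), of "\<lambda>i x. a i * pd k (f i) x" k] p2 c by (simp add: cpoly_mult cpoly_const cpoly_pd cong: sum.cong)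
    ultimately show ?thesis by simp
  qed
  then have "(\<Sum>k\<in>UNIV. pd k (pd k (\<lambda>x. \<Sum>i\<in>I. a i * f i x)) x) = (\<Sum>i\<in>I. a i * (\<Sum>k\<in>UNIV. pd k (pd k (f i)) x))" for x
    by (simp add: sum_distrib_left sum.swap[of _ UNIV])
  moreover have "homogeneous l (\<lambda>x. \<Sum>i\<in>I. a i * f i x)"
    using assms(2) by (auto simp: solid_harmonic_def homogeneous_def sum_distrib_left mult_ac intro!: sum.cong)
  ultimately show ?thesis
    using assms(2) cpoly_sum[OF c2] by (simp add: solid_harmonic_def)
qed

text \<open>Differentiate f (t (x + s e_i)) = t^l f (x + s e_i) at s = 0 and divide by t. For l = 0
  the truncated exponent does no harm, as f is constant.\<close>

lemma pd_homogeneous: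
  assumes f: "cpoly f" "homogeneous l f" and t: "t \<noteq> 0"
  shows "pd i f (t *\<^sub>R x) = of_real (t ^ (l - 1)) * pd i f x"
proof (cases l)
  case 0
  have "f y = f 0" for y using f(2)[unfolded homogeneous_def, rule_format, of 0 y] 0 by simp
  then have "f = (\<lambda>_. f 0)" by (rule ext)
  then have "pd i f = (\<lambda>x. 0)" using pd_const[of i "f 0"] by metis
  then show ?thesis by simp
next
  case (Suc m)
  have A: "((\<lambda>s. f (t *\<^sub>R x + s *\<^sub>R (t *\<^sub>R axis i 1))) has_vector_derivative
      (\<Sum>k\<in>UNIV. of_real ((t *\<^sub>R axis i 1 :: real^'a) $ k) * pd k f (t *\<^sub>R x + 0 *\<^sub>R (t *\<^sub>R axis i 1)))) (at 0)"
    by (rule has_grad_line[OF cpoly_has_grad[OF f(1)]])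
  have B: "(\<Sum>k\<in>UNIV. of_real ((t *\<^sub>R axis i 1 :: real^'a) $ k) * pd k f (t *\<^sub>R x + 0 *\<^sub>R (t *\<^sub>R axis i 1))) = of_real t * pd i f (t *\<^sub>R x)"
    by (simp add: mult.assoc sum_distrib_left[symmetric] sum_axis)
  have C: "((\<lambda>s. of_real (t ^ l) * f (x + s *\<^sub>R axis i 1)) has_vector_derivative of_real (t ^ l) * pd i f (x + 0 *\<^sub>R axis i 1)) (at 0)"
    by (intro has_vector_derivative_mult_right has_grad_axis[OF cpoly_has_grad[OF f(1)]])
  have D: "(\<lambda>s. f (t *\<^sub>R x + s *\<^sub>R (t *\<^sub>R axis i 1))) = (\<lambda>s. of_real (t ^ l) * f (x + s *\<^sub>R axis i 1))"
  proof
    fix s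
    have "t *\<^sub>R x + s *\<^sub>R (t *\<^sub>R axis i 1) = t *\<^sub>R (x + s *\<^sub>R axis i 1)" by (simp add: scaleR_add_right mult.commute)
    then show "f (t *\<^sub>R x + s *\<^sub>R (t *\<^sub>R axis i 1)) = of_real (t ^ l) * f (x + s *\<^sub>R axis i 1)"
      using f(2) by (simp add: homogeneous_def)
  qed
  have "of_real t * pd i f (t *\<^sub>R x) = of_real (t ^ l) * pd i f (x + 0 *\<^sub>R axis i 1)"
    by (rule vector_derivative_unique_at[OF A[unfolded B D] C])
  then show ?thesis using t Suc by simp
qed


section \<open>Dimension bound, rotation invariance and orthogonality of the harmonics\<close>

lemma spherical_harmonics_bounded_measurable:
  fixes f :: "real^'n \<Rightarrow> complex"
  assumes "f \<in> spherical_harmonics l"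
  shows "bounded_measurable sphere_measure f"
proof -
  obtain p where p: "solid_harmonic l p" "f = (\<lambda>\<omega>. if \<omega> \<in> sphere 0 1 then p \<omega> else 0)"
    using spherical_harmonicsE[OF assms] by blast
  have "bounded_measurable sphere_measure p" using p(1) by (auto simp: solid_harmonic_def intro: cpoly_bounded_measurable)
  moreover have "f \<in> borel_measurable sphere_measure \<longleftrightarrow> p \<in> borel_measurable sphere_measure"
    by (rule measurable_cong) (simp add: p(2))
  ultimately show ?thesis by (auto simp: bounded_measurable_def p(2))
qed

lemma orthonormal_basis_mem:
  assumes "orthonormal_basis M I e V" "i \<in> I"
  shows "e i \<in> V"
  using assms unfolding orthonormal_basis_def by (metis cfun.span_base imageI)

text \<open>The factor 2 stands for the two Cauchy data on the hyperplane, selected in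
  \<open>?F\<close> by a Boolean, and the power is the size of the grid. With more basis elements
  than data, some nontrivial combination has zero data on the grid, hence zero Cauchy data, hence is
  zero, against orthonormality.\<close>

lemma harmonics_dim_le:
  fixes Y :: "nat \<Rightarrow> real^'n \<Rightarrow> complex"
  assumes Y: "orthonormal_basis sphere_measure {1..harmonics_dim TYPE(real^'n) l} Y (spherical_harmonics l)"
    and n: "CARD('n) \<ge> 2"
  shows "harmonics_dim TYPE(real^'n) l \<le> 2 * (l + 1) ^ (CARD('n) - 2)"
proof (rule ccontr)
  let ?d = "harmonics_dim TYPE(real^'n) l"
  assume *: "\<not> ?d \<le> 2 * (l + 1) ^ (CARD('n) - 2)"
  obtain i0 i1 :: 'n where ne: "i0 \<noteq> i1"
    using n card_le_Suc0_iff_eq[of "UNIV :: 'n set"] by (auto simp: not_le[symmetric])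
  have "\<exists>y. solid_harmonic l y \<and> Y p = (\<lambda>\<omega>. if \<omega> \<in> sphere 0 1 then y \<omega> else 0)" if "p \<in> {1..?d}" for p
    using spherical_harmonicsE[OF orthonormal_basis_mem[OF Y that]] by metis
  then obtain y where y: "\<And>p. p \<in> {1..?d} \<Longrightarrow> solid_harmonic l (y p)"
      "\<And>p. p \<in> {1..?d} \<Longrightarrow> Y p = (\<lambda>\<omega>. if \<omega> \<in> sphere 0 1 then y p \<omega> else 0)" by metis
  let ?X = "grid i0 i1 l \<times> (UNIV :: bool set)"
  let ?F = "\<lambda>p (x, b). if b then y p x else pd i0 (y p) x"
  have X: "finite ?X" by (intro finite_cartesian_product finite_grid) simp
  have "card ?X = 2 * card (grid i0 i1 l)" by (simp add: card_cartesian_product)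
  also have "\<dots> \<le> 2 * (l + 1) ^ (CARD('n) - 2)" using card_grid[OF ne, of l] by simp
  also have "\<dots> < card {1..?d}" using * by simp
  finally have "card ?X < card {1..?d}" .
  then obtain a where a: "\<exists>p\<in>{1..?d}. a p \<noteq> 0" "\<forall>x\<in>?X. (\<Sum>p\<in>{1..?d}. a p * ?F p x) = 0"
    using exists_linear_relation[of "{1..?d}" ?X ?F] X by blast
  define q where "q x = (\<Sum>p\<in>{1..?d}. a p * y p x)" for x
  have q: "solid_harmonic l q" unfolding q_def[abs_def] by (intro solid_harmonic_sum y) auto
  have qc: "cpoly q" and qh: "homogeneous l q" and qharm: "\<And>x. (\<Sum>i\<in>UNIV. pd i (pd i q) x) = 0"
    using q by (auto simp: solid_harmonic_def)
  have pdq: "pd i0 q = (\<lambda>x. \<Sum>p\<in>{1..?d}. a p * pd i0 (y p) x)"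
  proof -
    have c: "cpoly (y p)" if "p \<in> {1..?d}" for p using y(1)[OF that] by (simp add: solid_harmonic_def)
    have "pd i0 q = (\<lambda>x. \<Sum>p\<in>{1..?d}. pd i0 (\<lambda>x. a p * y p x) x)"
      unfolding q_def[abs_def] by (intro pd_sum cpoly_mult cpoly_const c) auto
    also have "\<dots> = (\<lambda>x. \<Sum>p\<in>{1..?d}. a p * pd i0 (y p) x)"
      by (intro ext sum.cong refl) (simp add: pd_mult[OF cpoly_const c] pd_const)
    finally show ?thesis .
  qed
  have "q x = 0" for x
  proof (rule harmonic_cauchy_uniqueness[OF qc qharm])
    fix x :: "real^'n" assume x: "x $ i0 = 0"
    show "q x = 0"
    proof (rule vanish_on_grid[OF qc _ order_refl ne _ x])
      show "q (t *\<^sub>R x) = of_real (t ^ l) * q x" for t x using qh by (simp add: homogeneous_def)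
      show "q x = 0" if "x \<in> grid i0 i1 l" for x
        using bspec[OF a(2), of "(x, True)"] that by (simp add: q_def)
    qed
    show "pd i0 q x = 0"
    proof (rule vanish_on_grid[OF cpoly_pd[OF qc] pd_homogeneous[OF qc qh] _ ne _ x])
      show "pd i0 q x = 0" if "x \<in> grid i0 i1 l" for x
        using bspec[OF a(2), of "(x, False)"] that by (simp add: pdq)
    qed auto
  qed
  then have "(\<Sum>p\<in>{1..?d}. a p * Y p x) = 0" if "x \<in> space sphere_measure" for x
  proof -
    have "(\<Sum>p\<in>{1..?d}. a p * Y p x) = q x" unfolding q_def using that y(2) by (intro sum.cong) auto
    then show ?thesis using \<open>\<And>x. q x = 0\<close> by simp
  qed
  moreover have "L2_inner sphere_measure (Y i) (Y j) = (if i = j then 1 else 0)" if "i \<in> {1..?d}" "j \<in> {1..?d}" for i j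
    using Y that unfolding orthonormal_basis_def by blast
  moreover have "bounded_measurable sphere_measure (Y i)" if "i \<in> {1..?d}" for i
    by (rule spherical_harmonics_bounded_measurable[OF orthonormal_basis_mem[OF Y that]])
  ultimately have "a p = 0" if "p \<in> {1..?d}" for p
    using sphere.orthonormal_independent[of "{1..?d}" Y a p] that by blast
  then show False using a(1) by blast
qed

text \<open>By the chain rule the second derivatives are contracted with the matrix of T times its
  transpose, which is the identity (\<open>orth\<close>).\<close>

lemma solid_harmonic_orthogonal_comp:
  fixes T :: "real^'n \<Rightarrow> real^'n"
  assumes T: "orthogonal_transformation T" and p: "solid_harmonic l p"
  shows "solid_harmonic l (\<lambda>x. p (T x))"
proof -
  have lin: "linear T" using T by (rule orthogonal_transformation_linear)
  then have bl: "bounded_linear T" by (simp add: linear_conv_bounded_linear)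
  have pc: "cpoly p" using p by (simp add: solid_harmonic_def)
  let ?a = "\<lambda>i k. complex_of_real (T (axis i 1) $ k)"
  have comp: "cpoly (\<lambda>x. f (T x))" if "cpoly f" for f
    using that
  proof induction
    case (cpoly_coord i)
    have "bounded_linear (\<lambda>x. T x $ i)" by (rule bounded_linear_compose[OF bounded_linear_vec_nth bl])
    then show ?case by (intro real_polynomial_function_cpoly real_polynomial_function.intros(1))
  qed (auto intro: cpoly.intros)
  have grad: "has_grad (\<lambda>x. f (T x)) (\<lambda>i x. \<Sum>k\<in>UNIV. ?a i k * pd k f (T x))" if f: "cpoly f" for f
    unfolding has_grad_def
  proof
    fix x
    have "(f has_derivative (\<lambda>v. \<Sum>k\<in>UNIV. of_real (v $ k) * pd k f (T x))) (at (T x))"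
      using cpoly_has_grad[OF f] by (simp add: has_grad_def)
    from diff_chain_at[OF bounded_linear_imp_has_derivative[OF bl] this]
    have A: "((\<lambda>x. f (T x)) has_derivative (\<lambda>v. \<Sum>k\<in>UNIV. of_real (T v $ k) * pd k f (T x))) (at x)" by (simp only: o_def)
    have B: "(\<Sum>k\<in>UNIV. of_real (T v $ k) * pd k f (T x)) = (\<Sum>i\<in>UNIV. of_real (v $ i) * (\<Sum>k\<in>UNIV. ?a i k * pd k f (T x)))" for v
    proof -
      have "T v = T (\<Sum>i\<in>UNIV. v $ i *\<^sub>R axis i 1)" using basis_expansion[of v] by (simp add: scalar_mult_eq_scaleR)
      also have "\<dots> = (\<Sum>i\<in>UNIV. v $ i *\<^sub>R T (axis i 1))" using lin by (simp add: linear_sum linear_scale)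
      finally have "complex_of_real (T v $ k) = (\<Sum>i\<in>UNIV. of_real (v $ i) * ?a i k)" for k by simp
      then show ?thesis
        by (simp add: sum_distrib_left sum_distrib_right mult.assoc) (rule sum.swap)
    qed
    show "((\<lambda>x. f (T x)) has_derivative (\<lambda>v. \<Sum>i\<in>UNIV. of_real (v $ i) * (\<Sum>k\<in>UNIV. ?a i k * pd k f (T x)))) (at x)"
      by (rule has_derivative_eq_rhs[OF A ext[OF B]])
  qed
  have pdT: "pd i (\<lambda>x. f (T x)) = (\<lambda>x. \<Sum>k\<in>UNIV. ?a i k * pd k f (T x))" if "cpoly f" for f i
    using has_grad_pd[OF grad[OF that]] .
  have pd2: "pd i (pd i (\<lambda>x. p (T x))) x = (\<Sum>k\<in>UNIV. \<Sum>m\<in>UNIV. ?a i k * ?a i m * pd m (pd k p) (T x))" for i x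
  proof -
    have c: "cpoly (\<lambda>x. pd k p (T x))" for k by (intro comp cpoly_pd pc)
    have "pd i (pd i (\<lambda>x. p (T x))) = (\<lambda>x. \<Sum>k\<in>UNIV. pd i (\<lambda>x. ?a i k * pd k p (T x)) x)"
      unfolding pdT[OF pc] by (intro pd_sum cpoly_mult cpoly_const c) auto
    also have "\<dots> = (\<lambda>x. \<Sum>k\<in>UNIV. ?a i k * pd i (\<lambda>x. pd k p (T x)) x)"
      using pd_mult[OF cpoly_const c] by (simp add: pd_const)
    finally show ?thesis using pdT[OF cpoly_pd[OF pc]] by (simp add: sum_distrib_left mult.assoc)
  qed
  have orth: "(\<Sum>i\<in>UNIV. ?a i k * ?a i m) = (if k = m then 1 else 0)" for k m
  proof -
    have "orthogonal_matrix (matrix T)" using T by (simp add: orthogonal_transformation_matrix)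
    then have "matrix T ** transpose (matrix T) = mat 1" by (simp add: orthogonal_matrix_def)
    then have "(matrix T ** transpose (matrix T)) $ k $ m = (mat 1 :: real^'n^'n) $ k $ m" by simp
    then have "(\<Sum>i\<in>UNIV. T (axis i 1) $ k * T (axis i 1) $ m) = (if k = m then 1 else 0)"
      by (simp add: matrix_matrix_mult_def transpose_def matrix_def mat_def)
    then have "complex_of_real (\<Sum>i\<in>UNIV. T (axis i 1) $ k * T (axis i 1) $ m) = of_real (if k = m then 1 else 0)" by simp
    then show ?thesis by (simp split: if_splits)
  qed
  have "(\<Sum>i\<in>UNIV. pd i (pd i (\<lambda>x. p (T x))) x) = 0" for x
  proof -
    have "(\<Sum>i\<in>UNIV. pd i (pd i (\<lambda>x. p (T x))) x)
      = (\<Sum>i\<in>UNIV. \<Sum>k\<in>UNIV. \<Sum>m\<in>UNIV. ?a i k * ?a i m * pd m (pd k p) (T x))" unfolding pd2 ..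
    also have "\<dots> = (\<Sum>k\<in>UNIV. \<Sum>i\<in>UNIV. \<Sum>m\<in>UNIV. ?a i k * ?a i m * pd m (pd k p) (T x))"
      by (rule sum.swap)
    also have "\<dots> = (\<Sum>k\<in>UNIV. \<Sum>m\<in>UNIV. \<Sum>i\<in>UNIV. ?a i k * ?a i m * pd m (pd k p) (T x))"
      by (intro sum.cong refl sum.swap)
    also have "\<dots> = (\<Sum>k\<in>UNIV. \<Sum>m\<in>UNIV. (if k = m then 1 else 0) * pd m (pd k p) (T x))"
      unfolding sum_distrib_right[symmetric] orth ..
    also have "\<dots> = (\<Sum>k\<in>UNIV. pd k (pd k p) (T x))"
      by (simp add: if_distrib[of "\<lambda>c. c * _"] cong: if_cong)
    also have "\<dots> = 0" using p by (simp add: solid_harmonic_def)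
    finally show ?thesis .
  qed
  moreover have "homogeneous l (\<lambda>x. p (T x))"
    using p T by (simp add: solid_harmonic_def homogeneous_def orthogonal_transformation_scaleR)
  ultimately show ?thesis using comp[OF pc] by (simp add: solid_harmonic_def)
qed

lemma spherical_harmonics_comp:
  fixes T :: "real^'n \<Rightarrow> real^'n"
  assumes T: "orthogonal_transformation T" and f: "f \<in> spherical_harmonics l"
  shows "(\<lambda>x. f (T x)) \<in> spherical_harmonics l"
proof -
  obtain p where p: "solid_harmonic l p" "f = (\<lambda>\<omega>. if \<omega> \<in> sphere 0 1 then p \<omega> else 0)" "polynomial_function p"
    using spherical_harmonicsE[OF f] by blast
  have "bounded_linear T" using orthogonal_transformation_linear[OF T] by (simp add: linear_conv_bounded_linear)
  then have "polynomial_function (p \<circ> T)" by (intro polynomial_function_compose polynomial_function_bounded_linear p)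
  then have "polynomial_function (\<lambda>x. p (T x))" by (simp add: o_def)
  from spherical_harmonicsI[OF solid_harmonic_orthogonal_comp[OF T p(1)] this] show ?thesis
    using T by (simp add: p(2) orthogonal_transformation_norm)
qed

theorem spherical_harmonics_kernel_bound:
  fixes Y :: "nat \<Rightarrow> nat \<Rightarrow> real^'n \<Rightarrow> complex"
  assumes Y: "\<And>l. orthonormal_basis sphere_measure {1..harmonics_dim TYPE(real^'n) l} (Y l) (spherical_harmonics l)"
    and n: "CARD('n) \<ge> 2"
  shows "\<exists>C>0. \<forall>l \<omega>. kernel_diag {1..harmonics_dim TYPE(real^'n) l} (Y l) \<omega> \<le> C * (real l + 1) ^ (CARD('n) - 2)"
proof -
  let ?m = "measure (sphere_measure :: (real^'n) measure) (sphere 0 1)"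
  have m: "?m > 0" by (rule measure_sphere_pos)
  have "kernel_diag {1..harmonics_dim TYPE(real^'n) l} (Y l) \<omega> \<le> 2 / ?m * (real l + 1) ^ (CARD('n) - 2)" for l \<omega>
  proof -
    let ?d = "harmonics_dim TYPE(real^'n) l" and ?K = "kernel_diag {1..harmonics_dim TYPE(real^'n) l} (Y l)"
    have bm: "bounded_measurable sphere_measure (Y l i)" if "i \<in> {1..?d}" for i
      by (rule spherical_harmonics_bounded_measurable[OF orthonormal_basis_mem[OF Y that]])
    \<comment> \<open>Composition with T maps the harmonics of degree l to themselves and preserves
      their norms, so the description of the kernel as the squared norm of evaluation gives this
      without computing how T acts on the basis.\<close>
    have inv: "?K (T z) \<le> ?K z" if T: "orthogonal_transformation T" for T z
    proof (rule sphere.kernel_diag_leI[OF Y bm kernel_diag_nonneg])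
      fix f :: "real^'n \<Rightarrow> complex" assume f: "f \<in> spherical_harmonics l"
      have fb: "bounded_measurable sphere_measure (\<lambda>x. f x * cnj (f x))"
        by (intro bounded_measurable_intros spherical_harmonics_bounded_measurable[OF f])
      have "(cmod (f (T z)))\<^sup>2 \<le> ?K z * Re (L2_inner sphere_measure (\<lambda>x. f (T x)) (\<lambda>x. f (T x)))"
        by (rule sphere.pointwise_bound[OF Y bm spherical_harmonics_comp[OF T f]])
      also have "L2_inner sphere_measure (\<lambda>x. f (T x)) (\<lambda>x. f (T x)) = L2_inner sphere_measure f f"
        unfolding L2_inner_def using fb by (intro integral_sphere_orthogonal[OF T, of "\<lambda>x. f x * cnj (f x)"]) (simp add: bounded_measurable_def)
      finally show "(cmod (f (T z)))\<^sup>2 \<le> ?K z * Re (L2_inner sphere_measure f f)" .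
    qed
    show ?thesis
    proof (cases "\<omega> \<in> sphere 0 1")
      case False
      have "Y l i \<omega> = 0" if "i \<in> {1..?d}" for i
        using spherical_harmonicsE[OF orthonormal_basis_mem[OF Y that]] False by (metis (mono_tags))
      then have "?K \<omega> = 0" by (simp add: kernel_diag_def)
      then show ?thesis using m by simp
    next
      case True
      have const: "?K \<omega> \<le> ?K z" if z: "z \<in> sphere 0 1" for z
      proof -
        have "norm z = norm \<omega>" using z True by simp
        then obtain T where "orthogonal_transformation T" "T z = \<omega>"
          by (rule orthogonal_transformation_exists)
        then show ?thesis using inv[of T z] by simp
      qed
      have int: "integrable sphere_measure (\<lambda>x. (cmod (Y l i x))\<^sup>2)" if "i \<in> {1..?d}" for i
      proof -
        have "integrable sphere_measure (\<lambda>x. Re (Y l i x * cnj (Y l i x)))"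
          by (intro integrable_Re sphere.integrable_bounded_measurable bounded_measurable_intros bm that)
        then show ?thesis by (simp add: complex_norm_square[symmetric] complex_mult_cnj cmod_power2)
      qed
      have one: "(\<integral>x. (cmod (Y l i x))\<^sup>2 \<partial>sphere_measure) = 1" if "i \<in> {1..?d}" for i
      proof -
        have "complex_of_real (\<integral>x. (cmod (Y l i x))\<^sup>2 \<partial>sphere_measure) = (\<integral>x. Y l i x * cnj (Y l i x) \<partial>sphere_measure)"
          unfolding complex_norm_square[symmetric] by (rule integral_complex_of_real[symmetric])
        also have "\<dots> = 1" using Y[of l] that by (simp add: orthonormal_basis_def L2_inner_def)
        finally show ?thesis by (simp only: of_real_eq_1_iff)
      qed
      have "?K \<omega> * ?m = (\<integral>x. ?K \<omega> \<partial>(sphere_measure :: (real^'n) measure))" by simp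
      also have "\<dots> \<le> (\<integral>x. ?K x \<partial>sphere_measure)"
        using const int by (intro integral_mono) (auto simp: kernel_diag_def)
      also have "\<dots> = (\<Sum>i\<in>{1..?d}. \<integral>x. (cmod (Y l i x))\<^sup>2 \<partial>sphere_measure)"
        unfolding kernel_diag_def by (rule Bochner_Integration.integral_sum) (rule int)
      also have "\<dots> = real ?d" by (simp add: one)
      also have "\<dots> \<le> 2 * (real l + 1) ^ (CARD('n) - 2)"
        using of_nat_mono[OF harmonics_dim_le[OF Y n], of l, where ?'a=real] by (simp add: add.commute)
      finally show ?thesis using m by (simp add: field_simps)
    qed
  qed
  then show ?thesis using m by (intro exI[of _ "2 / ?m"]) auto
qed

theorem spherical_harmonics_orthogonal:
  fixes f g :: "real^'n \<Rightarrow> complex"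
  assumes "f \<in> spherical_harmonics l" "g \<in> spherical_harmonics l'" "l \<noteq> l'" "CARD('n) \<ge> 2"
  shows "L2_inner sphere_measure f g = 0"
proof -
  obtain p where p: "solid_harmonic l p" "f = (\<lambda>\<omega>. if \<omega> \<in> sphere 0 1 then p \<omega> else 0)"
    using spherical_harmonicsE[OF assms(1)] by blast
  obtain r where r: "solid_harmonic l' r" "g = (\<lambda>\<omega>. if \<omega> \<in> sphere 0 1 then r \<omega> else 0)"
    using spherical_harmonicsE[OF assms(2)] by blast
  have "L2_inner sphere_measure f g = (\<integral>x. p x * cnj (r x) \<partial>sphere_measure)"
    unfolding L2_inner_def by (rule Bochner_Integration.integral_cong) (auto simp: p(2) r(2))
  also have "\<dots> = 0" by (rule solid_harmonic_orthogonal[OF p(1) solid_harmonic_cnj[OF r(1)] assms(3,4)])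
  finally show ?thesis .
qed

section \<open>Kernel bounds on the unit sphere of the Grushin distance\<close>


definition pairs :: "nat \<Rightarrow> nat \<Rightarrow> (nat \<times> nat) set" where
  "pairs \<alpha> k = {(l, j). l \<le> k \<and> j \<le> k \<and> ktilde (real \<alpha>) k l j \<in> \<nat>}"

lemma finite_pairs: "finite (pairs \<alpha> k)"
  by (rule finite_subset[of _ "{..k} \<times> {..k}"]) (auto simp: pairs_def)

definition h_norm2 :: "nat \<Rightarrow> nat \<Rightarrow> nat \<Rightarrow> nat \<Rightarrow> nat \<Rightarrow> nat \<Rightarrow> real" where
  "h_norm2 \<alpha> n m k l j = jacobi_norm2 (nat \<lfloor>ktilde (real \<alpha>) k l j\<rfloor>) (mu (real \<alpha>) n l) (gam m j - 1)"

text \<open>Up to constants, a bound for the kernel on the diagonal: the sums over p and q have been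
  replaced by their bounds.\<close>

definition h_sum :: "nat \<Rightarrow> nat \<Rightarrow> nat \<Rightarrow> nat \<Rightarrow> real \<Rightarrow> real" where
  "h_sum \<alpha> n m k \<phi> = (\<Sum>(l, j)\<in>pairs \<alpha> k. (real l + 1) ^ (n - 2) * (real j + 1) ^ (m - 2)
     * (h_fun (real \<alpha>) n m k l j \<phi>)\<^sup>2 / h_norm2 \<alpha> n m k l j)"

lemma ktilde_eq_iff:
  "ktilde (real \<alpha>) k l j = real N \<longleftrightarrow> k = l + j * (\<alpha> + 1) + 2 * (\<alpha> + 1) * N"
proof -
  have "ktilde (real \<alpha>) k l j = real N \<longleftrightarrow> real k = real (l + j * (\<alpha> + 1) + 2 * (\<alpha> + 1) * N)"
    unfolding ktilde_def by (simp add: field_simps)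
  then show ?thesis by (simp only: of_nat_eq_iff)
qed

text \<open>Membership means k = l + (\<alpha> + 1) (j + 2 N), which forces l to have the residue of
  k modulo \<alpha> + 1.\<close>

lemma pairs_eq_image:
  assumes r: "r \<le> \<alpha>" and k: "k = r + (\<alpha> + 1) * k'"
  shows "pairs \<alpha> k = (\<lambda>(l, j, N). (r + (\<alpha> + 1) * l, j)) ` triples k'"
proof (intro equalityI subsetI)
  fix x assume "x \<in> pairs \<alpha> k"
  then obtain l j N where x: "x = (l, j)" and "ktilde (real \<alpha>) k l j = real N"
    by (auto simp: pairs_def Nats_def)
  then have e: "k = l + (\<alpha> + 1) * (j + 2 * N)" by (simp add: ktilde_eq_iff algebra_simps)
  have lm: "l mod (\<alpha> + 1) = r" "l div (\<alpha> + 1) + (j + 2 * N) = k'"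
  proof -
    have "k mod (\<alpha> + 1) = l mod (\<alpha> + 1)" "k div (\<alpha> + 1) = l div (\<alpha> + 1) + (j + 2 * N)"
      unfolding e by (simp_all add: div_mult_self2 del: add_Suc_right mult_Suc)
    moreover have "k mod (\<alpha> + 1) = r" "k div (\<alpha> + 1) = k'"
      unfolding k using r by (simp_all del: add_Suc_right mult_Suc)
    ultimately show "l mod (\<alpha> + 1) = r" "l div (\<alpha> + 1) + (j + 2 * N) = k'" by simp_all
  qed
  then have "l = r + (\<alpha> + 1) * (l div (\<alpha> + 1))" by (metis add.commute mult_div_mod_eq)
  then show "x \<in> (\<lambda>(l, j, N). (r + (\<alpha> + 1) * l, j)) ` triples k'"
    using lm x by (intro image_eqI[of _ _ "(l div (\<alpha> + 1), j, N)"]) (auto simp: triples_def)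
next
  fix x assume "x \<in> (\<lambda>(l, j, N). (r + (\<alpha> + 1) * l, j)) ` triples k'"
  then obtain l j N where x: "x = (r + (\<alpha> + 1) * l, j)" and e: "l + j + 2 * N = k'" by (auto simp: triples_def)
  have "ktilde (real \<alpha>) k (r + (\<alpha> + 1) * l) j = real N"
    unfolding ktilde_eq_iff k e[symmetric] by (simp add: algebra_simps)
  moreover have "r + (\<alpha> + 1) * l \<le> k" "j \<le> k"
    unfolding k e[symmetric] by (simp_all add: algebra_simps)
  ultimately show "x \<in> pairs \<alpha> k" by (auto simp: pairs_def x)
qed

text \<open>A prefactor that does not depend on l and j raises the exponents of sin and cos to the
  Jacobi parameters, as mu = l / (\<alpha> + 1) + (n - 2) / (2 (\<alpha> + 1)) and gam - 1 = j + (m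
  - 2) / 2.\<close>

lemma h_fun_jacobi_fun:
  assumes "\<phi> \<in> {0<..<pi/2}" "m \<ge> 2"
  shows "h_fun (real \<alpha>) n m k l j \<phi> = sin \<phi> powr (- (real n - 2) / (2 * (real \<alpha> + 1))) * cos \<phi> powr (- (real m - 2) / 2)
     * jacobi_fun (nat \<lfloor>ktilde (real \<alpha>) k l j\<rfloor>) (mu (real \<alpha>) n l) (gam m j - 1) \<phi>"
proof -
  note sc = sin_cos_gt_zero[OF assms(1)]
  have "(sin \<phi> powr (1 / (real \<alpha> + 1))) ^ l = sin \<phi> powr (- (real n - 2) / (2 * (real \<alpha> + 1)) + mu (real \<alpha>) n l)"
  proof -
    have "(sin \<phi> powr (1 / (real \<alpha> + 1))) ^ l = sin \<phi> powr (real l / (real \<alpha> + 1))"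
      using sc by (subst powr_realpow[symmetric]) (auto simp: powr_powr)
    moreover have "- (real n - 2) / (2 * (real \<alpha> + 1)) + mu (real \<alpha>) n l = real l / (real \<alpha> + 1)"
    proof -
      have "- (real n - 2) + (real n - 2 + 2 * real l) = 2 * real l" by simp
      then show ?thesis unfolding mu_def add_divide_distrib[symmetric]
        by (simp only: mult_divide_mult_cancel_left_if) simp
    qed
    ultimately show ?thesis by simp
  qed
  moreover have "cos \<phi> ^ j = cos \<phi> powr (- (real m - 2) / 2 + (gam m j - 1))"
  proof -
    have "- (real m - 2) / 2 + (gam m j - 1) = real j" by (simp add: gam_def field_simps)
    then show ?thesis using sc by (simp add: powr_realpow)
  qed
  ultimately show ?thesis unfolding h_fun_def jacobi_fun_def powr_add by simp
qed

text \<open>The exponent s is free within two limits. For s \<le> n - 2 the missing power of l + 1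
  is paid by \<open>(k + 1) powr (n - 2 - s)\<close>; for s \<ge> (n - 2) / (\<alpha> + 1) a
  nonnegative power of sin \<phi> remains after division by the prefactor. The powers of cos \<phi>
  cancel since 2 q = m - 2, and the exponents of k + 1 add up to n + m - 2 whatever s is.\<close>

lemma h_sum_residue_bound:
  fixes s :: real
  assumes m: "m \<ge> 2" and n: "n \<ge> 2" and r: "r \<le> \<alpha>"
    and P: "P = (real n - 2 + 2 * real r) / (2 * (real \<alpha> + 1))" and q: "q = (real m - 2) / 2"
    and s: "s \<le> real n - 2" "s \<ge> (real n - 2) / (real \<alpha> + 1)"
    and C: "C > 0" "\<And>k \<phi>. \<phi> \<in> {0<..<pi/2} \<Longrightarrow> jsum P s q k \<phi> \<le> C * (real k + 1) powr (s + 2 * q + 2) * (sin \<phi> powr s * cos \<phi> powr (2 * q))"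
    and \<phi>: "\<phi> \<in> {0<..<pi/2}" and k: "k = r + (\<alpha> + 1) * k'"
  shows "h_sum \<alpha> n m k \<phi> \<le> (real \<alpha> + 1) ^ (n - 2) * C * (real k + 1) ^ (n + m - 2)"
proof -
  note sc = sin_cos_gt_zero[OF \<phi>]
  let ?A = "real \<alpha> + 1"
  let ?S = "sin \<phi> powr (- (real n - 2) / ?A) * cos \<phi> powr (- (real m - 2))"
  let ?R = "(real k + 1) powr (real n - 2 - s)"
  have "P \<ge> 0" unfolding P using n by (intro divide_nonneg_nonneg) auto
  then have P0: "P \<ge> -1/2" by simp
  have q0: "q \<ge> 0" using m by (simp add: q)
  have q2: "2 * q = real m - 2" by (simp add: q)
  have kk: "k' \<le> k" unfolding k by simp
  have term_le: "(real (r + (\<alpha> + 1) * l) + 1) ^ (n - 2) * (real j + 1) ^ (m - 2)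
      * (h_fun (real \<alpha>) n m k (r + (\<alpha> + 1) * l) j \<phi>)\<^sup>2 / h_norm2 \<alpha> n m k (r + (\<alpha> + 1) * l) j
    \<le> ?A ^ (n - 2) * ?R * ?S * ((real l + 1) powr s * (real j + 1) powr (2 * q) * (jf P q l j N \<phi>)\<^sup>2 / jn P q l j N)"
    if t: "(l, j, N) \<in> triples k'" for l j N
  proof -
    have e: "l + j + 2 * N = k'" using t by (simp add: triples_def)
    have kt: "ktilde (real \<alpha>) k (r + (\<alpha> + 1) * l) j = real N"
      unfolding ktilde_eq_iff k e[symmetric] by (simp add: algebra_simps)
    have muP: "mu (real \<alpha>) n (r + (\<alpha> + 1) * l) = real l + P"
      unfolding mu_def P by (simp add: field_simps)
    have gq: "gam m j - 1 = real j + q" by (simp add: gam_def q field_simps)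
    have h: "(h_fun (real \<alpha>) n m k (r + (\<alpha> + 1) * l) j \<phi>)\<^sup>2 = ?S * (jf P q l j N \<phi>)\<^sup>2"
    proof -
      have "(sin \<phi> powr (- (real n - 2) / (2 * ?A)))\<^sup>2 = sin \<phi> powr (- (real n - 2) / ?A)"
        "(cos \<phi> powr (- (real m - 2) / 2))\<^sup>2 = cos \<phi> powr (- (real m - 2))"
      proof -
        have "- x / (2 * y) + - x / (2 * y) = - x / y" "- x / 2 + - x / 2 = - x" for x y :: real
          by (cases "y = 0") (auto simp: field_simps)
        then show "(sin \<phi> powr (- (real n - 2) / (2 * ?A)))\<^sup>2 = sin \<phi> powr (- (real n - 2) / ?A)"
          "(cos \<phi> powr (- (real m - 2) / 2))\<^sup>2 = cos \<phi> powr (- (real m - 2))"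
          unfolding power2_eq_square powr_add[symmetric] by (simp_all only:)
      qed
      then show ?thesis
        unfolding h_fun_jacobi_fun[OF \<phi> m] kt muP gq power_mult_distrib jf_def by simp
    qed
    have hn: "h_norm2 \<alpha> n m k (r + (\<alpha> + 1) * l) j = jn P q l j N"
      unfolding h_norm2_def kt muP gq jn_def by simp
    have l1: "(real (r + (\<alpha> + 1) * l) + 1) ^ (n - 2) \<le> ?A ^ (n - 2) * (?R * (real l + 1) powr s)"
    proof -
      have "(real (r + (\<alpha> + 1) * l) + 1) ^ (n - 2) \<le> (?A * (real l + 1)) ^ (n - 2)"
      proof (rule power_mono)
        have "real r \<le> real \<alpha>" using r by simp
        then show "real (r + (\<alpha> + 1) * l) + 1 \<le> ?A * (real l + 1)" by (simp add: algebra_simps)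
      qed simp
      also have "\<dots> = ?A ^ (n - 2) * ((real l + 1) powr (real n - 2 - s) * (real l + 1) powr s)"
        unfolding power_mult_distrib powr_add[symmetric] using n by (simp add: powr_realpow[symmetric] of_nat_diff)
      also have "\<dots> \<le> ?A ^ (n - 2) * (?R * (real l + 1) powr s)"
        using s(1) e kk by (intro mult_left_mono mult_right_mono powr_mono2) auto
      finally show ?thesis .
    qed
    have j1: "(real j + 1) ^ (m - 2) = (real j + 1) powr (2 * q)"
      unfolding q2 using m by (simp add: powr_realpow[symmetric] of_nat_diff)
    have x: "?S * (jf P q l j N \<phi>)\<^sup>2 / jn P q l j N \<ge> 0"
      using jn_pos[OF P0 q0, of l j N] by simp
    have "(real (r + (\<alpha> + 1) * l) + 1) ^ (n - 2) * (real j + 1) powr (2 * q) * (?S * (jf P q l j N \<phi>)\<^sup>2 / jn P q l j N)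
      \<le> ?A ^ (n - 2) * (?R * (real l + 1) powr s) * (real j + 1) powr (2 * q) * (?S * (jf P q l j N \<phi>)\<^sup>2 / jn P q l j N)"
      by (intro mult_right_mono l1 x) auto
    then show ?thesis unfolding h hn j1 by (simp add: mult_ac)
  qed
  have inj: "inj_on (\<lambda>(l, j, N). (r + (\<alpha> + 1) * l, j)) (triples k')"
    by (auto simp: inj_on_def triples_def simp del: add_Suc_right mult_Suc)
  have "h_sum \<alpha> n m k \<phi> = (\<Sum>(l, j, N)\<in>triples k'. (real (r + (\<alpha> + 1) * l) + 1) ^ (n - 2) * (real j + 1) ^ (m - 2)
      * (h_fun (real \<alpha>) n m k (r + (\<alpha> + 1) * l) j \<phi>)\<^sup>2 / h_norm2 \<alpha> n m k (r + (\<alpha> + 1) * l) j)"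
    unfolding h_sum_def pairs_eq_image[OF r k] sum.reindex[OF inj] by (simp add: split_def o_def)
  also have "\<dots> \<le> (\<Sum>(l, j, N)\<in>triples k'. ?A ^ (n - 2) * ?R * ?S * ((real l + 1) powr s * (real j + 1) powr (2 * q) * (jf P q l j N \<phi>)\<^sup>2 / jn P q l j N))"
    using term_le by (intro sum_mono) auto
  also have "\<dots> = ?A ^ (n - 2) * ?R * ?S * jsum P s q k' \<phi>"
    unfolding jsum_def sum_distrib_left by (simp add: split_def)
  also have "\<dots> \<le> ?A ^ (n - 2) * ?R * ?S * (C * (real k' + 1) powr (s + 2 * q + 2) * (sin \<phi> powr s * cos \<phi> powr (2 * q)))"
    by (intro mult_left_mono C(2)[OF \<phi>]) auto
  also have "\<dots> = ?A ^ (n - 2) * C * (?R * (real k' + 1) powr (s + 2 * q + 2)) * ((sin \<phi> powr (- (real n - 2) / ?A) * sin \<phi> powr s) * (cos \<phi> powr (- (real m - 2)) * cos \<phi> powr (2 * q)))"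
    by (simp only: mult_ac)
  also have "\<dots> \<le> ?A ^ (n - 2) * C * (?R * (real k + 1) powr (s + 2 * q + 2)) * (1 * 1)"
  proof (intro mult_mono mult_left_mono)
    show "(real k' + 1) powr (s + 2 * q + 2) \<le> (real k + 1) powr (s + 2 * q + 2)"
    proof (rule powr_mono2)
      have "0 \<le> (real n - 2) / ?A" using n by simp
      then show "0 \<le> s + 2 * q + 2" using s q0 by linarith
    qed (use kk in auto)
    have "sin \<phi> powr (- (real n - 2) / ?A) * sin \<phi> powr s = sin \<phi> powr (s - (real n - 2) / ?A)"
    proof -
      have "- x / y + s = s - x / y" for x y :: real by simp
      then show ?thesis unfolding powr_add[symmetric] by (simp only:)
    qed
    also have "\<dots> \<le> 1" using sc s(2) powr_mono2[of "s - (real n - 2) / ?A" "sin \<phi>" 1] by simp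
    finally show "sin \<phi> powr (- (real n - 2) / ?A) * sin \<phi> powr s \<le> 1" .
    show "cos \<phi> powr (- (real m - 2)) * cos \<phi> powr (2 * q) \<le> 1"
      unfolding powr_add[symmetric] q2 using sc by simp
  qed (use C(1) in auto)
  also have "?R * (real k + 1) powr (s + 2 * q + 2) = (real k + 1) ^ (n + m - 2)"
  proof -
    have "real n - 2 - s + (s + 2 * q + 2) = real (n + m - 2)" unfolding add.assoc q2 using n m by simp
    then show ?thesis unfolding powr_add[symmetric] by (simp add: powr_realpow)
  qed
  finally show ?thesis by simp
qed

theorem h_sum_bound:
  assumes par: "n \<ge> 4 \<and> m \<ge> 2 \<and> \<alpha> \<ge> 1 \<or> n \<in> {2, 3} \<and> m \<ge> 2 \<and> \<alpha> = 1"
  shows "\<exists>C>0. \<forall>k. \<forall>\<phi>\<in>{0<..<pi/2}. h_sum \<alpha> n m k \<phi> \<le> C * (real k + 1) ^ (n + m - 2)"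
proof -
  have m: "m \<ge> 2" and n: "n \<ge> 2" using par by auto
  define q where "q = (real m - 2) / 2"
  have q0: "q \<ge> 0" using m by (simp add: q_def)
  have "\<exists>C>0. \<forall>k k'. \<forall>\<phi>\<in>{0<..<pi/2}. k = r + (\<alpha> + 1) * k' \<longrightarrow> h_sum \<alpha> n m k \<phi> \<le> C * (real k + 1) ^ (n + m - 2)" if r: "r \<le> \<alpha>" for r
  proof -
    define P where "P = (real n - 2 + 2 * real r) / (2 * (real \<alpha> + 1))"
    have "\<exists>s C. s \<le> real n - 2 \<and> s \<ge> (real n - 2) / (real \<alpha> + 1) \<and> C > 0 \<and>
      (\<forall>k. \<forall>\<phi>\<in>{0<..<pi/2}. jsum P s q k \<phi> \<le> C * (real k + 1) powr (s + 2 * q + 2) * (sin \<phi> powr s * cos \<phi> powr (2 * q)))"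
    \<comment> \<open>The natural choice is s = 2 P. When it is too large, only n < 4 and \<alpha> =
      r = 1 remain, and s = 2 p with p = (n - 2) / 4 is the smallest admissible exponent; then P = n
      / 4 = p + 1/2, as \<open>jsum_shifted_le\<close> requires.\<close>
    proof (cases "2 * P \<le> real n - 2")
      case True
      have "P \<ge> 0" using n by (simp add: P_def)
      then obtain C where "C > 0" "\<forall>k. \<forall>\<phi>\<in>{0<..<pi/2}. jsum P (2 * P) q k \<phi>
          \<le> C * (real k + 1) powr (2 * P + 2 * q + 2) * (sin \<phi> powr (2 * P) * cos \<phi> powr (2 * q))"
        using jsum_le q0 by blast
      moreover have "2 * P \<ge> (real n - 2) / (real \<alpha> + 1)" by (simp add: P_def field_simps)
      ultimately show ?thesis using True by blast
    next
      case False
      have "n \<in> {2, 3} \<and> \<alpha> = 1 \<and> r = 1"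
      proof -
        have *: "2 * P = (real n - 2 + 2 * real r) / (real \<alpha> + 1)" by (simp add: P_def del: distrib_left_numeral)
        have "\<not> (n \<ge> 4)"
        proof
          assume "n \<ge> 4"
          then have "2 * real \<alpha> \<le> (real n - 2) * real \<alpha>" by (intro mult_right_mono) auto
          moreover have "2 * real r \<le> 2 * real \<alpha>" using r by simp
          ultimately have "real n - 2 + 2 * real r \<le> (real n - 2) * (real \<alpha> + 1)" by (simp add: algebra_simps)
          then show False using False unfolding * by (simp add: field_simps)
        qed
        then have na: "n \<in> {2, 3}" "\<alpha> = 1" using par by auto
        have "r \<noteq> 0"
        proof
          assume "r = 0"
          then show False using False n unfolding * na(2) by (simp add: field_simps)
        qed
        then show ?thesis using na r by auto
      qed
      define p where "p = (real n - 2) / 4"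
      have p0: "p \<ge> 0" and Pp: "P = p + 1/2" using n \<open>n \<in> {2, 3} \<and> \<alpha> = 1 \<and> r = 1\<close> by (auto simp: p_def P_def field_simps)
      obtain C where "C > 0" "\<forall>k. \<forall>\<phi>\<in>{0<..<pi/2}. jsum (p + 1/2) (2 * p) q k \<phi>
          \<le> C * (real k + 1) powr (2 * p + 2 * q + 2) * (sin \<phi> powr (2 * p) * cos \<phi> powr (2 * q))"
        using jsum_shifted_le[OF p0 q0] by blast
      moreover have "2 * p \<le> real n - 2" "2 * p \<ge> (real n - 2) / (real \<alpha> + 1)"
        using n \<open>n \<in> {2, 3} \<and> \<alpha> = 1 \<and> r = 1\<close> by (auto simp: p_def field_simps)
      ultimately show ?thesis unfolding Pp by blast
    qed
    then obtain s C where s: "s \<le> real n - 2" "s \<ge> (real n - 2) / (real \<alpha> + 1)" and C: "C > 0"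
      "\<And>k \<phi>. \<phi> \<in> {0<..<pi/2} \<Longrightarrow> jsum P s q k \<phi> \<le> C * (real k + 1) powr (s + 2 * q + 2) * (sin \<phi> powr s * cos \<phi> powr (2 * q))"
      by blast
    show ?thesis
      using h_sum_residue_bound[OF m n r P_def q_def s C] C(1)
      by (intro exI[of _ "(real \<alpha> + 1) ^ (n - 2) * C"]) auto
  qed
  then have "\<forall>r. \<exists>C. r \<le> \<alpha> \<longrightarrow> C > 0 \<and> (\<forall>k k'. \<forall>\<phi>\<in>{0<..<pi/2}. k = r + (\<alpha> + 1) * k' \<longrightarrow> h_sum \<alpha> n m k \<phi> \<le> C * (real k + 1) ^ (n + m - 2))"
    by blast
  then obtain C where C: "\<And>r. r \<le> \<alpha> \<Longrightarrow> C r > 0"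
    "\<And>r k k' \<phi>. r \<le> \<alpha> \<Longrightarrow> \<phi> \<in> {0<..<pi/2} \<Longrightarrow> k = r + (\<alpha> + 1) * k' \<Longrightarrow> h_sum \<alpha> n m k \<phi> \<le> C r * (real k + 1) ^ (n + m - 2)"
    by metis
  have "h_sum \<alpha> n m k \<phi> \<le> (\<Sum>r\<le>\<alpha>. C r) * (real k + 1) ^ (n + m - 2)" if "\<phi> \<in> {0<..<pi/2}" for k \<phi>
  proof -
    let ?r = "k mod (\<alpha> + 1)"
    have r: "?r \<le> \<alpha>" using mod_less_divisor[of "\<alpha> + 1" k] by simp
    have "h_sum \<alpha> n m k \<phi> \<le> C ?r * (real k + 1) ^ (n + m - 2)"
      by (rule C(2)[OF r that, of _ "k div (\<alpha> + 1)"]) (simp only: mod_mult_div_eq)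
    also have "C ?r \<le> (\<Sum>r\<le>\<alpha>. C r)" using C(1) r by (intro member_le_sum) (auto intro: less_imp_le)
    finally show ?thesis by (simp add: mult_right_mono)
  qed
  moreover have "(\<Sum>r\<le>\<alpha>. C r) > 0" using C(1) by (intro sum_pos) auto
  ultimately show ?thesis by blast
qed


section \<open>Polar coordinates and the measure on \<Omega>\<close>

definition polar_angle :: "real \<Rightarrow> (real^'n) \<times> (real^'m) \<Rightarrow> real" where
  "polar_angle \<alpha> z = arccos (min 1 ((\<alpha> + 1) * norm (snd z)))"

lemma Omega_eq:
  assumes "\<alpha> \<ge> 0" "z \<in> Omega \<alpha>"
  shows "norm (fst z) powr (2 * (\<alpha> + 1)) + ((\<alpha> + 1) * norm (snd z))\<^sup>2 = 1"
proof -
  let ?X = "norm (fst z) powr (2 * (\<alpha> + 1)) + (\<alpha> + 1)\<^sup>2 * (norm (snd z))\<^sup>2"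
  have X: "?X \<ge> 0" "?X powr (1 / (2 * (\<alpha> + 1))) = 1" using assms by (auto simp: Omega_def rho_def)
  have "(?X powr (1 / (2 * (\<alpha> + 1)))) powr (2 * (\<alpha> + 1)) = 1" by (simp only: X(2) powr_one_eq_one)
  moreover have "1 / (2 * (\<alpha> + 1)) * (2 * (\<alpha> + 1)) = 1" using assms(1) by simp
  ultimately have "?X powr 1 = 1" by (simp only: powr_powr)
  then have "?X = 1" using X(1) by simp
  then show ?thesis by (simp add: power_mult_distrib)
qed

lemma polar_angle_Omega:
  assumes \<alpha>: "\<alpha> \<ge> 0" and z: "z \<in> Omega \<alpha>"
  shows "polar_angle \<alpha> z \<in> {0..pi/2}" "cos (polar_angle \<alpha> z) = (\<alpha> + 1) * norm (snd z)"
    "sin (polar_angle \<alpha> z) powr (1 / (\<alpha> + 1)) = norm (fst z)"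
proof -
  let ?u = "(\<alpha> + 1) * norm (snd z)"
  have e: "norm (fst z) powr (2 * (\<alpha> + 1)) + ?u\<^sup>2 = 1" by (rule Omega_eq[OF assms])
  have u0: "?u \<ge> 0" using \<alpha> by simp
  have "?u\<^sup>2 \<le> 1" using e powr_ge_zero[of "norm (fst z)" "2 * (\<alpha> + 1)"] by linarith
  then have u1: "?u \<le> 1" using u0 by (simp add: power2_le_iff_abs_le abs_le_square_iff[symmetric] power_le_one_iff)
  then have p: "polar_angle \<alpha> z = arccos ?u" by (simp add: polar_angle_def)
  show "polar_angle \<alpha> z \<in> {0..pi/2}" using arccos_le_pi2[OF u0 u1] arccos_lbound[of ?u] u0 u1 by (simp add: p)
  show "cos (polar_angle \<alpha> z) = ?u" unfolding p using u0 u1 by (intro cos_arccos) auto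
  have "sin (polar_angle \<alpha> z) = sqrt (1 - ?u\<^sup>2)" unfolding p using u0 u1 by (intro sin_arccos) auto
  also have "1 - ?u\<^sup>2 = norm (fst z) powr (2 * (\<alpha> + 1))" using e by simp
  also have "sqrt (norm (fst z) powr (2 * (\<alpha> + 1))) = norm (fst z) powr (\<alpha> + 1)"
    by (simp add: powr_half_sqrt[symmetric] powr_powr del: distrib_left_numeral)
  finally show "sin (polar_angle \<alpha> z) powr (1 / (\<alpha> + 1)) = norm (fst z)"
    using \<alpha> by (simp add: powr_powr)
qed

lemma phi_unique:
  assumes \<alpha>: "\<alpha> \<ge> 0" and z: "z \<in> Omega \<alpha>" and \<phi>: "\<phi> \<in> {0..pi/2}" "norm (snd z) = 1 / (\<alpha> + 1) * cos \<phi>"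
  shows "\<phi> = polar_angle \<alpha> z"
proof -
  have "cos \<phi> = cos (polar_angle \<alpha> z)" using polar_angle_Omega(2)[OF \<alpha> z] \<phi>(2) \<alpha> by simp
  moreover have "0 \<le> \<phi>" "\<phi> \<le> pi" "0 \<le> polar_angle \<alpha> z" "polar_angle \<alpha> z \<le> pi"
    using \<phi>(1) polar_angle_Omega(1)[OF \<alpha> z] by auto
  ultimately show ?thesis using cos_inj_pi by blast
qed

text \<open>Replaces the description by \<open>THE\<close> with the formula
  \<open>polar_angle\<close>, which makes sense on the whole space; the cut-off by
  \<open>min 1\<close> makes it continuous there, and measurability is deduced from that.\<close>

lemma phi_Omega:
  assumes \<alpha>: "\<alpha> \<ge> 0" and z: "z \<in> Omega \<alpha>"
  shows "phi \<alpha> z = polar_angle \<alpha> z"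
  unfolding phi_def
proof (rule the_equality)
  have r: "rho \<alpha> z = 1" using z by (simp add: Omega_def)
  show "polar_angle \<alpha> z \<in> {0..pi/2} \<and> norm (fst z) = rho \<alpha> z * sin (polar_angle \<alpha> z) powr (1 / (\<alpha> + 1)) \<and>
     norm (snd z) = 1 / (\<alpha> + 1) * rho \<alpha> z powr (\<alpha> + 1) * cos (polar_angle \<alpha> z)"
    using polar_angle_Omega[OF assms] \<alpha> unfolding r by simp
  fix \<phi> assume "\<phi> \<in> {0..pi/2} \<and> norm (fst z) = rho \<alpha> z * sin \<phi> powr (1 / (\<alpha> + 1)) \<and>
     norm (snd z) = 1 / (\<alpha> + 1) * rho \<alpha> z powr (\<alpha> + 1) * cos \<phi>"
  then show "\<phi> = polar_angle \<alpha> z" unfolding r by (intro phi_unique[OF \<alpha> z]) auto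
qed

text \<open>At each end of the range of \<phi> one angular variable is lost and becomes the junk
  value 0. The exact values are recorded because the parametrisation is used at every point, not
  only almost everywhere.\<close>

lemma Omega_param_simps:
  fixes \<omega>1 :: "real^'n" and \<omega>2 :: "real^'m"
  assumes \<alpha>: "\<alpha> \<ge> 0" and \<phi>: "\<phi> \<in> {0..pi/2}" and \<omega>: "\<omega>1 \<in> sphere 0 1" "\<omega>2 \<in> sphere 0 1"
  defines "z \<equiv> Omega_param \<alpha> (\<phi>, \<omega>1, \<omega>2)"
  shows "z \<in> Omega \<alpha>" "phi \<alpha> z = \<phi>"
    "omega1 z = (if \<phi> = 0 then 0 else \<omega>1)" "omega2 z = (if \<phi> = pi/2 then 0 else \<omega>2)"
proof -
  note sc = sin_cos_ge_zero[OF \<phi>]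
  have z: "fst z = sin \<phi> powr (1 / (\<alpha> + 1)) *\<^sub>R \<omega>1" "snd z = (1 / (\<alpha> + 1) * cos \<phi>) *\<^sub>R \<omega>2"
    by (simp_all add: z_def Omega_param_def)
  have nz: "norm (fst z) = sin \<phi> powr (1 / (\<alpha> + 1))" "norm (snd z) = 1 / (\<alpha> + 1) * cos \<phi>"
    unfolding z using \<omega> sc \<alpha> by (simp_all add: abs_mult)
  have "norm (fst z) powr (2 * (\<alpha> + 1)) + (\<alpha> + 1)\<^sup>2 * (norm (snd z))\<^sup>2 = (sin \<phi>)\<^sup>2 + (cos \<phi>)\<^sup>2"
    unfolding nz using \<alpha> sc by (simp add: powr_powr power_divide del: distrib_left_numeral)
  then show "z \<in> Omega \<alpha>" by (simp add: Omega_def rho_def)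
  from phi_unique[OF \<alpha> this \<phi> nz(2)] phi_Omega[OF \<alpha> this] show "phi \<alpha> z = \<phi>" by simp
  have "sin \<phi> > 0" if "\<phi> \<noteq> 0" using that \<phi> pi_gt_zero by (intro sin_gt_zero) auto
  then show "omega1 z = (if \<phi> = 0 then 0 else \<omega>1)"
    unfolding omega1_def nz unfolding z by auto
  have "cos \<phi> > 0" if "\<phi> \<noteq> pi/2" using that \<phi> by (intro cos_gt_zero_pi) auto
  moreover have "cos \<phi> = 0" if "\<phi> = pi/2" unfolding that by (rule cos_pi_half)
  ultimately show "omega2 z = (if \<phi> = pi/2 then 0 else \<omega>2)"
    unfolding omega2_def nz unfolding z using \<alpha> by (cases "\<phi> = pi/2") (simp_all del: eq_divide_eq_numeral1)
qed

definition angle_measure :: "real \<Rightarrow> nat \<Rightarrow> nat \<Rightarrow> real measure" where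
  "angle_measure \<alpha> n m = density (restrict_space lborel {0..pi/2})
     (\<lambda>\<phi>. ennreal (sin \<phi> powr ((real n - 2) / (\<alpha> + 1) + 1) * cos \<phi> ^ (m - 1)))"

lemma space_angle_measure [simp]: "space (angle_measure \<alpha> n m) = {0..pi/2}"
  by (simp add: angle_measure_def space_restrict_space)

lemma sets_angle_measure [measurable_cong]: "sets (angle_measure \<alpha> n m) = sets (restrict_space borel {0..pi/2})"
  unfolding angle_measure_def by (simp add: sets_restrict_space)

lemma Omega_measure_eq:
  "(Omega_measure \<alpha> :: ((real^'n) \<times> (real^'m)) measure) = distr
     (angle_measure \<alpha> CARD('n) CARD('m) \<Otimes>\<^sub>M (sphere_measure \<Otimes>\<^sub>M sphere_measure))
     (restrict_space borel (Omega \<alpha>)) (Omega_param \<alpha>)"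
  unfolding Omega_measure_def angle_measure_def ..

lemma finite_angle_measure:
  assumes "\<alpha> \<ge> 0" "n \<ge> 2"
  shows "finite_measure (angle_measure \<alpha> n m)"
proof (rule finite_measureI)
  let ?w = "\<lambda>\<phi>. sin \<phi> powr ((real n - 2) / (\<alpha> + 1) + 1) * cos \<phi> ^ (m - 1)"
  have w: "?w \<phi> \<le> 1" if "\<phi> \<in> {0..pi/2}" for \<phi>
  proof -
    note sc = sin_cos_ge_zero[OF that]
    have "sin \<phi> powr ((real n - 2) / (\<alpha> + 1) + 1) \<le> 1 powr ((real n - 2) / (\<alpha> + 1) + 1)"
      using sc assms by (intro powr_mono2) auto
    moreover have "cos \<phi> ^ (m - 1) \<le> 1" using sc by (intro power_le_one) auto
    ultimately have "?w \<phi> \<le> 1 * 1" using sc by (intro mult_mono) auto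
    then show ?thesis by simp
  qed
  have "emeasure (angle_measure \<alpha> n m) (space (angle_measure \<alpha> n m)) = (\<integral>\<^sup>+\<phi>. ennreal (?w \<phi>) * indicator {0..pi/2} \<phi> \<partial>restrict_space lborel {0..pi/2})"
    unfolding space_angle_measure unfolding angle_measure_def
    by (intro emeasure_density) (auto simp: sets_restrict_space_iff intro!: measurable_restrict_space1)
  also have "\<dots> \<le> (\<integral>\<^sup>+\<phi>. 1 \<partial>restrict_space lborel {0..pi/2})"
  proof (rule nn_integral_mono)
    fix \<phi> assume "\<phi> \<in> space (restrict_space lborel {0..pi/2})"
    then have "\<phi> \<in> {0..pi/2}" by (simp add: space_restrict_space)
    then show "ennreal (?w \<phi>) * indicator {0..pi/2} \<phi> \<le> 1" using w[of \<phi>] by (simp add: ennreal_le_1)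
  qed
  also have "\<dots> = emeasure lborel {0..pi/2}" by (simp add: emeasure_restrict_space space_restrict_space)
  also have "\<dots> < \<infinity>" by simp
  finally show "emeasure (angle_measure \<alpha> n m) (space (angle_measure \<alpha> n m)) \<noteq> \<infinity>" by simp
qed

lemma Omega_param_measurable:
  assumes \<alpha>: "\<alpha> \<ge> 0"
  shows "(Omega_param \<alpha> :: real \<times> (real^'n) \<times> (real^'m) \<Rightarrow> _) \<in> measurable
     (angle_measure \<alpha> n m \<Otimes>\<^sub>M (sphere_measure \<Otimes>\<^sub>M sphere_measure)) (restrict_space borel (Omega \<alpha>))"
proof (rule measurable_restrict_space2)
  let ?B = "angle_measure \<alpha> n m \<Otimes>\<^sub>M ((sphere_measure :: (real^'n) measure) \<Otimes>\<^sub>M (sphere_measure :: (real^'m) measure))"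
  show "(Omega_param \<alpha> :: real \<times> (real^'n) \<times> (real^'m) \<Rightarrow> _) \<in> space ?B \<rightarrow> Omega \<alpha>"
  proof (rule funcsetI)
    fix t :: "real \<times> (real^'n) \<times> (real^'m)" assume "t \<in> space ?B"
    then show "Omega_param \<alpha> t \<in> Omega \<alpha>"
      using Omega_param_simps(1)[OF \<alpha>, of "fst t" "fst (snd t)" "snd (snd t)"] by (auto simp: space_pair_measure)
  qed
  have [measurable]: "(\<lambda>x. x) \<in> borel_measurable (sphere_measure :: (real^'d) measure)"
    using measurable_cong_sets[OF sets_sphere_measure refl] measurable_restrict_space1[OF measurable_ident_sets[OF refl]] by blast
  have [measurable]: "(\<lambda>x. x) \<in> borel_measurable (angle_measure \<alpha> n m)"
    using measurable_cong_sets[OF sets_angle_measure refl] measurable_restrict_space1[OF measurable_ident_sets[OF refl]] by blast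
  have m: "fst \<in> borel_measurable ?B" "(\<lambda>t. fst (snd t)) \<in> borel_measurable ?B" "(\<lambda>t. snd (snd t)) \<in> borel_measurable ?B"
    by measurable
  note [measurable] = m
  have "Omega_param \<alpha> = (\<lambda>t::real \<times> (real^'n) \<times> (real^'m). (sin (fst t) powr (1 / (\<alpha> + 1)) *\<^sub>R fst (snd t), (1 / (\<alpha> + 1) * cos (fst t)) *\<^sub>R snd (snd t)))"
    by (auto simp: Omega_param_def split_def)
  moreover have "(\<lambda>t::real \<times> (real^'n) \<times> (real^'m). (sin (fst t) powr (1 / (\<alpha> + 1)) *\<^sub>R fst (snd t), (1 / (\<alpha> + 1) * cos (fst t)) *\<^sub>R snd (snd t))) \<in> borel_measurable ?B"
    by (intro borel_measurable_Pair) measurable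
  ultimately show "(Omega_param \<alpha> :: real \<times> (real^'n) \<times> (real^'m) \<Rightarrow> _) \<in> borel_measurable ?B" by simp
qed

lemma space_Omega_measure [simp]: "space (Omega_measure \<alpha>) = Omega \<alpha>"
  by (simp add: Omega_measure_def space_restrict_space)

lemma sets_Omega_measure: "sets (Omega_measure \<alpha>) = sets (restrict_space borel (Omega \<alpha>))"
  by (simp add: Omega_measure_def)

lemma finite_base_measure:
  assumes "\<alpha> \<ge> 0" "n \<ge> 2"
  shows "finite_measure (angle_measure \<alpha> n m \<Otimes>\<^sub>M ((sphere_measure :: (real^'n) measure) \<Otimes>\<^sub>M (sphere_measure :: (real^'m) measure)))"
  by (intro finite_measure_pair_measure finite_angle_measure finite_sphere_measure assms)

lemma finite_Omega_measure:
  assumes "\<alpha> \<ge> 0" "CARD('n) \<ge> 2"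
  shows "finite_measure (Omega_measure \<alpha> :: ((real^'n) \<times> (real^'m)) measure)"
  unfolding Omega_measure_eq
  by (rule finite_measure.finite_measure_distr[OF finite_base_measure Omega_param_measurable]) (use assms in auto)

lemma integral_product_measure:
  fixes f :: "'a \<Rightarrow> complex"
  assumes "finite_measure M" "finite_measure N" and f: "bounded_measurable M f" and g: "bounded_measurable N g"
  shows "(\<integral>t. f (fst t) * g (snd t) \<partial>(M \<Otimes>\<^sub>M N)) = (\<integral>x. f x \<partial>M) * (\<integral>y. g y \<partial>N)"
    and "bounded_measurable (M \<Otimes>\<^sub>M N) (\<lambda>t. f (fst t) * g (snd t))"
proof -
  interpret M: finite_measure M by fact
  interpret N: finite_measure N by fact
  interpret pair_sigma_finite M N ..
  interpret MN: finite_measure "M \<Otimes>\<^sub>M N" by (intro finite_measure_pair_measure assms)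
  have [measurable]: "f \<in> borel_measurable M" "g \<in> borel_measurable N" using f g by (auto simp: bounded_measurable_def)
  have "bounded_measurable (M \<Otimes>\<^sub>M N) (\<lambda>t. f (fst t))" "bounded_measurable (M \<Otimes>\<^sub>M N) (\<lambda>t. g (snd t))"
    using f g by (auto simp: bounded_measurable_def space_pair_measure)
  then show bm: "bounded_measurable (M \<Otimes>\<^sub>M N) (\<lambda>t. f (fst t) * g (snd t))" by (rule bounded_measurable_mult)
  have "(\<integral>t. f (fst t) * g (snd t) \<partial>(M \<Otimes>\<^sub>M N)) = (\<integral>x. \<integral>y. f x * g y \<partial>N \<partial>M)"
    using integral_fst'[OF MN.integrable_bounded_measurable[OF bm]] by simp
  then show "(\<integral>t. f (fst t) * g (snd t) \<partial>(M \<Otimes>\<^sub>M N)) = (\<integral>x. f x \<partial>M) * (\<integral>y. g y \<partial>N)" by simp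
qed

lemma borel_measurable_h_fun [measurable]: "h_fun \<alpha> n m k l j \<in> borel_measurable borel"
proof -
  have [measurable]: "jacobi_P N a b \<in> borel_measurable borel" for N a b
    unfolding jacobi_P_def[abs_def] by measurable
  show ?thesis unfolding h_fun_def[abs_def] by measurable
qed

lemma h_fun_bounded:
  assumes "\<alpha> \<ge> 0"
  shows "\<exists>B. \<forall>\<phi>\<in>{0..pi/2}. \<bar>h_fun \<alpha> n m k l j \<phi>\<bar> \<le> B"
proof -
  let ?J = "\<lambda>\<phi>. jacobi_P (nat \<lfloor>ktilde \<alpha> k l j\<rfloor>) (mu \<alpha> n l) (gam m j - 1) (cos (2 * \<phi>))"
  have "continuous_on {0..pi/2} ?J" unfolding jacobi_P_cos_double by (rule continuous_on_jhom_trig)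
  then have "bounded (?J ` {0..pi/2})" by (intro compact_imp_bounded compact_continuous_image) auto
  then obtain B where "\<forall>x\<in>?J ` {0..pi/2}. norm x \<le> B" unfolding bounded_iff by blast
  then have B: "\<bar>?J \<phi>\<bar> \<le> B" if "\<phi> \<in> {0..pi/2}" for \<phi> using that by (simp only: ball_simps real_norm_def)
  have "\<bar>h_fun \<alpha> n m k l j \<phi>\<bar> \<le> B" if \<phi>: "\<phi> \<in> {0..pi/2}" for \<phi>
  proof -
    note sc = sin_cos_ge_zero[OF \<phi>]
    have "sin \<phi> powr (1 / (\<alpha> + 1)) \<le> 1 powr (1 / (\<alpha> + 1))" using sc assms by (intro powr_mono2) auto
    then have "(sin \<phi> powr (1 / (\<alpha> + 1))) ^ l \<le> 1" by (intro power_le_one) auto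
    moreover have "cos \<phi> ^ j \<le> 1" using sc by (intro power_le_one) auto
    ultimately have "\<bar>cos \<phi> ^ j * (sin \<phi> powr (1 / (\<alpha> + 1))) ^ l\<bar> \<le> 1 * 1"
      unfolding abs_mult using sc by (intro mult_mono) auto
    then have "\<bar>cos \<phi> ^ j * (sin \<phi> powr (1 / (\<alpha> + 1))) ^ l\<bar> * \<bar>?J \<phi>\<bar> \<le> 1 * B"
      using B[OF \<phi>] by (intro mult_mono) auto
    then show ?thesis unfolding h_fun_def by (simp add: abs_mult)
  qed
  then show ?thesis by blast
qed

text \<open>Stated on the ambient space since \<open>omega1\<close> and \<open>omega2\<close> take
  values there, including 0, where the harmonics vanish by convention.\<close>

lemma spherical_harmonics_borel_bounded:
  fixes f :: "real^'n \<Rightarrow> complex"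
  assumes "f \<in> spherical_harmonics l"
  shows "f \<in> borel_measurable borel" "\<exists>B. \<forall>x. cmod (f x) \<le> B" "f 0 = 0"
proof -
  obtain p where p: "solid_harmonic l p" "f = (\<lambda>\<omega>. if \<omega> \<in> sphere 0 1 then p \<omega> else 0)"
    using spherical_harmonicsE[OF assms] by blast
  have c: "cpoly p" using p(1) by (simp add: solid_harmonic_def)
  have [measurable]: "p \<in> borel_measurable borel" by (intro borel_measurable_continuous_onI cpoly_continuous c)
  have [measurable]: "sphere 0 1 \<in> sets (borel :: (real^'n) measure)" by (intro borel_closed) simp
  show "f \<in> borel_measurable borel" unfolding p(2) by measurable
  obtain B where "\<forall>x\<in>sphere 0 1. cmod (p x) \<le> B"
    using cpoly_bounded_measurable[OF c] unfolding bounded_measurable_def space_sphere_measure by blast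
  then have "cmod (f x) \<le> max 0 B" for x
    by (cases "x \<in> sphere 0 1") (simp_all only: p(2) if_True if_False norm_zero max.cobounded1 max.coboundedI2)
  then show "\<exists>B. \<forall>x. cmod (f x) \<le> B" by blast
  show "f 0 = 0" by (simp add: p(2))
qed


section \<open>The explicit orthonormal basis and the bound for the projection\<close>

locale harmonic_bases =
  fixes \<alpha> :: nat
    and Y :: "nat \<Rightarrow> nat \<Rightarrow> real^'n \<Rightarrow> complex"
    and Z :: "nat \<Rightarrow> nat \<Rightarrow> real^'m \<Rightarrow> complex"
  assumes Y: "\<And>l. orthonormal_basis sphere_measure {1..harmonics_dim TYPE(real^'n) l} (Y l) (spherical_harmonics l)"
    and Z: "\<And>j. orthonormal_basis sphere_measure {1..harmonics_dim TYPE(real^'m) j} (Z j) (spherical_harmonics j)"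
    and n: "CARD('n) \<ge> 2" and m: "CARD('m) \<ge> 2"
begin

sublocale \<Omega>: finite_measure "Omega_measure (real \<alpha>) :: ((real^'n) \<times> (real^'m)) measure"
  by (rule finite_Omega_measure) (use n in auto)

definition idx :: "nat \<Rightarrow> ((nat \<times> nat) \<times> (nat \<times> nat)) set" where
  "idx k = (SIGMA lj:pairs \<alpha> k. {1..harmonics_dim TYPE(real^'n) (fst lj)} \<times> {1..harmonics_dim TYPE(real^'m) (snd lj)})"

definition product_fun :: "nat \<Rightarrow> (nat \<times> nat) \<times> (nat \<times> nat) \<Rightarrow> (real^'n) \<times> (real^'m) \<Rightarrow> complex" where
  "product_fun k = (\<lambda>((l, j), (p, q)) z. if z \<in> Omega (real \<alpha>)
     then of_real (h_fun (real \<alpha>) CARD('n) CARD('m) k l j (phi (real \<alpha>) z)) * Y l p (omega1 z) * Z j q (omega2 z) else 0)"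

text \<open>The spherical factors already have norm one, so only the norm of the \<phi> part has to
  be divided out.\<close>

definition unit_fun :: "nat \<Rightarrow> (nat \<times> nat) \<times> (nat \<times> nat) \<Rightarrow> (real^'n) \<times> (real^'m) \<Rightarrow> complex" where
  "unit_fun k i z = of_real (1 / sqrt (h_norm2 \<alpha> CARD('n) CARD('m) k (fst (fst i)) (snd (fst i)))) * product_fun k i z"

lemma finite_idx: "finite (idx k)"
  unfolding idx_def by (intro finite_SigmaI finite_pairs) auto

lemma H_space_eq: "H_space (real \<alpha>) Y Z k = cspan (product_fun k ` idx k)"
  unfolding H_space_def
proof (rule arg_cong[of _ _ cspan], intro equalityI subsetI)
  fix f assume "f \<in> product_fun k ` idx k"
  then show "f \<in> {\<lambda>z. if z \<in> Omega (real \<alpha>) then of_real (h_fun (real \<alpha>) CARD('n) CARD('m) k l j (phi (real \<alpha>) z)) * Y l p (omega1 z) * Z j q (omega2 z) else 0 | l j p q.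
      l \<le> k \<and> j \<le> k \<and> ktilde (real \<alpha>) k l j \<in> \<nat> \<and> p \<in> {1..harmonics_dim TYPE(real^'n) l} \<and> q \<in> {1..harmonics_dim TYPE(real^'m) j}}"
    by (auto simp: idx_def product_fun_def pairs_def) blast
next
  fix f assume "f \<in> {\<lambda>z. if z \<in> Omega (real \<alpha>) then of_real (h_fun (real \<alpha>) CARD('n) CARD('m) k l j (phi (real \<alpha>) z)) * Y l p (omega1 z) * Z j q (omega2 z) else 0 | l j p q.
      l \<le> k \<and> j \<le> k \<and> ktilde (real \<alpha>) k l j \<in> \<nat> \<and> p \<in> {1..harmonics_dim TYPE(real^'n) l} \<and> q \<in> {1..harmonics_dim TYPE(real^'m) j}}"
  then obtain l j p q where f: "f = product_fun k ((l, j), (p, q))"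
    and "l \<le> k \<and> j \<le> k \<and> ktilde (real \<alpha>) k l j \<in> \<nat> \<and> p \<in> {1..harmonics_dim TYPE(real^'n) l} \<and> q \<in> {1..harmonics_dim TYPE(real^'m) j}"
    by (auto simp: product_fun_def)
  then have "((l, j), (p, q)) \<in> idx k" by (auto simp: idx_def pairs_def)
  then show "f \<in> product_fun k ` idx k" unfolding f by (rule imageI)
qed

lemma product_fun_bounded_measurable:
  assumes "i \<in> idx k"
  shows "bounded_measurable (Omega_measure (real \<alpha>) :: ((real^'n) \<times> (real^'m)) measure) (product_fun k i)"
proof -
  obtain l j p q where i: "i = ((l, j), (p, q))" by (metis surj_pair)
  have pq: "p \<in> {1..harmonics_dim TYPE(real^'n) l}" "q \<in> {1..harmonics_dim TYPE(real^'m) j}" using assms by (auto simp: i idx_def)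
  note sY = spherical_harmonics_borel_bounded[OF orthonormal_basis_mem[OF Y pq(1)]]
  note sZ = spherical_harmonics_borel_bounded[OF orthonormal_basis_mem[OF Z pq(2)]]
  let ?g = "\<lambda>z. of_real (h_fun (real \<alpha>) CARD('n) CARD('m) k l j (polar_angle (real \<alpha>) z)) * Y l p (omega1 z) * Z j q (omega2 z)"
  have eq: "product_fun k i z = ?g z" if "z \<in> Omega (real \<alpha>)" for z
    using that by (simp add: product_fun_def i phi_Omega)
  have [measurable]: "(polar_angle (real \<alpha>) :: (real^'n) \<times> (real^'m) \<Rightarrow> real) \<in> borel_measurable borel"
  proof (rule borel_measurable_continuous_onI)
    \<comment> \<open>The additional \<open>max 0\<close> keeps the argument in the domain of arccos
      for every real u; it changes nothing at the nonnegative values that occur.\<close>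
    have "continuous_on UNIV (\<lambda>u. arccos (min 1 (max 0 u)))"
      by (intro continuous_on_arccos' continuous_intros) (auto simp: min_def max_def)
    then have "continuous_on UNIV (\<lambda>z::(real^'n) \<times> (real^'m). arccos (min 1 (max 0 ((real \<alpha> + 1) * norm (snd z)))))"
      by (rule continuous_on_compose2) (auto intro!: continuous_intros)
    moreover have "max 0 ((real \<alpha> + 1) * norm (snd z)) = (real \<alpha> + 1) * norm (snd z)" for z :: "(real^'n) \<times> (real^'m)"
      by simp
    ultimately show "continuous_on UNIV (polar_angle (real \<alpha>) :: (real^'n) \<times> (real^'m) \<Rightarrow> real)"
      by (simp add: polar_angle_def[abs_def])
  qed
  have [measurable]: "(omega1 :: (real^'n) \<times> (real^'m) \<Rightarrow> _) \<in> borel_measurable borel"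
    "(omega2 :: (real^'n) \<times> (real^'m) \<Rightarrow> _) \<in> borel_measurable borel"
  proof -
    have [measurable]: "(fst :: (real^'n) \<times> (real^'m) \<Rightarrow> _) \<in> borel_measurable borel" "(snd :: (real^'n) \<times> (real^'m) \<Rightarrow> _) \<in> borel_measurable borel"
      by (intro borel_measurable_continuous_onI continuous_intros)+
    show "(omega1 :: (real^'n) \<times> (real^'m) \<Rightarrow> _) \<in> borel_measurable borel"
      "(omega2 :: (real^'n) \<times> (real^'m) \<Rightarrow> _) \<in> borel_measurable borel"
      unfolding omega1_def[abs_def] omega2_def[abs_def] by measurable
  qed
  note [measurable] = sY(1) sZ(1)
  have "?g \<in> borel_measurable borel" by measurable
  then have "?g \<in> borel_measurable (restrict_space borel (Omega (real \<alpha>)))" by (rule measurable_restrict_space1)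
  then have "?g \<in> borel_measurable (Omega_measure (real \<alpha>) :: ((real^'n) \<times> (real^'m)) measure)" using measurable_cong_sets[OF sets_Omega_measure refl] by blast
  then have "product_fun k i \<in> borel_measurable (Omega_measure (real \<alpha>) :: ((real^'n) \<times> (real^'m)) measure)" using measurable_cong[of "Omega_measure (real \<alpha>) :: ((real^'n) \<times> (real^'m)) measure" "product_fun k i" ?g borel] eq by simp
  moreover have "\<exists>B. \<forall>z\<in>space (Omega_measure (real \<alpha>) :: ((real^'n) \<times> (real^'m)) measure). cmod (product_fun k i z) \<le> B"
  proof -
    obtain B1 where B1: "\<And>\<phi>. \<phi> \<in> {0..pi/2} \<Longrightarrow> \<bar>h_fun (real \<alpha>) CARD('n) CARD('m) k l j \<phi>\<bar> \<le> B1"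
      using h_fun_bounded[of "real \<alpha>" "CARD('n)" "CARD('m)" k l j, OF of_nat_0_le_iff] by blast
    obtain B2 B3 where B: "\<And>x. cmod (Y l p x) \<le> B2" "\<And>x. cmod (Z j q x) \<le> B3" using sY(2) sZ(2) by blast
    have "cmod (product_fun k i z) \<le> B1 * B2 * B3" if z: "z \<in> Omega (real \<alpha>)" for z
    proof -
      have "polar_angle (real \<alpha>) z \<in> {0..pi/2}" using polar_angle_Omega(1)[OF _ z] by simp
      from B1[OF this] have b1: "cmod (of_real (h_fun (real \<alpha>) CARD('n) CARD('m) k l j (polar_angle (real \<alpha>) z))) \<le> B1" by simp
      have nn: "0 \<le> B1" "0 \<le> B2" using b1 B(1) norm_ge_zero order_trans by blast+
      show ?thesis unfolding eq[OF z] norm_mult by (intro mult_mono b1 B nn mult_nonneg_nonneg norm_ge_zero)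
    qed
    then show ?thesis unfolding space_Omega_measure by blast
  qed
  ultimately show ?thesis by (simp add: bounded_measurable_def)
qed

text \<open>The indicator of the open interval reflects the junk values: at an end point one
  harmonic is evaluated at 0 and vanishes, whereas \<open>h_fun\<close> itself can be nonzero
  there.\<close>

lemma product_fun_param:
  assumes i: "((l, j), (p, q)) \<in> idx k" and \<phi>: "\<phi> \<in> {0..pi/2}" and \<omega>: "\<omega>1 \<in> sphere 0 1" "\<omega>2 \<in> sphere 0 1"
  shows "product_fun k ((l, j), (p, q)) (Omega_param (real \<alpha>) (\<phi>, \<omega>1, \<omega>2))
    = of_real (indicator {0<..<pi/2} \<phi> * h_fun (real \<alpha>) CARD('n) CARD('m) k l j \<phi>) * Y l p \<omega>1 * Z j q \<omega>2"
proof -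
  have pq: "p \<in> {1..harmonics_dim TYPE(real^'n) l}" "q \<in> {1..harmonics_dim TYPE(real^'m) j}" using i by (auto simp: idx_def)
  have z: "Y l p 0 = 0" "Z j q 0 = 0"
    using spherical_harmonics_borel_bounded(3)[OF orthonormal_basis_mem[OF Y pq(1)]]
      spherical_harmonics_borel_bounded(3)[OF orthonormal_basis_mem[OF Z pq(2)]] by auto
  note P = Omega_param_simps[OF _ \<phi> \<omega>, of "real \<alpha>", OF of_nat_0_le_iff]
  have "\<phi> = 0 \<or> \<phi> = pi/2 \<or> \<phi> \<in> {0<..<pi/2}" using \<phi> by auto
  then show ?thesis
  proof (elim disjE)
    assume "\<phi> = 0"
    then show ?thesis unfolding product_fun_def prod.case P by (simp add: z)
  next
    assume "\<phi> = pi/2"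
    then show ?thesis unfolding product_fun_def prod.case P by (simp add: z del: eq_divide_eq_numeral1)
  next
    assume "\<phi> \<in> {0<..<pi/2}"
    then show ?thesis unfolding product_fun_def prod.case P by (simp add: P(1))
  qed
qed

lemma inner_Y:
  assumes "p \<in> {1..harmonics_dim TYPE(real^'n) l}" "p' \<in> {1..harmonics_dim TYPE(real^'n) l'}"
  shows "L2_inner sphere_measure (Y l p) (Y l' p') = (if l = l' \<and> p = p' then 1 else 0)"
proof (cases "l = l'")
  case True
  then show ?thesis using Y[of l] assms by (simp add: orthonormal_basis_def)
next
  case False
  then show ?thesis
    using spherical_harmonics_orthogonal[OF orthonormal_basis_mem[OF Y assms(1)] orthonormal_basis_mem[OF Y assms(2)] False n] by simp
qed

lemma inner_Z:
  assumes "q \<in> {1..harmonics_dim TYPE(real^'m) j}" "q' \<in> {1..harmonics_dim TYPE(real^'m) j'}"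
  shows "L2_inner sphere_measure (Z j q) (Z j' q') = (if j = j' \<and> q = q' then 1 else 0)"
proof (cases "j = j'")
  case True
  then show ?thesis using Z[of j] assms by (simp add: orthonormal_basis_def)
next
  case False
  then show ?thesis
    using spherical_harmonics_orthogonal[OF orthonormal_basis_mem[OF Z assms(1)] orthonormal_basis_mem[OF Z assms(2)] False m] by simp
qed

text \<open>The square of the prefactor in \<open>h_fun_jacobi_fun\<close> reduces the density of
  the angle measure to sin \<phi> cos \<phi>, the weight in \<open>jacobi_norm2\<close>.\<close>

lemma integral_h_squared:
  "(\<integral>\<phi>. complex_of_real (indicator {0<..<pi/2} \<phi> * (h_fun (real \<alpha>) CARD('n) CARD('m) k l j \<phi>)\<^sup>2) \<partial>angle_measure (real \<alpha>) CARD('n) CARD('m)) = of_real (h_norm2 \<alpha> CARD('n) CARD('m) k l j)"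
proof -
  let ?w = "\<lambda>\<phi>. sin \<phi> powr ((real CARD('n) - 2) / (real \<alpha> + 1) + 1) * cos \<phi> ^ (CARD('m) - 1)"
  let ?G = "\<lambda>\<phi>. indicator {0<..<pi/2} \<phi> * (h_fun (real \<alpha>) CARD('n) CARD('m) k l j \<phi>)\<^sup>2"
  let ?H = "jacobi_fun (nat \<lfloor>ktilde (real \<alpha>) k l j\<rfloor>) (mu (real \<alpha>) CARD('n) l) (gam CARD('m) j - 1)"
  have "(\<integral>\<phi>. ?G \<phi> \<partial>angle_measure (real \<alpha>) CARD('n) CARD('m)) = (\<integral>\<phi>. ?w \<phi> *\<^sub>R ?G \<phi> \<partial>restrict_space lborel {0..pi/2})"
    unfolding angle_measure_def
  proof (rule integral_density)
    show "AE x in restrict_space lborel {0..pi/2}. 0 \<le> ?w x"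
      using sin_cos_ge_zero by (intro AE_I2) (simp add: space_restrict_space)
  qed (auto intro!: measurable_restrict_space1)
  also have "\<dots> = (LINT \<phi>:{0..pi/2}|lborel. ?w \<phi> *\<^sub>R ?G \<phi>)"
    unfolding set_lebesgue_integral_def by (rule integral_restrict_space) simp
  also have "\<dots> = (LINT \<phi>:{0..pi/2}|lborel. ?H \<phi> * ?H \<phi> * sin \<phi> * cos \<phi>)"
  proof (rule set_lebesgue_integral_cong)
    show "\<forall>\<phi>. \<phi> \<in> {0..pi/2} \<longrightarrow> ?w \<phi> *\<^sub>R ?G \<phi> = ?H \<phi> * ?H \<phi> * sin \<phi> * cos \<phi>"
    proof (intro allI impI)
      fix \<phi> :: real assume \<phi>: "\<phi> \<in> {0..pi/2}"
      show "?w \<phi> *\<^sub>R ?G \<phi> = ?H \<phi> * ?H \<phi> * sin \<phi> * cos \<phi>"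
      proof (cases "\<phi> \<in> {0<..<pi/2}")
        case True
        note sc = sin_cos_gt_zero[OF True]
        let ?a = "- (real CARD('n) - 2) / (2 * (real \<alpha> + 1))" and ?b = "- (real CARD('m) - 2) / 2"
        have h2: "(h_fun (real \<alpha>) CARD('n) CARD('m) k l j \<phi>)\<^sup>2 = sin \<phi> powr (?a + ?a) * cos \<phi> powr (?b + ?b) * (?H \<phi> * ?H \<phi>)"
          unfolding h_fun_jacobi_fun[OF True m] power2_eq_square powr_add by (simp only: mult_ac)
        have "- x / (2 * y) + - x / (2 * y) + (x / y + 1) = 1" for x y :: real
          by (cases "y = 0") (auto simp: field_simps)
        then have s: "sin \<phi> powr (?a + ?a) * sin \<phi> powr ((real CARD('n) - 2) / (real \<alpha> + 1) + 1) = sin \<phi>"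
          using sc unfolding powr_add[symmetric] by (simp only: powr_one order_less_imp_le)
        have c: "cos \<phi> powr (?b + ?b) * cos \<phi> ^ (CARD('m) - 1) = cos \<phi>"
        proof -
          have "cos \<phi> ^ (CARD('m) - 1) = cos \<phi> powr (real CARD('m) - 1)"
            using sc m by (simp add: powr_realpow[symmetric] of_nat_diff)
          moreover have "?b + ?b + (real CARD('m) - 1) = 1" by simp
          ultimately show ?thesis using sc unfolding powr_add[symmetric] by (simp only: powr_add[symmetric] powr_one order_less_imp_le)
        qed
        have "?w \<phi> *\<^sub>R ?G \<phi> = (sin \<phi> powr (?a + ?a) * sin \<phi> powr ((real CARD('n) - 2) / (real \<alpha> + 1) + 1))
          * (cos \<phi> powr (?b + ?b) * cos \<phi> ^ (CARD('m) - 1)) * (?H \<phi> * ?H \<phi>)"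
          using True unfolding h2 by simp
        then show ?thesis unfolding s c by (simp only: mult_ac)
      next
        case False
        then have "\<phi> = 0 \<or> \<phi> = pi/2" using \<phi> by auto
        then have "sin \<phi> * cos \<phi> = 0" by (elim disjE) (simp_all only: sin_zero cos_pi_half mult_zero_left mult_zero_right)
        moreover have "indicator {0<..<pi/2} \<phi> = (0::real)" using False by (rule indicator_simps(2))
        ultimately show ?thesis by (simp only: mult_zero_left scaleR_zero_right mult.assoc mult_zero_right)
      qed
    qed
  qed simp
  also have "\<dots> = h_norm2 \<alpha> CARD('n) CARD('m) k l j" by (simp add: h_norm2_def jacobi_norm2_def)
  finally have "(\<integral>\<phi>. ?G \<phi> \<partial>angle_measure (real \<alpha>) CARD('n) CARD('m)) = h_norm2 \<alpha> CARD('n) CARD('m) k l j" .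
  then show ?thesis by (simp only: integral_complex_of_real)
qed

text \<open>Orthogonality comes from the two spheres alone: distinct indices differ in (l, p) or in
  (j, q), since k, l and j determine the degree of the Jacobi polynomial. The integral over \<phi>
  has to be evaluated for equal indices only.\<close>

lemma inner_product_fun:
  assumes i: "i \<in> idx k" and i': "i' \<in> idx k"
  shows "L2_inner (Omega_measure (real \<alpha>) :: ((real^'n) \<times> (real^'m)) measure) (product_fun k i) (product_fun k i') = (if i = i' then of_real (h_norm2 \<alpha> CARD('n) CARD('m) k (fst (fst i)) (snd (fst i))) else 0)"
proof -
  obtain l j p q where e: "i = ((l, j), (p, q))" by (metis surj_pair)
  obtain l' j' p' q' where e': "i' = ((l', j'), (p', q'))" by (metis surj_pair)
  have pq: "p \<in> {1..harmonics_dim TYPE(real^'n) l}" "q \<in> {1..harmonics_dim TYPE(real^'m) j}" using i by (auto simp: e idx_def)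
  have pq': "p' \<in> {1..harmonics_dim TYPE(real^'n) l'}" "q' \<in> {1..harmonics_dim TYPE(real^'m) j'}" using i' by (auto simp: e' idx_def)
  let ?D = "angle_measure (real \<alpha>) CARD('n) CARD('m)"
  let ?S = "(sphere_measure :: (real^'n) measure) \<Otimes>\<^sub>M (sphere_measure :: (real^'m) measure)"
  let ?G = "\<lambda>\<phi>. complex_of_real (indicator {0<..<pi/2} \<phi> * h_fun (real \<alpha>) CARD('n) CARD('m) k l j \<phi>) * cnj (complex_of_real (indicator {0<..<pi/2} \<phi> * h_fun (real \<alpha>) CARD('n) CARD('m) k l' j' \<phi>))"
  let ?y = "\<lambda>x. Y l p x * cnj (Y l' p' x)" and ?z = "\<lambda>x. Z j q x * cnj (Z j' q' x)"
  have fS: "finite_measure ?S" by (intro finite_measure_pair_measure finite_sphere_measure)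
  have fD: "finite_measure ?D" by (rule finite_angle_measure) (use n in auto)
  have by1: "bounded_measurable sphere_measure ?y"
    by (intro bounded_measurable_intros spherical_harmonics_bounded_measurable[OF orthonormal_basis_mem[OF Y pq(1)]]
        spherical_harmonics_bounded_measurable[OF orthonormal_basis_mem[OF Y pq'(1)]])
  have bz: "bounded_measurable sphere_measure ?z"
    by (intro bounded_measurable_intros spherical_harmonics_bounded_measurable[OF orthonormal_basis_mem[OF Z pq(2)]]
        spherical_harmonics_bounded_measurable[OF orthonormal_basis_mem[OF Z pq'(2)]])
  have bh: "bounded_measurable ?D (\<lambda>\<phi>. complex_of_real (indicator {0<..<pi/2} \<phi> * h_fun (real \<alpha>) CARD('n) CARD('m) k a b \<phi>))" for a b
  proof -
    obtain B where B: "\<And>\<phi>. \<phi> \<in> {0..pi/2} \<Longrightarrow> \<bar>h_fun (real \<alpha>) CARD('n) CARD('m) k a b \<phi>\<bar> \<le> B"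
      using h_fun_bounded[of "real \<alpha>" "CARD('n)" "CARD('m)" k a b, OF of_nat_0_le_iff] by blast
    have "(\<lambda>\<phi>. complex_of_real (indicator {0<..<pi/2} \<phi> * h_fun (real \<alpha>) CARD('n) CARD('m) k a b \<phi>)) \<in> borel_measurable borel" by measurable
    then have "(\<lambda>\<phi>. complex_of_real (indicator {0<..<pi/2} \<phi> * h_fun (real \<alpha>) CARD('n) CARD('m) k a b \<phi>)) \<in> borel_measurable (restrict_space borel {0..pi/2})"
      by (rule measurable_restrict_space1)
    then have "(\<lambda>\<phi>. complex_of_real (indicator {0<..<pi/2} \<phi> * h_fun (real \<alpha>) CARD('n) CARD('m) k a b \<phi>)) \<in> borel_measurable ?D"
      using measurable_cong_sets[OF sets_angle_measure refl] by blast
    moreover have "cmod (complex_of_real (indicator {0<..<pi/2} \<phi> * h_fun (real \<alpha>) CARD('n) CARD('m) k a b \<phi>)) \<le> B" if "\<phi> \<in> {0..pi/2}" for \<phi>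
      using B[OF that] order_trans[OF abs_ge_zero B[OF that]] by (simp add: indicator_def)
    ultimately show ?thesis unfolding bounded_measurable_def space_angle_measure by blast
  qed
  have bG: "bounded_measurable ?D ?G" by (intro bounded_measurable_intros bh)
  let ?f = "\<lambda>z. product_fun k i z * cnj (product_fun k i' z)"
  have mf: "?f \<in> borel_measurable (restrict_space borel (Omega (real \<alpha>)))"
  proof -
    have "bounded_measurable (Omega_measure (real \<alpha>) :: ((real^'n) \<times> (real^'m)) measure) ?f" by (intro bounded_measurable_intros product_fun_bounded_measurable i i')
    then show ?thesis using measurable_cong_sets[OF sets_Omega_measure refl] unfolding bounded_measurable_def by blast
  qed
  have "L2_inner (Omega_measure (real \<alpha>) :: ((real^'n) \<times> (real^'m)) measure) (product_fun k i) (product_fun k i') = (\<integral>t. ?f (Omega_param (real \<alpha>) t) \<partial>(?D \<Otimes>\<^sub>M ?S))"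
    unfolding L2_inner_def Omega_measure_eq by (rule integral_distr[OF Omega_param_measurable mf]) simp
  also have "\<dots> = (\<integral>t. ?G (fst t) * (?y (fst (snd t)) * ?z (snd (snd t))) \<partial>(?D \<Otimes>\<^sub>M ?S))"
  proof (rule Bochner_Integration.integral_cong[OF refl])
    fix t assume t: "t \<in> space (?D \<Otimes>\<^sub>M ?S)"
    obtain \<phi> \<omega>1 \<omega>2 where tt: "t = (\<phi>, \<omega>1, \<omega>2)" by (metis surj_pair)
    have d: "\<phi> \<in> {0..pi/2}" "\<omega>1 \<in> sphere 0 1" "\<omega>2 \<in> sphere 0 1"
      using t unfolding tt space_pair_measure by auto
    show "?f (Omega_param (real \<alpha>) t) = ?G (fst t) * (?y (fst (snd t)) * ?z (snd (snd t)))"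
      unfolding tt e e' product_fun_param[OF i[unfolded e] d] product_fun_param[OF i'[unfolded e'] d] by simp
  qed
  also have "\<dots> = (\<integral>\<phi>. ?G \<phi> \<partial>?D) * (\<integral>t. ?y (fst t) * ?z (snd t) \<partial>?S)"
    by (rule integral_product_measure(1)[OF fD fS bG integral_product_measure(2)[OF finite_sphere_measure finite_sphere_measure by1 bz]])
  also have "(\<integral>t. ?y (fst t) * ?z (snd t) \<partial>?S) = L2_inner sphere_measure (Y l p) (Y l' p') * L2_inner sphere_measure (Z j q) (Z j' q')"
    unfolding L2_inner_def by (rule integral_product_measure(1)[OF finite_sphere_measure finite_sphere_measure by1 bz])
  also have "\<dots> = (if i = i' then 1 else 0)"
    unfolding inner_Y[OF pq(1) pq'(1)] inner_Z[OF pq(2) pq'(2)] by (auto simp: e e')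
  finally have I: "L2_inner (Omega_measure (real \<alpha>) :: ((real^'n) \<times> (real^'m)) measure) (product_fun k i) (product_fun k i') = (\<integral>\<phi>. ?G \<phi> \<partial>?D) * (if i = i' then 1 else 0)" .
  show ?thesis
  proof (cases "i = i'")
    case True
    then have "l' = l" "j' = j" by (auto simp: e e')
    then have "?G = (\<lambda>\<phi>. complex_of_real (indicator {0<..<pi/2} \<phi> * (h_fun (real \<alpha>) CARD('n) CARD('m) k l j \<phi>)\<^sup>2))"
      by (auto simp: fun_eq_iff power2_eq_square indicator_def)
    then show ?thesis using I integral_h_squared[of k l j] unfolding if_P[OF True] by (simp add: e)
  next
    case False
    then show ?thesis using I by simp
  qed
qed

lemma hn_pos: "h_norm2 \<alpha> CARD('n) CARD('m) k l j > 0"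
  unfolding h_norm2_def
proof (rule jacobi_norm2_pos)
  have "0 \<le> mu (real \<alpha>) CARD('n) l" unfolding mu_def using n by (intro divide_nonneg_nonneg) auto
  then show "- 1/2 \<le> mu (real \<alpha>) CARD('n) l" by simp
  show "- 1/2 \<le> gam CARD('m) j - 1" using m by (simp add: gam_def)
qed

lemma unit_fun_bounded_measurable: "i \<in> idx k \<Longrightarrow> bounded_measurable (Omega_measure (real \<alpha>) :: ((real^'n) \<times> (real^'m)) measure) (unit_fun k i)"
  unfolding unit_fun_def[abs_def] by (intro bounded_measurable_intros product_fun_bounded_measurable)

lemma orthonormal_unit_fun: "orthonormal_basis (Omega_measure (real \<alpha>) :: ((real^'n) \<times> (real^'m)) measure) (idx k) (unit_fun k) (H_space (real \<alpha>) Y Z k)"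
  unfolding orthonormal_basis_def
proof (intro conjI ballI finite_idx)
  fix i i' assume i: "i \<in> idx k" and i': "i' \<in> idx k"
  let ?c = "\<lambda>i. complex_of_real (1 / sqrt (h_norm2 \<alpha> CARD('n) CARD('m) k (fst (fst i)) (snd (fst i))))"
  have "L2_inner (Omega_measure (real \<alpha>) :: ((real^'n) \<times> (real^'m)) measure) (unit_fun k i) (unit_fun k i') = ?c i * ?c i' * L2_inner (Omega_measure (real \<alpha>) :: ((real^'n) \<times> (real^'m)) measure) (product_fun k i) (product_fun k i')"
    using \<Omega>.L2_inner_sum[of "{i}" "product_fun k" "{i'}" "product_fun k" ?c ?c] i i' product_fun_bounded_measurable
    by (simp add: unit_fun_def[abs_def])
  also have "\<dots> = (if i = i' then 1 else 0)"
  proof -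
    have X: "?c i * ?c i * of_real (h_norm2 \<alpha> CARD('n) CARD('m) k (fst (fst i)) (snd (fst i))) = 1"
      using hn_pos[of k "fst (fst i)" "snd (fst i)"] by (simp flip: of_real_mult)
    show ?thesis
    proof (cases "i = i'")
      case True
      show ?thesis unfolding True[symmetric] inner_product_fun[OF i i] if_P[OF refl] by (rule X)
    next
      case False
      then show ?thesis unfolding inner_product_fun[OF i i'] by simp
    qed
  qed
  finally show "L2_inner (Omega_measure (real \<alpha>) :: ((real^'n) \<times> (real^'m)) measure) (unit_fun k i) (unit_fun k i') = (if i = i' then 1 else 0)" .
next
  let ?c = "\<lambda>i. complex_of_real (1 / sqrt (h_norm2 \<alpha> CARD('n) CARD('m) k (fst (fst i)) (snd (fst i))))"
  show "cspan (unit_fun k ` idx k) = H_space (real \<alpha>) Y Z k"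
    unfolding H_space_eq
  proof (intro equalityI cfun.span_minimal cfun.subspace_span subsetI)
    fix f assume "f \<in> unit_fun k ` idx k"
    then obtain i where i: "i \<in> idx k" "f = (\<lambda>z. ?c i * product_fun k i z)" by (auto simp: unit_fun_def[abs_def])
    show "f \<in> cspan (product_fun k ` idx k)" unfolding i(2) by (intro cfun.span_scale cfun.span_base imageI i(1))
  next
    fix f assume "f \<in> product_fun k ` idx k"
    then obtain i where i: "i \<in> idx k" "f = product_fun k i" by auto
    have "f = (\<lambda>z. inverse (?c i) * unit_fun k i z)"
      using hn_pos[of k "fst (fst i)" "snd (fst i)"] by (auto simp: i(2) unit_fun_def fun_eq_iff)
    then show "f \<in> cspan (unit_fun k ` idx k)"
      using cfun.span_scale[OF cfun.span_base[OF imageI[OF i(1), of "unit_fun k"]], of "inverse (?c i)"] by simp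
  qed
qed

text \<open>A bound at every point of \<Omega>. Where x = 0 or y = 0 the kernel is zero because a
  harmonic is evaluated at the junk value 0; at all other points \<phi> is interior, where
  \<open>C3\<close> applies.\<close>

lemma product_fun_kernel_le:
  assumes C1: "\<And>l x. kernel_diag {1..harmonics_dim TYPE(real^'n) l} (Y l) x \<le> C1 * (real l + 1) ^ (CARD('n) - 2)"
    and C2: "\<And>j x. kernel_diag {1..harmonics_dim TYPE(real^'m) j} (Z j) x \<le> C2 * (real j + 1) ^ (CARD('m) - 2)"
    and C3: "\<And>k \<phi>. \<phi> \<in> {0<..<pi/2} \<Longrightarrow> h_sum \<alpha> CARD('n) CARD('m) k \<phi> \<le> C3 * (real k + 1) ^ (CARD('n) + CARD('m) - 2)"
    and pos: "C1 \<ge> 0" "C2 \<ge> 0" "C3 \<ge> 0" and z: "z \<in> Omega (real \<alpha>)"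
  shows "kernel_diag (idx k) (unit_fun k) z \<le> C1 * C2 * C3 * (real k + 1) ^ (CARD('n) + CARD('m) - 2)"
proof -
  let ?\<phi> = "phi (real \<alpha>) z"
  let ?K1 = "\<lambda>l. kernel_diag {1..harmonics_dim TYPE(real^'n) l} (Y l) (omega1 z)"
  let ?K2 = "\<lambda>j. kernel_diag {1..harmonics_dim TYPE(real^'m) j} (Z j) (omega2 z)"
  let ?h = "\<lambda>l j. (h_fun (real \<alpha>) CARD('n) CARD('m) k l j ?\<phi>)\<^sup>2 / h_norm2 \<alpha> CARD('n) CARD('m) k l j"
  have h0: "?h l j \<ge> 0" for l j using hn_pos[of k l j] by simp
  have sq: "(cmod (unit_fun k ((l, j), (p, q)) z))\<^sup>2 = ?h l j * ((cmod (Y l p (omega1 z)))\<^sup>2 * (cmod (Z j q (omega2 z)))\<^sup>2)" for l j p q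
    using z hn_pos[of k l j]
    by (simp add: unit_fun_def product_fun_def norm_mult norm_divide power_mult_distrib power_divide)
  have K: "kernel_diag (idx k) (unit_fun k) z = (\<Sum>(l, j)\<in>pairs \<alpha> k. ?h l j * (?K1 l * ?K2 j))"
  proof -
    have "kernel_diag (idx k) (unit_fun k) z = (\<Sum>lj\<in>pairs \<alpha> k. \<Sum>pq\<in>{1..harmonics_dim TYPE(real^'n) (fst lj)} \<times> {1..harmonics_dim TYPE(real^'m) (snd lj)}. (cmod (unit_fun k (lj, pq) z))\<^sup>2)"
      unfolding kernel_diag_def idx_def by (subst sum.Sigma) (auto simp: finite_pairs split_def)
    also have "\<dots> = (\<Sum>(l, j)\<in>pairs \<alpha> k. ?h l j * (?K1 l * ?K2 j))"
    proof (intro sum.cong refl)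
      fix lj :: "nat \<times> nat"
      obtain l j where lj: "lj = (l, j)" by (cases lj)
      have "(\<Sum>pq\<in>{1..harmonics_dim TYPE(real^'n) l} \<times> {1..harmonics_dim TYPE(real^'m) j}. (cmod (unit_fun k ((l, j), pq) z))\<^sup>2)
        = (\<Sum>(p, q)\<in>{1..harmonics_dim TYPE(real^'n) l} \<times> {1..harmonics_dim TYPE(real^'m) j}. ?h l j * ((cmod (Y l p (omega1 z)))\<^sup>2 * (cmod (Z j q (omega2 z)))\<^sup>2))"
        by (intro sum.cong refl) (auto simp: sq)
      also have "\<dots> = ?h l j * (?K1 l * ?K2 j)"
      proof -
        have "(\<Sum>(p, q)\<in>A \<times> B. c * (f p * g q)) = c * (sum f A * sum g B)" for A B c and f g :: "nat \<Rightarrow> real"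
          unfolding sum_product sum.cartesian_product by (simp only: sum_distrib_left split_def)
        then show ?thesis unfolding kernel_diag_def .
      qed
      finally show "(\<Sum>pq\<in>{1..harmonics_dim TYPE(real^'n) (fst lj)} \<times> {1..harmonics_dim TYPE(real^'m) (snd lj)}. (cmod (unit_fun k (lj, pq) z))\<^sup>2)
        = (case lj of (l, j) \<Rightarrow> ?h l j * (?K1 l * ?K2 j))" by (simp add: lj)
    qed
    finally show ?thesis .
  qed
  note pa = polar_angle_Omega[OF of_nat_0_le_iff z] and ph = phi_Omega[OF of_nat_0_le_iff z]
  show ?thesis
  proof (cases "fst z = 0 \<or> snd z = 0")
    case True
    have z0: "?K1 l * ?K2 j = 0" for l j
    proof -
      have "Y l p 0 = 0" if "p \<in> {1..harmonics_dim TYPE(real^'n) l}" for p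
        by (rule spherical_harmonics_borel_bounded(3)[OF orthonormal_basis_mem[OF Y that]])
      moreover have "Z j q 0 = 0" if "q \<in> {1..harmonics_dim TYPE(real^'m) j}" for q
        by (rule spherical_harmonics_borel_bounded(3)[OF orthonormal_basis_mem[OF Z that]])
      moreover have "omega1 z = 0 \<or> omega2 z = 0" using True by (auto simp: omega1_def omega2_def)
      ultimately show ?thesis by (auto simp: kernel_diag_def)
    qed
    have "kernel_diag (idx k) (unit_fun k) z = 0"
      unfolding K by (simp only: z0 mult_zero_right split_def sum.neutral_const)
    then show ?thesis using pos by simp
  next
    case False
    have "?\<phi> \<noteq> 0"
    proof
      assume "?\<phi> = 0"
      then have "norm (fst z) = 0" using pa(3) by (simp add: ph)
      then show False using False by simp
    qed
    moreover have "?\<phi> \<noteq> pi/2"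
    proof
      assume "?\<phi> = pi/2"
      then have pe: "polar_angle (real \<alpha>) z = pi/2" unfolding ph .
      have "(real \<alpha> + 1) * norm (snd z) = 0" unfolding pa(2)[symmetric] pe by (rule cos_pi_half)
      then show False using False by (simp add: add_eq_0_iff)
    qed
    ultimately have \<phi>: "?\<phi> \<in> {0<..<pi/2}" using pa(1) by (auto simp: ph)
    have "kernel_diag (idx k) (unit_fun k) z \<le> (\<Sum>(l, j)\<in>pairs \<alpha> k. ?h l j * ((C1 * (real l + 1) ^ (CARD('n) - 2)) * (C2 * (real j + 1) ^ (CARD('m) - 2))))"
      unfolding K
    proof (intro sum_mono, clarify)
      fix l j
      show "?h l j * (?K1 l * ?K2 j) \<le> ?h l j * ((C1 * (real l + 1) ^ (CARD('n) - 2)) * (C2 * (real j + 1) ^ (CARD('m) - 2)))"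
        using pos by (intro mult_left_mono mult_mono C1 C2 h0 kernel_diag_nonneg) auto
    qed
    also have "\<dots> = C1 * C2 * h_sum \<alpha> CARD('n) CARD('m) k ?\<phi>"
      unfolding h_sum_def sum_distrib_left by (intro sum.cong refl) (auto simp: mult_ac)
    also have "\<dots> \<le> C1 * C2 * (C3 * (real k + 1) ^ (CARD('n) + CARD('m) - 2))"
      using pos by (intro mult_left_mono C3[OF \<phi>]) auto
    finally show ?thesis by (simp add: mult.assoc)
  qed
qed

text \<open>The choice in \<open>G_kernel\<close> is among bases indexed by
  \<open>{..<cdim _}\<close>, and an enumeration b of \<open>idx k\<close> shows that there is one.
  About the chosen functions only membership in the span is known, and boundedness and measurability
  follow from it.\<close>

lemma G_kernel_representation:
  obtains e where "orthonormal_basis (Omega_measure (real \<alpha>)) {..<cdim (H_space (real \<alpha>) Y Z k)} e (H_space (real \<alpha>) Y Z k)"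
    "\<And>i. i < cdim (H_space (real \<alpha>) Y Z k) \<Longrightarrow> bounded_measurable (Omega_measure (real \<alpha>)) (e i)"
    "\<And>z \<zeta>. G_kernel (real \<alpha>) Y Z k z \<zeta> = (\<Sum>i<cdim (H_space (real \<alpha>) Y Z k). e i z * cnj (e i \<zeta>))"
proof -
  let ?H = "H_space (real \<alpha>) Y Z k" and ?M = "Omega_measure (real \<alpha>) :: ((real^'n) \<times> (real^'m)) measure"
  note U = orthonormal_unit_fun[of k]
  have on: "L2_inner ?M (unit_fun k i) (unit_fun k i') = (if i = i' then 1 else 0)" if "i \<in> idx k" "i' \<in> idx k" for i i'
    using U that unfolding orthonormal_basis_def by blast
  have H: "?H = cspan (unit_fun k ` idx k)" using U unfolding orthonormal_basis_def by blast
  note ind = \<Omega>.orthonormal_inj_independent[OF finite_idx on unit_fun_bounded_measurable]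
  have "cdim (cspan (unit_fun k ` idx k)) = card (unit_fun k ` idx k)"
    by (rule cfun.dim_span_eq_card_independent) (rule ind(2))
  moreover have "inj_on (unit_fun k) (idx k)" by (rule ind(1))
  ultimately have "cdim ?H = card (idx k)"
    unfolding H by (simp only: card_image)
  then obtain b where b: "bij_betw b {..<cdim ?H} (idx k)"
    using finite_same_card_bij[of "{..<cdim ?H}" "idx k"] finite_idx by auto
  have "orthonormal_basis ?M {..<cdim ?H} (\<lambda>i. unit_fun k (b i)) ?H"
    unfolding orthonormal_basis_def
  proof (intro conjI ballI)
    fix i i' assume ii: "i \<in> {..<cdim ?H}" "i' \<in> {..<cdim ?H}"
    have "b i \<in> idx k" "b i' \<in> idx k" "b i = b i' \<longleftrightarrow> i = i'"
      using bij_betwE[OF b] inj_on_eq_iff[OF bij_betw_imp_inj_on[OF b]] ii by auto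
    then show "L2_inner ?M (unit_fun k (b i)) (unit_fun k (b i')) = (if i = i' then 1 else 0)"
      using on[of "b i" "b i'"] by simp
  next
    have "(\<lambda>i. unit_fun k (b i)) ` {..<cdim ?H} = unit_fun k ` (b ` {..<cdim ?H})" by (simp only: image_image)
    also have "b ` {..<cdim ?H} = idx k" using b by (simp add: bij_betw_def)
    finally show "cspan ((\<lambda>i. unit_fun k (b i)) ` {..<cdim ?H}) = ?H" unfolding H by simp
  qed simp
  moreover define e where "e = (SOME e. orthonormal_basis ?M {..<cdim ?H} e ?H)"
  ultimately have e: "orthonormal_basis ?M {..<cdim ?H} e ?H"
    by (simp only: someI[where P="\<lambda>e. orthonormal_basis ?M {..<cdim ?H} e ?H"])
  show thesis
  proof (rule that[OF e])
    show "G_kernel (real \<alpha>) Y Z k z \<zeta> = (\<Sum>i<cdim ?H. e i z * cnj (e i \<zeta>))" for z \<zeta>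
      unfolding G_kernel_def Let_def e_def ..
    fix i assume "i < cdim ?H"
    then have "e i \<in> cspan (unit_fun k ` idx k)"
      using orthonormal_basis_mem[OF e, of i] unfolding H by simp
    then obtain u where u: "\<And>x. e i x = (\<Sum>j\<in>idx k. u j * unit_fun k j x)"
      using cspan_image_finite[OF finite_idx] by blast
    have "bounded_measurable ?M (\<lambda>x. \<Sum>j\<in>idx k. u j * unit_fun k j x)"
      by (intro bounded_measurable_intros unit_fun_bounded_measurable)
    moreover have "e i = (\<lambda>x. \<Sum>j\<in>idx k. u j * unit_fun k j x)"
      by (rule ext) (rule u)
    ultimately show "bounded_measurable ?M (e i)" by (simp only:)
  qed
qed

lemma P_proj_bound:
  assumes B: "\<And>z. z \<in> Omega (real \<alpha>) \<Longrightarrow> kernel_diag (idx k) (unit_fun k) z \<le> B"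
    and g: "integrable (Omega_measure (real \<alpha>)) g"
  shows "Linf_norm (Omega_measure (real \<alpha>)) (P_proj (real \<alpha>) Y Z k g) \<le> ereal (B * L1_norm (Omega_measure (real \<alpha>)) g)"
proof -
  let ?H = "H_space (real \<alpha>) Y Z k" and ?M = "Omega_measure (real \<alpha>) :: ((real^'n) \<times> (real^'m)) measure"
  obtain e where e: "orthonormal_basis ?M {..<cdim ?H} e ?H" "\<And>i. i < cdim ?H \<Longrightarrow> bounded_measurable ?M (e i)"
    and G: "\<And>z \<zeta>. G_kernel (real \<alpha>) Y Z k z \<zeta> = (\<Sum>i<cdim ?H. e i z * cnj (e i \<zeta>))"
    using G_kernel_representation by blast
  have KB: "kernel_diag {..<cdim ?H} e z \<le> B" if "z \<in> Omega (real \<alpha>)" for z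
    \<comment> \<open>Independence of the basis carries the bound from the explicit basis to the
      chosen one.\<close>
    using \<Omega>.kernel_diag_unique_le[OF e(1) _ orthonormal_unit_fun unit_fun_bounded_measurable, of z] e(2) B[OF that] by fastforce
  have GB: "cmod (G_kernel (real \<alpha>) Y Z k z \<zeta>) \<le> B" if "z \<in> Omega (real \<alpha>)" "\<zeta> \<in> Omega (real \<alpha>)" for z \<zeta>
  proof -
    have "cmod (G_kernel (real \<alpha>) Y Z k z \<zeta>) \<le> (\<Sum>i<cdim ?H. cmod (e i z) * cmod (e i \<zeta>))"
      unfolding G by (rule order_trans[OF norm_sum]) (simp add: norm_mult)
    \<comment> \<open>The inequality of arithmetic and geometric means, term by term, suffices in
      place of Cauchy-Schwarz: the mean of two diagonal values is still at most B.\<close>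
    also have "\<dots> \<le> (\<Sum>i<cdim ?H. ((cmod (e i z))\<^sup>2 + (cmod (e i \<zeta>))\<^sup>2) / 2)"
    proof (rule sum_mono)
      fix i
      show "cmod (e i z) * cmod (e i \<zeta>) \<le> ((cmod (e i z))\<^sup>2 + (cmod (e i \<zeta>))\<^sup>2) / 2"
        using sum_squares_bound[of "cmod (e i z)" "cmod (e i \<zeta>)"] by simp
    qed
    also have "\<dots> = (kernel_diag {..<cdim ?H} e z + kernel_diag {..<cdim ?H} e \<zeta>) / 2"
      by (simp add: kernel_diag_def sum.distrib sum_divide_distrib[symmetric])
    finally show ?thesis using KB[OF that(1)] KB[OF that(2)] by simp
  qed
  have [measurable]: "g \<in> borel_measurable ?M" using g by auto
  have [measurable]: "e i \<in> borel_measurable ?M" if "i < cdim ?H" for i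
    using e(2)[OF that] by (simp add: bounded_measurable_def)
  have int: "integrable ?M (\<lambda>\<zeta>. cnj (e i \<zeta>) * g \<zeta>)" if i: "i < cdim ?H" for i
  proof -
    obtain A where A: "\<forall>x\<in>space ?M. cmod (e i x) \<le> A" using e(2)[OF i] unfolding bounded_measurable_def by blast
    have "integrable ?M (\<lambda>\<zeta>. A * cmod (g \<zeta>))" using g by simp
    moreover have "(\<lambda>\<zeta>. cnj (e i \<zeta>) * g \<zeta>) \<in> borel_measurable ?M"
    proof (intro borel_measurable_times)
      show "(\<lambda>\<zeta>. cnj (e i \<zeta>)) \<in> borel_measurable ?M"
        using bounded_measurable_cnj[OF e(2)[OF i]] by (simp add: bounded_measurable_def)
    qed measurable
    moreover have "AE \<zeta> in ?M. norm (cnj (e i \<zeta>) * g \<zeta>) \<le> norm (A * cmod (g \<zeta>))"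
    proof (rule AE_I2)
      fix \<zeta> assume "\<zeta> \<in> space ?M"
      then have "cmod (e i \<zeta>) \<le> \<bar>A\<bar>" using A by force
      then show "norm (cnj (e i \<zeta>) * g \<zeta>) \<le> norm (A * cmod (g \<zeta>))" by (simp add: norm_mult abs_mult mult_right_mono)
    qed
    ultimately show ?thesis by (rule Bochner_Integration.integrable_bound)
  qed
  \<comment> \<open>The finite expansion serves the measurability of the projected function, which
    \<open>esssup_I\<close> asks for.\<close>
  have P: "P_proj (real \<alpha>) Y Z k g z = (\<Sum>i<cdim ?H. e i z * (\<integral>\<zeta>. cnj (e i \<zeta>) * g \<zeta> \<partial>?M))" for z
  proof -
    have "P_proj (real \<alpha>) Y Z k g z = (\<integral>\<zeta>. (\<Sum>i<cdim ?H. e i z * (cnj (e i \<zeta>) * g \<zeta>)) \<partial>?M)"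
      unfolding P_proj_def G by (simp add: sum_distrib_right mult.assoc)
    also have "\<dots> = (\<Sum>i<cdim ?H. \<integral>\<zeta>. e i z * (cnj (e i \<zeta>) * g \<zeta>) \<partial>?M)"
      by (rule Bochner_Integration.integral_sum) (use int in auto)
    finally show ?thesis by simp
  qed
  have "P_proj (real \<alpha>) Y Z k g \<in> borel_measurable ?M"
    unfolding P[abs_def] by (intro borel_measurable_sum borel_measurable_times borel_measurable_const) auto
  then have "(\<lambda>z. ereal (cmod (P_proj (real \<alpha>) Y Z k g z))) \<in> borel_measurable ?M" by measurable
  moreover have "AE z in ?M. ereal (cmod (P_proj (real \<alpha>) Y Z k g z)) \<le> ereal (B * L1_norm ?M g)"
  proof (rule AE_I2)
    fix z assume "z \<in> space ?M"
    then have z: "z \<in> Omega (real \<alpha>)" by simp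
    have B0: "B \<ge> 0" using order_trans[OF norm_ge_zero GB[OF z z]] .
    have "cmod (P_proj (real \<alpha>) Y Z k g z) \<le> (\<integral>\<zeta>. cmod (G_kernel (real \<alpha>) Y Z k z \<zeta> * g \<zeta>) \<partial>?M)"
      unfolding P_proj_def by (rule integral_norm_bound)
    also have "\<dots> \<le> (\<integral>\<zeta>. B * cmod (g \<zeta>) \<partial>?M)"
    proof (rule integral_mono')
      show "integrable ?M (\<lambda>\<zeta>. B * cmod (g \<zeta>))" using g by simp
      fix \<zeta> assume "\<zeta> \<in> space ?M"
      then show "cmod (G_kernel (real \<alpha>) Y Z k z \<zeta> * g \<zeta>) \<le> B * cmod (g \<zeta>)"
        using GB[OF z] by (simp add: norm_mult mult_right_mono)
      show "0 \<le> B * cmod (g \<zeta>)" using B0 by simp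
    qed
    also have "\<dots> = B * L1_norm ?M g" by (simp add: L1_norm_def)
    finally show "ereal (cmod (P_proj (real \<alpha>) Y Z k g z)) \<le> ereal (B * L1_norm ?M g)" by simp
  qed
  ultimately show ?thesis unfolding Linf_norm_def by (rule esssup_I)
qed

end

theorem theorem4p4:
  fixes \<alpha> :: nat
    and Y :: "nat \<Rightarrow> nat \<Rightarrow> real^'n \<Rightarrow> complex"
    and Z :: "nat \<Rightarrow> nat \<Rightarrow> real^'m \<Rightarrow> complex"
  assumes Y: "\<And>l. orthonormal_basis sphere_measure {1..harmonics_dim TYPE(real^'n) l} (Y l)
                (spherical_harmonics l)"
    and Z: "\<And>j. orthonormal_basis sphere_measure {1..harmonics_dim TYPE(real^'m) j} (Z j)
                (spherical_harmonics j)"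
    and params: "CARD('n) \<ge> 4 \<and> CARD('m) \<ge> 2 \<and> \<alpha> \<ge> 1 \<or>
                 CARD('n) \<in> {2, 3} \<and> CARD('m) \<ge> 2 \<and> \<alpha> = 1"
  shows "\<exists>C::real. C > 0 \<and>
    (\<forall>k::nat. \<forall>g :: (real^'n) \<times> (real^'m) \<Rightarrow> complex.
       integrable (Omega_measure (real \<alpha>)) g \<longrightarrow>
       Linf_norm (Omega_measure (real \<alpha>)) (P_proj (real \<alpha>) Y Z k g)
         \<le> ereal (C * (real k + 1) ^ (CARD('n) + CARD('m) - 2) * L1_norm (Omega_measure (real \<alpha>)) g))"
proof -
  have n: "CARD('n) \<ge> 2" and m: "CARD('m) \<ge> 2" using params by auto
  interpret harmonic_bases \<alpha> Y Z by unfold_locales (rule Y, rule Z, rule n, rule m)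
  obtain C1 where C1: "C1 > 0" "\<And>l x. kernel_diag {1..harmonics_dim TYPE(real^'n) l} (Y l) x \<le> C1 * (real l + 1) ^ (CARD('n) - 2)"
    using spherical_harmonics_kernel_bound[OF Y n] by blast
  obtain C2 where C2: "C2 > 0" "\<And>j x. kernel_diag {1..harmonics_dim TYPE(real^'m) j} (Z j) x \<le> C2 * (real j + 1) ^ (CARD('m) - 2)"
    using spherical_harmonics_kernel_bound[OF Z m] by blast
  obtain C3 where C3: "C3 > 0" "\<And>k \<phi>. \<phi> \<in> {0<..<pi/2} \<Longrightarrow> h_sum \<alpha> CARD('n) CARD('m) k \<phi> \<le> C3 * (real k + 1) ^ (CARD('n) + CARD('m) - 2)"
    using h_sum_bound[OF params] by blast
  have "kernel_diag (idx k) (unit_fun k) z \<le> C1 * C2 * C3 * (real k + 1) ^ (CARD('n) + CARD('m) - 2)" if "z \<in> Omega (real \<alpha>)" for k z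
    using product_fun_kernel_le[OF C1(2) C2(2) C3(2) _ _ _ that] C1(1) C2(1) C3(1) by simp
  from P_proj_bound[OF this] C1(1) C2(1) C3(1) show ?thesis
    by (intro exI[of _ "C1 * C2 * C3"]) auto
qed

end
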